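(* Let $G(2,\mathbb{O})$ be the Grassmannian of oriented real $2$-planes in $\mathbb{O}\cong\mathbb{R}^8$. Then: (1) $G(2,\mathbb{O})=\mathrm{Spin}(7)/\mathrm{U}(3)$ as a homogeneous space, and the $\mathrm{U}(3)$-structure defines a $\mathrm{Spin}(7)$-invariant, nonintegrable almost complex structure on $G(2,\mathbb{O})$, namely the one specified in the context. (2) Nondegenerate $r$-oriented $2$-ruled Cayley cones in $\mathbb{O}$ are equivalent to immersed pseudoholomorphic curves in $G(2,\mathbb{O})$ with respect to this almost complex structure, under the correspondence that associates to a cone $(M,\pi,\Sigma)$ the map $\gamma:\Sigma\to G(2,\mathbb{O})$, $\gamma(\sigma)=\pi^{-1}(\sigma)$, and to an immersion $\gamma:\Sigma\to G(2,\mathbb{O})$ the cone swept out by the $2$-planes $\gamma(\sigma)$, $\sigma\in\Sigma$.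
   Context: Identify the octonions $\mathbb{O}$ with Euclidean $\mathbb{R}^8$ with coordinates $x^1,\dots,x^8$, and write $dx^{ijkl}=dx^i\wedge dx^j\wedge dx^k\wedge dx^l$. The Cayley form is $$\Phi=dx^{5678}-dx^{5128}-dx^{5348}-dx^{6138}-dx^{6428}-dx^{7148}-dx^{7238}+dx^{1234}-dx^{3467}-dx^{1267}-dx^{2457}+dx^{1357}-dx^{2356}-dx^{1456}.$$ $\mathrm{Spin}(7)\subset \mathrm{SO}(8)$ is the stabilizer of $\Phi$. It acts transitively on orthonormal pairs in $\mathbb{O}$. Cayley condition: $\Phi$ is the real part of the totally skew quadruple cross product on $\mathbb{O}$; let $\psi_1,\dots,\psi_7$ be the components of its imaginary part. An immersed $4$-fold is Cayley if all $\psi_m$ pull back to $0$; equivalently, $|\Phi(v_1,v_2,v_3,v_4)|=1$ for every orthonormal basis $v_1,\dots,v_4$ of every tangent space. For cones this is required wherever the $4$-fold is smooth (immersed). Adapted frames: a $\mathrm{Spin}(7)$-adapted frame is an orthonormal frame $(e_1,\dots,e_8)$ that is the image of the standard basis under an element of $\mathrm{Spin}(7)$; write $de_i=e_j\omega_{ji}$. Every oriented $2$-plane is $e_1\wedge e_2$ for some adapted frame. Almost complex structure on $G(2,\mathbb{O})$: at $E=e_1\wedge e_2$ the $(1,0)$-forms are spanned by $$\omega_{31}+i\omega_{41},\ \omega_{32}+i\omega_{42},\ \omega_{61}-i\omega_{71},\ \omega_{62}-i\omega_{72},\ \omega_{51}-i\omega_{81},\ \omega_{52}-i\omega_{82}$$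 (this is independent of the choice of adapted frame). Equivalently, on $T_E G(2,\mathbb{O})=\mathrm{Hom}(E,E^\perp)$ it is $X\mapsto J_E\circ X$, where $J_E$ is the orthogonal complex structure on $\mathbb{O}$ with $J_Ee_1=e_2,\ J_Ee_3=e_4,\ J_Ee_6=-e_7,\ J_Ee_5=-e_8$. A $4$-fold $M\subset\mathbb{O}$ is $2$-ruled if there are a smooth surface $\Sigma$ and a smooth map $\pi:M\to\Sigma$ such that every $\pi^{-1}(\sigma)$ is a (possibly affine) $2$-plane in $\mathbb{O}$. It is $r$-oriented if there is a continuous choice of orientation of the planes $\pi^{-1}(\sigma)$. Translating these oriented planes to the origin gives a map $\gamma:\Sigma\to G(2,\mathbb{O})$; $(M,\pi,\Sigma)$ is nondegenerate if $\gamma$ is an immersion. A $2$-ruled cone is a $2$-ruled $4$-fold whose planes all pass through the origin; it is locally parametrized by $(r_1,r_2,\sigma)\mapsto r_1e_1(\sigma)+r_2e_2(\sigma)$ with $\gamma=e_1\wedge e_2$ (its planes are allowed to meet at the origin). A pseudoholomorphic curve in an almost complex manifold $(X,J)$ is a smooth map $\gamma:\Sigma\to X$ from a smooth surface such that $\gamma_*(T_\sigma\Sigma)$ is a $J$-complex line whenever it has real dimension two.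
   Formalization: In (2), a Cayley cone is shown to give a pseudoholomorphic curve only where its planes do not locally lie in one fixed Cayley 4-plane (a general ruling of such a 4-plane is a counterexample); the bijection is for nowhere planar cones and curves. The converse holds without exception. *)

theory Defs
  imports "HOL-Analysis.Analysis"
begin

section \<open>Smooth maps between subsets of Euclidean spaces\<close>

text \<open>\<open>Ck_on k S f\<close>, for an open set \<open>S\<close>, says that \<open>f\<close> is \<open>k\<close> times continuously differentiable on \<open>S\<close>.\<close>

primrec Ck_on :: "nat \<Rightarrow> 'a::real_normed_vector set \<Rightarrow> ('a \<Rightarrow> 'b::real_normed_vector) \<Rightarrow> bool" where
  "Ck_on 0 S f \<longleftrightarrow> continuous_on S f"
| "Ck_on (Suc k) S f \<longleftrightarrow>
     (\<forall>x\<in>S. f differentiable (at x)) \<and> (\<forall>v. Ck_on k S (\<lambda>x. frechet_derivative f (at x) v))"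

definition smooth_on :: "'a::real_normed_vector set \<Rightarrow> ('a \<Rightarrow> 'b::real_normed_vector) \<Rightarrow> bool" where
  "smooth_on S f \<longleftrightarrow> (\<forall>k. Ck_on k S f)"

text \<open>On an arbitrary subset \<open>X\<close>, smoothness means having local smooth extensions to open sets.\<close>

definition smooth_on_subset ::
    "'a::real_normed_vector set \<Rightarrow> ('a \<Rightarrow> 'b::real_normed_vector) \<Rightarrow> bool" where
  "smooth_on_subset X f \<longleftrightarrow>
     (\<forall>x\<in>X. \<exists>U g. open U \<and> x \<in> U \<and> smooth_on U g \<and> (\<forall>y\<in>X \<inter> U. g y = f y))"

definition tangent_space :: "'a::real_normed_vector set \<Rightarrow> 'a \<Rightarrow> 'a set" where
  "tangent_space X x =
     {v. \<exists>c. smooth_on UNIV c \<and> range c \<subseteq> X \<and> c 0 = x \<and> (c has_vector_derivative v) (at (0::real))}"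


section \<open>Almost complex structures on embedded submanifolds\<close>

definition almost_complex_structure ::
    "'a::real_normed_vector set \<Rightarrow> ('a \<Rightarrow> 'a \<Rightarrow> 'a) \<Rightarrow> bool" where
  "almost_complex_structure X J \<longleftrightarrow>
     (\<forall>x\<in>X. \<forall>u\<in>tangent_space X x. J x u \<in> tangent_space X x \<and> J x (J x u) = - u) \<and>
     (\<forall>x\<in>X. \<forall>u\<in>tangent_space X x. \<forall>v\<in>tangent_space X x. \<forall>a b.
        J x (a *\<^sub>R u + b *\<^sub>R v) = a *\<^sub>R J x u + b *\<^sub>R J x v) \<and>
     smooth_on_subset {(x, u). x \<in> X \<and> u \<in> tangent_space X x} (\<lambda>(x, u). J x u)"

text \<open>A \<open>J\<close>-holomorphic coordinate chart of \<open>X\<close> on \<open>X \<inter> U\<close>; the map \<open>f\<close> is given on the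
  open subset \<open>U\<close> of the ambient space, but on tangent vectors of \<open>X\<close> its derivative depends
  only on the restriction to \<open>X\<close>.\<close>

definition holomorphic_chart ::
    "'a::real_normed_vector set \<Rightarrow> ('a \<Rightarrow> 'a \<Rightarrow> 'a) \<Rightarrow> 'a set \<Rightarrow> ('a \<Rightarrow> complex^'k) \<Rightarrow> bool" where
  "holomorphic_chart X J U f \<longleftrightarrow>
     open U \<and> smooth_on U f \<and> inj_on f (X \<inter> U) \<and> open (f ` (X \<inter> U)) \<and>
     smooth_on (f ` (X \<inter> U)) (inv_into (X \<inter> U) f) \<and>
     (\<forall>y\<in>X \<inter> U. \<forall>v\<in>tangent_space X y.
        frechet_derivative f (at y) (J y v) = \<i> *s frechet_derivative f (at y) v)"

definition integrable_acs ::
    "'k::finite itself \<Rightarrow> 'a::real_normed_vector set \<Rightarrow> ('a \<Rightarrow> 'a \<Rightarrow> 'a) \<Rightarrow> bool" where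
  "integrable_acs _ X J \<longleftrightarrow>
     (\<forall>x\<in>X. \<exists>U (f :: 'a \<Rightarrow> complex^'k). x \<in> U \<and> holomorphic_chart X J U f)"


section \<open>Homogeneous spaces of matrix groups\<close>

definition matrix_group :: "(('a::semiring_1)^'n^'n) set \<Rightarrow> bool" where
  "matrix_group K \<longleftrightarrow> mat 1 \<in> K \<and> (\<forall>g\<in>K. \<forall>h\<in>K. g ** h \<in> K) \<and>
     (\<forall>g\<in>K. \<exists>h\<in>K. g ** h = mat 1 \<and> h ** g = mat 1)"

definition smooth_group_iso ::
    "(('a::real_normed_field)^'m^'m) set \<Rightarrow> (('b::real_normed_field)^'n^'n) set \<Rightarrow>
     ('a^'m^'m \<Rightarrow> 'b^'n^'n) \<Rightarrow> bool" where
  "smooth_group_iso H K \<phi> \<longleftrightarrow> bij_betw \<phi> H K \<and> (\<forall>a\<in>H. \<forall>b\<in>H. \<phi> (a ** b) = \<phi> a ** \<phi> b) \<and>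
     smooth_on_subset H \<phi> \<and> smooth_on_subset K (inv_into H \<phi>)"

text \<open>\<open>X = K/H\<close> as a homogeneous space: \<open>K\<close> acts smoothly and transitively on \<open>X\<close>, every isotropy
  group is isomorphic to \<open>H\<close> as a Lie group, and every orbit map \<open>K \<rightarrow> X\<close> has local smooth
  sections, so that it induces a diffeomorphism from the coset space onto \<open>X\<close>.\<close>

definition homogeneous_space ::
    "'x::real_normed_vector set \<Rightarrow> (real^'n^'n) set \<Rightarrow> (real^'n^'n \<Rightarrow> 'x \<Rightarrow> 'x) \<Rightarrow>
     (complex^'m^'m) set \<Rightarrow> bool" where
  "homogeneous_space X K act H \<longleftrightarrow>
     X \<noteq> {} \<and> matrix_group K \<and> matrix_group H \<and>
     (\<forall>g\<in>K. \<forall>x\<in>X. act g x \<in> X) \<and>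
     (\<forall>x\<in>X. act (mat 1) x = x) \<and>
     (\<forall>g\<in>K. \<forall>h\<in>K. \<forall>x\<in>X. act (g ** h) x = act g (act h x)) \<and>
     smooth_on_subset (K \<times> X) (\<lambda>(g, x). act g x) \<and>
     (\<forall>x\<in>X. \<forall>y\<in>X. \<exists>g\<in>K. act g x = y) \<and>
     (\<forall>x\<in>X. \<exists>\<phi>. smooth_group_iso H {g\<in>K. act g x = x} \<phi>) \<and>
     (\<forall>x\<in>X. \<forall>y\<in>X. \<exists>U s. open U \<and> y \<in> U \<and> smooth_on_subset (X \<inter> U) s \<and>
        (\<forall>z\<in>X \<inter> U. s z \<in> K \<and> act (s z) x = z))"

definition U3 :: "(complex^3^3) set" where
  "U3 = {A. A ** (\<chi> i j. cnj (A $ j $ i)) = mat 1}"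


section \<open>The Cayley form and \<open>Spin(7)\<close>\<close>

type_synonym octonion = "real^8"

text \<open>The index type \<open>8\<close> consists of the residues modulo 8, so \<open>x $ 8\<close> is the same coordinate
  as \<open>x $ 0\<close>; the eight coordinates are still \<open>x $ 1, \<dots>, x $ 8\<close>.\<close>

definition dx4 :: "8 \<Rightarrow> 8 \<Rightarrow> 8 \<Rightarrow> 8 \<Rightarrow> octonion \<Rightarrow> octonion \<Rightarrow> octonion \<Rightarrow> octonion \<Rightarrow> real" where
  "dx4 i j k l a b c d =
     det (vector [vector [a$i, a$j, a$k, a$l], vector [b$i, b$j, b$k, b$l],
                  vector [c$i, c$j, c$k, c$l], vector [d$i, d$j, d$k, d$l]] :: real^4^4)"

definition cayley_form :: "octonion \<Rightarrow> octonion \<Rightarrow> octonion \<Rightarrow> octonion \<Rightarrow> real" where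
  "cayley_form a b c d =
     dx4 5 6 7 8 a b c d - dx4 5 1 2 8 a b c d - dx4 5 3 4 8 a b c d - dx4 6 1 3 8 a b c d
     - dx4 6 4 2 8 a b c d - dx4 7 1 4 8 a b c d - dx4 7 2 3 8 a b c d + dx4 1 2 3 4 a b c d
     - dx4 3 4 6 7 a b c d - dx4 1 2 6 7 a b c d - dx4 2 4 5 7 a b c d + dx4 1 3 5 7 a b c d
     - dx4 2 3 5 6 a b c d - dx4 1 4 5 6 a b c d"

text \<open>The Spin(7)-adapted frames are the matrices in \<open>Spin7\<close>, with \<open>e\<^sub>i = column i F\<close>.\<close>

definition Spin7 :: "(real^8^8) set" where
  "Spin7 = {g. orthogonal_matrix g \<and> det g = 1 \<and>
     (\<forall>a b c d. cayley_form (g *v a) (g *v b) (g *v c) (g *v d) = cayley_form a b c d)}"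

definition cayley_plane :: "octonion set \<Rightarrow> bool" where
  "cayley_plane P \<longleftrightarrow> subspace P \<and> dim P = 4 \<and>
     (\<forall>v :: 4 \<Rightarrow> octonion. range v \<subseteq> P \<and> (\<forall>i j. v i \<bullet> v j = (if i = j then 1 else 0)) \<longrightarrow>
        \<bar>cayley_form (v 1) (v 2) (v 3) (v 4)\<bar> = 1)"


section \<open>The Grassmannian of oriented 2-planes and its almost complex structure\<close>

text \<open>An oriented 2-plane with oriented orthonormal basis \<open>u, v\<close> is represented by the bivector
  \<open>u \<and> v\<close>, here the skew matrix of \<open>x \<mapsto> (v \<bullet> x) u - (u \<bullet> x) v\<close>. This is the Pluecker embedding
  of \<open>G(2,\<O>)\<close> into the second exterior power of \<open>\<O>\<close>; changing the orientation changes the sign.\<close>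

type_synonym bivector = "real^8^8"

definition wedge :: "octonion \<Rightarrow> octonion \<Rightarrow> bivector" where
  "wedge u v = (\<chi> i j. u$i * v$j - v$i * u$j)"

definition G2O :: "bivector set" where
  "G2O = {wedge u v | u v. norm u = 1 \<and> norm v = 1 \<and> u \<bullet> v = 0}"

definition plane_of :: "bivector \<Rightarrow> octonion set" where
  "plane_of E = range (\<lambda>x. E *v x)"

text \<open>\<open>g (u \<and> v) = (g u) \<and> (g v)\<close>; the action is linear in the bivector, so it is also the
  induced action on tangent vectors.\<close>

definition act2 :: "real^8^8 \<Rightarrow> bivector \<Rightarrow> bivector" where
  "act2 g E = g ** E ** transpose g"

definition frame_plane :: "real^8^8 \<Rightarrow> bivector" where
  "frame_plane F = wedge (column 1 F) (column 2 F)"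

text \<open>\<open>omega F X j i\<close> is the value of \<open>\<omega>\<^sub>j\<^sub>i = e\<^sub>j \<bullet> de\<^sub>i\<close> (\<open>i = 1, 2\<close> and \<open>j \<ge> 3\<close>)
  at the frame \<open>F\<close> on a tangent vector \<open>X\<close> of the Grassmannian at \<open>e\<^sub>1 \<and> e\<^sub>2\<close>:
  from \<open>X = de\<^sub>1 \<and> e\<^sub>2 + e\<^sub>1 \<and> de\<^sub>2\<close> one gets \<open>e\<^sub>j \<bullet> X e\<^sub>2 = e\<^sub>j \<bullet> de\<^sub>1\<close> and
  \<open>e\<^sub>j \<bullet> X e\<^sub>1 = - e\<^sub>j \<bullet> de\<^sub>2\<close>; see lemma \<open>omega_moving_frame\<close>.\<close>

definition omega :: "real^8^8 \<Rightarrow> bivector \<Rightarrow> 8 \<Rightarrow> 8 \<Rightarrow> real" where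
  "omega F X j i =
     (if i = 1 then column j F \<bullet> (X *v column 2 F) else - (column j F \<bullet> (X *v column 1 F)))"

lemma wedge_mult: "wedge u v *v x = (v \<bullet> x) *\<^sub>R u - (u \<bullet> x) *\<^sub>R v"
  by (simp add: vec_eq_iff wedge_def matrix_vector_mult_def inner_vec_def algebra_simps
      sum_subtractf sum_distrib_left)

lemma bounded_bilinear_wedge: "bounded_bilinear wedge"
  by (rule bilinear_conv_bounded_bilinear[THEN iffD1], unfold bilinear_def)
    (auto simp: vec_eq_iff wedge_def algebra_simps intro!: linearI)

lemma omega_moving_frame:
  fixes F :: "real \<Rightarrow> real^8^8"
  assumes orth: "\<And>i j. column i (F t) \<bullet> column j (F t) = (if i = j then 1 else 0)"
    and F': "(F has_vector_derivative F') (at t)"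
    and X: "((\<lambda>s. frame_plane (F s)) has_vector_derivative X) (at t)"
    and j: "j \<noteq> 1" "j \<noteq> 2" and i: "i = 1 \<or> i = 2"
  shows "omega (F t) X j i = column j (F t) \<bullet> column i F'"
proof -
  have lin: "bounded_linear (\<lambda>A :: real^8^8. column k A)" for k
    by (rule linear_conv_bounded_linear[THEN iffD1])
      (auto simp: column_def vec_eq_iff intro!: linearI)
  have c: "((\<lambda>s. column k (F s)) has_vector_derivative column k F') (at t)" for k
    by (rule bounded_linear.has_vector_derivative[OF lin F'])
  have "((\<lambda>s. frame_plane (F s)) has_vector_derivative
      wedge (column 1 (F t)) (column 2 F') + wedge (column 1 F') (column 2 (F t))) (at t)"
    unfolding frame_plane_def
    by (rule bounded_bilinear.has_vector_derivative[OF bounded_bilinear_wedge c c])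
  then have "X = wedge (column 1 (F t)) (column 2 F') + wedge (column 1 F') (column 2 (F t))"
    using X vector_derivative_unique_at by blast
  then show ?thesis
    using i j
    by (auto simp: omega_def wedge_mult matrix_vector_mult_add_rdistrib inner_diff_right
        inner_add_right orth)
qed

text \<open>The values on \<open>X\<close> of the six complex 1-forms spanning the (1,0)-forms, in an adapted frame.\<close>

definition forms10 :: "real^8^8 \<Rightarrow> bivector \<Rightarrow> complex list" where
  "forms10 F X =
     [Complex (omega F X 3 1) (omega F X 4 1), Complex (omega F X 3 2) (omega F X 4 2),
      Complex (omega F X 6 1) (- omega F X 7 1), Complex (omega F X 6 2) (- omega F X 7 2),
      Complex (omega F X 5 1) (- omega F X 8 1), Complex (omega F X 5 2) (- omega F X 8 2)]"

text \<open>The almost complex structure with these (1,0)-forms: \<open>\<theta>(J X) = \<i> \<theta>(X)\<close> for each of the six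
  forms \<open>\<theta>\<close> in every adapted frame.\<close>

definition J_G2O :: "bivector \<Rightarrow> bivector \<Rightarrow> bivector" where
  "J_G2O E X = (THE Y. Y \<in> tangent_space G2O E \<and>
     (\<forall>F\<in>Spin7. frame_plane F = E \<longrightarrow> forms10 F Y = map ((*) \<i>) (forms10 F X)))"


section \<open>Smooth surfaces\<close>

text \<open>The points of the surface are the elements of a type \<open>'s\<close>.\<close>

type_synonym 's surface_atlas = "('s set \<times> ('s \<Rightarrow> real^2)) set"

definition smooth_surface ::
    "('s::{t2_space, second_countable_topology}) surface_atlas \<Rightarrow> bool" where
  "smooth_surface A \<longleftrightarrow>
     (\<Union>(U, \<phi>)\<in>A. U) = UNIV \<and>
     (\<forall>(U, \<phi>)\<in>A. open U \<and> open (\<phi> ` U) \<and> homeomorphism U (\<phi> ` U) \<phi> (inv_into U \<phi>)) \<and>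
     (\<forall>(U, \<phi>)\<in>A. \<forall>(V, \<psi>)\<in>A. smooth_on (\<phi> ` (U \<inter> V)) (\<psi> \<circ> inv_into U \<phi>))"

definition smooth_map_on ::
    "('s::topological_space) surface_atlas \<Rightarrow> 's set \<Rightarrow> ('s \<Rightarrow> 'b::real_normed_vector) \<Rightarrow> bool" where
  "smooth_map_on A V f \<longleftrightarrow> (\<forall>(U, \<phi>)\<in>A. smooth_on (\<phi> ` (U \<inter> V)) (f \<circ> inv_into U \<phi>))"

definition immersion ::
    "('s::topological_space) surface_atlas \<Rightarrow> ('s \<Rightarrow> 'b::real_normed_vector) \<Rightarrow> bool" where
  "immersion A f \<longleftrightarrow> smooth_map_on A UNIV f \<and>
     (\<forall>(U, \<phi>)\<in>A. \<forall>\<sigma>\<in>U. inj (frechet_derivative (f \<circ> inv_into U \<phi>) (at (\<phi> \<sigma>))))"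

text \<open>The image of the tangent space at \<open>\<sigma>\<close> under the differential of \<open>f\<close>; by the chain rule all
  charts around \<open>\<sigma>\<close> give the same set.\<close>

definition tangent_image ::
    "('s::topological_space) surface_atlas \<Rightarrow> ('s \<Rightarrow> 'b::real_normed_vector) \<Rightarrow> 's \<Rightarrow> 'b set" where
  "tangent_image A f \<sigma> =
     {w. \<exists>(U, \<phi>)\<in>A. \<sigma> \<in> U \<and> w \<in> range (frechet_derivative (f \<circ> inv_into U \<phi>) (at (\<phi> \<sigma>)))}"

definition pseudoholomorphic_at ::
    "('s::topological_space) surface_atlas \<Rightarrow> ('s \<Rightarrow> bivector) \<Rightarrow> 's \<Rightarrow> bool" where
  "pseudoholomorphic_at A \<gamma> \<sigma> \<longleftrightarrow>
     (dim (tangent_image A \<gamma> \<sigma>) = 2 \<longrightarrow>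
        (\<forall>w\<in>tangent_image A \<gamma> \<sigma>. J_G2O (\<gamma> \<sigma>) w \<in> tangent_image A \<gamma> \<sigma>))"

definition immersed_pseudoholomorphic_curve ::
    "('s::topological_space) surface_atlas \<Rightarrow> ('s \<Rightarrow> bivector) \<Rightarrow> bool" where
  "immersed_pseudoholomorphic_curve A \<gamma> \<longleftrightarrow>
     range \<gamma> \<subseteq> G2O \<and> immersion A \<gamma> \<and> (\<forall>\<sigma>. pseudoholomorphic_at A \<gamma> \<sigma>)"


section \<open>2-ruled cones\<close>

text \<open>A cone \<open>(M, \<pi>, \<Sigma>)\<close> is recorded as the set of pairs \<open>(\<pi> p, p)\<close>, that is, as the graph of the
  projection with its arguments exchanged. So \<open>M \<subseteq> \<Sigma> \<times> \<O>\<close>, the projection is \<open>fst\<close>, the map into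
  \<open>\<O>\<close> is \<open>snd\<close>, and \<open>ruling M \<sigma>\<close> is the ruling plane over \<open>\<sigma>\<close>. Keeping \<open>\<sigma>\<close> allows different
  ruling planes to meet, at the origin (where \<open>\<pi>\<close> is not a function on \<open>\<O>\<close>) and, for cones that
  are immersed but not embedded, elsewhere.\<close>

definition ruling :: "('s \<times> octonion) set \<Rightarrow> 's \<Rightarrow> octonion set" where
  "ruling M \<sigma> = {x. (\<sigma>, x) \<in> M}"

definition ruling_frame ::
    "('s::topological_space) surface_atlas \<Rightarrow> ('s \<times> octonion) set \<Rightarrow> 's set \<Rightarrow>
     ('s \<Rightarrow> octonion) \<Rightarrow> ('s \<Rightarrow> octonion) \<Rightarrow> bool" where
  "ruling_frame A M V e1 e2 \<longleftrightarrow>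
     open V \<and> smooth_map_on A V e1 \<and> smooth_map_on A V e2 \<and>
     (\<forall>\<sigma>\<in>V. norm (e1 \<sigma>) = 1 \<and> norm (e2 \<sigma>) = 1 \<and> e1 \<sigma> \<bullet> e2 \<sigma> = 0 \<and>
        ruling M \<sigma> = span {e1 \<sigma>, e2 \<sigma>})"

text \<open>The local parametrization \<open>(r\<^sub>1, r\<^sub>2, \<sigma>) \<mapsto> r\<^sub>1 e\<^sub>1(\<sigma>) + r\<^sub>2 e\<^sub>2(\<sigma>)\<close>, with \<open>\<sigma>\<close> read in a chart
  \<open>(U, \<phi>)\<close>.\<close>

definition cone_param ::
    "'s set \<Rightarrow> ('s \<Rightarrow> real^2) \<Rightarrow> ('s \<Rightarrow> octonion) \<Rightarrow> ('s \<Rightarrow> octonion) \<Rightarrow>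
     (real^2) \<times> (real^2) \<Rightarrow> octonion" where
  "cone_param U \<phi> e1 e2 = (\<lambda>(r, y). (r$1) *\<^sub>R e1 (inv_into U \<phi> y) + (r$2) *\<^sub>R e2 (inv_into U \<phi> y))"

text \<open>The image in \<open>\<O>\<close> of the tangent space of \<open>M\<close> at \<open>(\<sigma>, x)\<close> (independent of all choices);
  \<open>M\<close> is immersed there if this image is 4-dimensional.\<close>

definition cone_tangent ::
    "('s::topological_space) surface_atlas \<Rightarrow> ('s \<times> octonion) set \<Rightarrow> 's \<times> octonion \<Rightarrow>
     octonion set" where
  "cone_tangent A M p =
     {w. \<exists>V e1 e2. \<exists>(U, \<phi>)\<in>A. \<exists>r. ruling_frame A M V e1 e2 \<and> fst p \<in> U \<inter> V \<and>
        cone_param U \<phi> e1 e2 (r, \<phi> (fst p)) = snd p \<and>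
        w \<in> range (frechet_derivative (cone_param U \<phi> e1 e2) (at (r, \<phi> (fst p))))}"

definition immersed_points ::
    "('s::topological_space) surface_atlas \<Rightarrow> ('s \<times> octonion) set \<Rightarrow> ('s \<times> octonion) set" where
  "immersed_points A M = {p\<in>M. dim (cone_tangent A M p) = 4}"

text \<open>The density of the immersed points expresses that \<open>M\<close> is a 4-fold, possibly singular along a
  nowhere dense set (a cone is in particular singular at the origin).\<close>

definition two_ruled_cone ::
    "('s::topological_space) surface_atlas \<Rightarrow> ('s \<times> octonion) set \<Rightarrow> bool" where
  "two_ruled_cone A M \<longleftrightarrow>
     (\<forall>\<sigma>. \<exists>V e1 e2. \<sigma> \<in> V \<and> ruling_frame A M V e1 e2) \<and> M \<subseteq> closure (immersed_points A M)"

definition cayley_cone ::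
    "('s::topological_space) surface_atlas \<Rightarrow> ('s \<times> octonion) set \<Rightarrow> bool" where
  "cayley_cone A M \<longleftrightarrow> (\<forall>p\<in>immersed_points A M. cayley_plane (cone_tangent A M p))"

text \<open>A continuous choice of orientation of the ruling planes; the oriented planes are points of the
  Grassmannian, so the choice itself is the map \<open>\<gamma> : \<Sigma> \<rightarrow> G(2,\<O>)\<close>.\<close>

definition r_orientation ::
    "('s::topological_space \<times> octonion) set \<Rightarrow> ('s \<Rightarrow> bivector) \<Rightarrow> bool" where
  "r_orientation M \<gamma> \<longleftrightarrow> continuous_on UNIV \<gamma> \<and> (\<forall>\<sigma>. \<gamma> \<sigma> \<in> G2O \<and> plane_of (\<gamma> \<sigma>) = ruling M \<sigma>)"

definition nondegenerate_oriented_cayley_cone ::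
    "('s::topological_space) surface_atlas \<Rightarrow> ('s \<times> octonion) set \<Rightarrow> ('s \<Rightarrow> bivector) \<Rightarrow> bool" where
  "nondegenerate_oriented_cayley_cone A M \<gamma> \<longleftrightarrow>
     two_ruled_cone A M \<and> cayley_cone A M \<and> r_orientation M \<gamma> \<and> immersion A \<gamma>"

definition swept_cone :: "('s \<Rightarrow> bivector) \<Rightarrow> ('s \<times> octonion) set" where
  "swept_cone \<gamma> = {(\<sigma>, x). x \<in> plane_of (\<gamma> \<sigma>)}"

text \<open>The planes near \<open>\<sigma>\<close> rule an open piece of a fixed Cayley 4-plane. This case has to be set
  apart: a Cayley 4-plane is a Cayley cone for every one of its rulings by 2-planes through the
  origin, and most of these are not pseudoholomorphic. For example, every great circle fibration
  of the 3-sphere gives such a ruling of a 4-plane \<open>P\<close>; as a surface in the Grassmannian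
  \<open>G(2,P) = S\<^sup>2 \<times> S\<^sup>2\<close> it is the graph of an arbitrary distance-decreasing map.\<close>

definition planar_at :: "('s::topological_space \<times> octonion) set \<Rightarrow> 's \<Rightarrow> bool" where
  "planar_at M \<sigma> \<longleftrightarrow>
     (\<exists>V P. open V \<and> \<sigma> \<in> V \<and> cayley_plane P \<and> (\<forall>\<tau>\<in>V. ruling M \<tau> \<subseteq> P))"

end

theory Submission
  imports Defs
begin

text \<open>For an orthonormal pair \<open>u, v\<close> the Cayley form gives the triple product \<open>x \<mapsto> u \<times> v \<times> x\<close>, which is
  linear in the bivector \<open>E = u \<and> v\<close>. It is the complex structure \<open>K\<^sub>E\<close> of the orthogonal complement of the
  plane, extended by 0, and the almost complex structure is \<open>X \<mapsto> [K\<^sub>E, X]\<close>. In complex coordinates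
  \<open>\<Phi> = \<omega>\<^sup>2/2 + Im \<Omega>\<close> for the Kaehler form \<open>\<omega>\<close> and a complex volume form \<open>\<Omega>\<close>. So \<open>SU(4)\<close> preserves \<open>\<Phi>\<close>,
  and Givens rotations together with one further rotation make \<open>Spin(7)\<close> simply transitive on quadruples
  \<open>(e\<^sub>1, e\<^sub>2, e\<^sub>3, e\<^sub>5)\<close> with \<open>e\<^sub>5\<close> orthogonal to \<open>e\<^sub>1, e\<^sub>2, e\<^sub>3, e\<^sub>1 \<times> e\<^sub>2 \<times> e\<^sub>3\<close>. Gram-Schmidt gives the local
  sections, and the stabilizer of a plane consists of the matrices \<open>diag(det A\<^sup>-\<^sup>1, A)\<close> with \<open>A \<in> U(3)\<close>.

  A holomorphic chart \<open>f\<close> satisfies \<open>df \<circ> J = \<i> df\<close>. Differentiating this along the linear fields \<open>[S, E]\<close> and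
  using the symmetry of the second derivative makes \<open>df\<close> vanish on the Nijenhuis tensor, which is nonzero.

  The tangent space of a cone at \<open>x \<in> E\<close> is spanned by \<open>E\<close> and the vectors \<open>X(x)\<close>, where \<open>X \<in> Hom(E, E\<^sup>\<bottom>)\<close> runs
  over the image of \<open>d\<gamma>\<close>. It is a Cayley plane iff the \<open>X(x)\<close> form a complex line. If this holds for all \<open>x\<close>,
  then the pencil spanned by \<open>X\<^sub>1, X\<^sub>2\<close> has rank one over the complex numbers, so that either \<open>X\<^sub>1, X\<^sub>2\<close> are
  complex dependent, and \<open>\<gamma>\<close> is pseudoholomorphic, or all values lie in one complex line \<open>L\<close>. In the second case
  the Cayley plane \<open>E \<oplus> L\<close> is locally constant.\<close>

section \<open>Smooth maps\<close>

text \<open>Everything on the Grassmannian is computed in the ambient space of 8 by 8 matrices: K_E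
  extends to a linear map of the matrix E and J to a bilinear map of E and X. Smoothness and
  derivatives then need no charts of the Grassmannian, and a holomorphic chart can be differentiated
  twice on an open set of matrices. The obstacle in passing from cones to curves is that the Cayley
  condition at one point restricts first derivatives only, and the rank-one alternative is
  compatible with it. Second derivatives decide. Let Pi be the projection to the sum of E and L,
  with partial derivatives D1 and D2. The partial derivatives of a frame f of the plane stay in the
  image of Pi, so equality of mixed partials makes D2 of the first partial of f equal to D1 of the
  second. The coordinates of these partials in L form a 2 by 2 complex matrix, invertible exactly
  when X1 and X2 are complex independent, and this forces D1 = D2 = 0. Invertibility is an open
  condition, so the conclusion holds on a neighbourhood.\<close>

lemma Ck_on_cong:
  assumes "open S" "\<And>x. x \<in> S \<Longrightarrow> f x = g x"
  shows "Ck_on k S f \<longleftrightarrow> Ck_on k S g"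
  using assms(2)
proof (induction k arbitrary: f g)
  case 0
  then show ?case by (auto intro: continuous_on_eq)
next
  case (Suc k)
  have ev: "\<forall>\<^sub>F y in at x. f y = g y" if "x \<in> S" for x
    using eventually_at_in_open'[OF assms(1) that] Suc.prems by (auto elim!: eventually_mono)
  have d: "(f has_derivative D) (at x) \<longleftrightarrow> (g has_derivative D) (at x)" if "x \<in> S" for x D
  proof
    show "(f has_derivative D) (at x) \<Longrightarrow> (g has_derivative D) (at x)"
      by (rule has_derivative_transform_eventually[of f D x UNIV g]) (use ev that Suc.prems in auto)
    have "\<forall>\<^sub>F y in at x. g y = f y" using ev[OF that] by (simp add: eq_commute)
    then show "(g has_derivative D) (at x) \<Longrightarrow> (f has_derivative D) (at x)"
      by (rule has_derivative_transform_eventually[of g D x UNIV f, rotated]) (use that Suc.prems in auto)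
  qed
  then have "frechet_derivative f (at x) = frechet_derivative g (at x)" if "x \<in> S" for x
    using that by (simp add: frechet_derivative_def)
  then have "Ck_on k S (\<lambda>x. frechet_derivative f (at x) v) \<longleftrightarrow>
      Ck_on k S (\<lambda>x. frechet_derivative g (at x) v)" for v
    by (intro Suc.IH) simp
  with d show ?case by (auto simp: differentiable_def)
qed

lemma Ck_on_SucI:
  assumes "open S" "\<And>x. x \<in> S \<Longrightarrow> (f has_derivative f' x) (at x)"
    and "\<And>v. Ck_on k S (\<lambda>x. f' x v)"
  shows "Ck_on (Suc k) S f"
proof -
  have "frechet_derivative f (at x) = f' x" if "x \<in> S" for x
    using assms(2)[OF that] frechet_derivative_at by metis
  then have "Ck_on k S (\<lambda>x. frechet_derivative f (at x) v)" for v
    using Ck_on_cong[OF assms(1), of "\<lambda>x. frechet_derivative f (at x) v" "\<lambda>x. f' x v"] assms(3)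
    by simp
  then show ?thesis using assms(2) by (auto simp: differentiable_def)
qed

lemma Ck_on_SucD:
  assumes "Ck_on (Suc k) S f" "x \<in> S"
  shows "(f has_derivative frechet_derivative f (at x)) (at x)"
  using assms frechet_derivative_works by auto

lemma Ck_on_subset: "Ck_on k S f \<Longrightarrow> T \<subseteq> S \<Longrightarrow> Ck_on k T f"
  by (induction k arbitrary: f) (auto intro: continuous_on_subset)

lemma Ck_on_imp_continuous_on: "Ck_on k S f \<Longrightarrow> continuous_on S f"
  by (cases k) (auto intro!: continuous_at_imp_continuous_on differentiable_imp_continuous_within)

lemma Ck_on_Suc_imp: "Ck_on (Suc k) S f \<Longrightarrow> Ck_on k S f"
proof (induction k arbitrary: f)
  case 0
  then show ?case by (metis Ck_on.simps(1) Ck_on_imp_continuous_on)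
next
  case (Suc k)
  then show ?case by (metis Ck_on.simps(2))
qed

lemma Ck_on_const: "Ck_on k S (\<lambda>x. c)"
  by (induction k arbitrary: c) auto

lemma Ck_on_bounded_linear:
  assumes "bounded_linear L" "open S" "Ck_on k S f"
  shows "Ck_on k S (\<lambda>x. L (f x))"
  using assms(3)
proof (induction k arbitrary: f)
  case 0
  then show ?case using assms bounded_linear.continuous_on by fastforce
next
  case (Suc k)
  show ?case
  proof (rule Ck_on_SucI[OF assms(2)])
    show "((\<lambda>x. L (f x)) has_derivative (\<lambda>v. L (frechet_derivative f (at x) v))) (at x)" if "x \<in> S" for x
      using bounded_linear.has_derivative[OF assms(1)] Ck_on_SucD[OF Suc.prems that] by blast
    show "Ck_on k S (\<lambda>x. L (frechet_derivative f (at x) v))" for v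
      using Suc by simp
  qed
qed

lemma Ck_on_add:
  assumes "open S" "Ck_on k S f" "Ck_on k S g"
  shows "Ck_on k S (\<lambda>x. f x + g x)"
  using assms(2,3)
proof (induction k arbitrary: f g)
  case 0
  then show ?case by (auto intro: continuous_on_add)
next
  case (Suc k)
  show ?case
  proof (rule Ck_on_SucI[OF assms(1)])
    show "((\<lambda>x. f x + g x) has_derivative
        (\<lambda>v. frechet_derivative f (at x) v + frechet_derivative g (at x) v)) (at x)" if "x \<in> S" for x
      using Ck_on_SucD Suc.prems that by (intro has_derivative_add) blast+
    show "Ck_on k S (\<lambda>x. frechet_derivative f (at x) v + frechet_derivative g (at x) v)" for v
      using Suc by simp
  qed
qed

lemma Ck_on_sum:
  assumes "open S" "\<And>i. i \<in> I \<Longrightarrow> Ck_on k S (f i)"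
  shows "Ck_on k S (\<lambda>x. \<Sum>i\<in>I. f i x)"
  using assms(2) by (induction I rule: infinite_finite_induct) (auto intro: Ck_on_const Ck_on_add assms(1))

lemma Ck_on_bounded_bilinear:
  assumes "bounded_bilinear B" "open S" "Ck_on k S f" "Ck_on k S g"
  shows "Ck_on k S (\<lambda>x. B (f x) (g x))"
  using assms(3,4)
proof (induction k arbitrary: f g)
  case 0
  then show ?case by (auto intro: bounded_bilinear.continuous_on[OF assms(1)])
next
  case (Suc k)
  show ?case
  proof (rule Ck_on_SucI[OF assms(2)])
    show "((\<lambda>x. B (f x) (g x)) has_derivative
        (\<lambda>v. B (f x) (frechet_derivative g (at x) v) + B (frechet_derivative f (at x) v) (g x))) (at x)"
      if "x \<in> S" for x
      by (intro bounded_bilinear.FDERIV[OF assms(1)] Ck_on_SucD[OF Suc.prems(1) that]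
          Ck_on_SucD[OF Suc.prems(2) that])
    show "Ck_on k S (\<lambda>x. B (f x) (frechet_derivative g (at x) v) + B (frechet_derivative f (at x) v) (g x))" for v
      using Suc Ck_on_Suc_imp[OF Suc.prems(1)] Ck_on_Suc_imp[OF Suc.prems(2)]
      by (intro Ck_on_add[OF assms(2)] Suc.IH) (auto simp del: Ck_on.simps simp add: Ck_on.simps(2))
  qed
qed

text \<open>\<open>Ck_on\<close> controls derivatives in fixed directions, whereas the chain rule
  differentiates \<open>g\<close> in a direction that moves with \<open>x\<close>. Expanding that
  direction in \<open>Basis\<close> gives scalar functions times derivatives in fixed directions, to
  which the induction hypothesis applies; hence the Euclidean middle space.\<close>

lemma Ck_on_compose:
  fixes g :: "'b::euclidean_space \<Rightarrow> 'c::real_normed_vector"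
  assumes "open S" "open T" "Ck_on k S f" "Ck_on k T g" "f ` S \<subseteq> T"
  shows "Ck_on k S (\<lambda>x. g (f x))"
  using assms(3,4)
proof (induction k arbitrary: g)
  case 0
  then show ?case using continuous_on_compose2[of T g S f] assms(5) by simp
next
  case (Suc k)
  have g: "(g has_derivative frechet_derivative g (at (f x))) (at (f x))" if "x \<in> S" for x
    using Ck_on_SucD[OF Suc.prems(2)] that assms(5) by auto
  have exp: "frechet_derivative g (at (f x)) w = (\<Sum>b\<in>Basis. (w \<bullet> b) *\<^sub>R frechet_derivative g (at (f x)) b)"
    if "x \<in> S" for x w
  proof -
    interpret bounded_linear "frechet_derivative g (at (f x))"
      using g[OF that] has_derivative_bounded_linear by blast
    have "frechet_derivative g (at (f x)) (\<Sum>b\<in>Basis. (w \<bullet> b) *\<^sub>R b) =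
        (\<Sum>b\<in>Basis. (w \<bullet> b) *\<^sub>R frechet_derivative g (at (f x)) b)"
      by (simp add: sum scaleR)
    then show ?thesis by (simp add: euclidean_representation)
  qed
  show ?case
  proof (rule Ck_on_SucI[OF assms(1)])
    show "((\<lambda>x. g (f x)) has_derivative
       (\<lambda>v. (\<Sum>b\<in>Basis. (frechet_derivative f (at x) v \<bullet> b) *\<^sub>R frechet_derivative g (at (f x)) b))) (at x)"
      if "x \<in> S" for x
      using has_derivative_compose[OF Ck_on_SucD[OF Suc.prems(1) that] g[OF that]]
      by (subst (asm) exp[OF that])
    have "Ck_on k S (\<lambda>x. frechet_derivative g (at (f x)) b)" for b
      using Suc.IH[of "\<lambda>y. frechet_derivative g (at y) b"] Suc.prems Ck_on_Suc_imp by auto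
    moreover have "Ck_on k S (\<lambda>x. frechet_derivative f (at x) v \<bullet> b)" for v b
      using Ck_on_bounded_linear[OF bounded_linear_inner_left assms(1), of k "\<lambda>x. frechet_derivative f (at x) v"]
        Suc.prems(1) by auto
    ultimately show "Ck_on k S (\<lambda>x. \<Sum>b\<in>Basis. (frechet_derivative f (at x) v \<bullet> b) *\<^sub>R
        frechet_derivative g (at (f x)) b)" for v
      by (intro Ck_on_sum Ck_on_bounded_bilinear[OF bounded_bilinear_scaleR] assms(1))
  qed
qed

lemma Ck_on_id: "Ck_on k S (\<lambda>x. x)"
proof (cases k)
  case (Suc j)
  then show ?thesis using frechet_derivative_ident
    by (auto simp: Ck_on_const frechet_derivative_id)
qed auto

text \<open>The derivative of \<open>inverse\<close> is built from two copies of
  \<open>inverse\<close>, so the induction feeds on itself through the product rule.\<close>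

lemma Ck_on_inverse: "Ck_on k (- {0}) (inverse :: real \<Rightarrow> real)"
proof (induction k)
  case 0
  then show ?case by (auto intro!: continuous_intros)
next
  case (Suc k)
  show ?case
  proof (rule Ck_on_SucI)
    show "Ck_on k (- {0}) (\<lambda>x::real. - (inverse x * v * inverse x))" for v
      using Ck_on_bounded_linear[OF bounded_linear_mult_right[of "-v"], of "- {0}" k "\<lambda>x. inverse x * inverse x"]
        Ck_on_bounded_bilinear[OF bounded_bilinear_mult _ Suc Suc]
      by (simp add: mult_ac open_Compl)
  qed (auto intro!: has_derivative_inverse')
qed

lemma Ck_on_sqrt: "Ck_on k {0<..} sqrt"
proof (induction k)
  case 0
  then show ?case by (auto intro!: continuous_intros)
next
  case (Suc k)
  show ?case
  proof (rule Ck_on_SucI)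
    have "Ck_on k {0<..} (\<lambda>x. inverse (sqrt x))"
      by (rule Ck_on_compose[where T="- {0}"]) (auto simp: Suc Ck_on_inverse)
    then show "Ck_on k {0<..} (\<lambda>x. v * (inverse (sqrt x) / 2))" for v
      using Ck_on_bounded_linear[OF bounded_linear_mult_right[of "v / 2"], of _ k "\<lambda>x. inverse (sqrt x)"] by simp
    show "(sqrt has_derivative (\<lambda>v. v * (inverse (sqrt x) / 2))) (at x)" if "x \<in> {0<..}" for x
      using DERIV_real_sqrt[of x] that unfolding has_field_derivative_def mult.commute[of "inverse (sqrt x) / 2"]
      by simp
  qed auto
qed

lemma smooth_on_subset_open: "smooth_on S f \<Longrightarrow> T \<subseteq> S \<Longrightarrow> smooth_on T f"
  using Ck_on_subset unfolding smooth_on_def by blast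

lemma smooth_on_imp_continuous_on: "smooth_on S f \<Longrightarrow> continuous_on S f"
  using Ck_on_imp_continuous_on unfolding smooth_on_def by blast

lemma smooth_on_has_derivative:
  "smooth_on S f \<Longrightarrow> x \<in> S \<Longrightarrow> (f has_derivative frechet_derivative f (at x)) (at x)"
  using Ck_on_SucD unfolding smooth_on_def by blast

lemma smooth_on_frechet_derivative:
  "smooth_on S f \<Longrightarrow> smooth_on S (\<lambda>x. frechet_derivative f (at x) v)"
  unfolding smooth_on_def using Ck_on.simps(2) by blast

lemma smooth_on_const: "smooth_on S (\<lambda>x. c)"
  by (simp add: smooth_on_def Ck_on_const)

lemma smooth_on_id: "smooth_on S (\<lambda>x. x)"
  by (simp add: smooth_on_def Ck_on_id)

lemma smooth_on_bounded_linear: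
  "bounded_linear L \<Longrightarrow> open S \<Longrightarrow> smooth_on S f \<Longrightarrow> smooth_on S (\<lambda>x. L (f x))"
  by (simp add: smooth_on_def Ck_on_bounded_linear)

lemma smooth_on_linear:
  fixes L :: "'b::euclidean_space \<Rightarrow> 'c::real_normed_vector"
  shows "linear L \<Longrightarrow> open S \<Longrightarrow> smooth_on S f \<Longrightarrow> smooth_on S (\<lambda>x. L (f x))"
  by (simp add: smooth_on_bounded_linear linear_conv_bounded_linear)

lemma smooth_on_bounded_bilinear:
  "bounded_bilinear B \<Longrightarrow> open S \<Longrightarrow> smooth_on S f \<Longrightarrow> smooth_on S g \<Longrightarrow> smooth_on S (\<lambda>x. B (f x) (g x))"
  by (simp add: smooth_on_def Ck_on_bounded_bilinear)

lemma smooth_on_compose: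
  fixes g :: "'b::euclidean_space \<Rightarrow> 'c::real_normed_vector"
  shows "open S \<Longrightarrow> open T \<Longrightarrow> smooth_on S f \<Longrightarrow> smooth_on T g \<Longrightarrow> f ` S \<subseteq> T \<Longrightarrow>
    smooth_on S (\<lambda>x. g (f x))"
  unfolding smooth_on_def using Ck_on_compose by blast

lemma smooth_on_add: "open S \<Longrightarrow> smooth_on S f \<Longrightarrow> smooth_on S g \<Longrightarrow> smooth_on S (\<lambda>x. f x + g x)"
  by (simp add: smooth_on_def Ck_on_add)

lemma smooth_on_minus: "open S \<Longrightarrow> smooth_on S f \<Longrightarrow> smooth_on S (\<lambda>x. - f x)"
  by (rule smooth_on_bounded_linear[OF bounded_linear_minus[OF bounded_linear_ident]])

lemma smooth_on_diff: "open S \<Longrightarrow> smooth_on S f \<Longrightarrow> smooth_on S g \<Longrightarrow> smooth_on S (\<lambda>x. f x - g x)"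
  using smooth_on_add[of S f "\<lambda>x. - g x"] smooth_on_minus[of S g] by simp

lemma smooth_on_sum:
  "open S \<Longrightarrow> (\<And>i. i \<in> I \<Longrightarrow> smooth_on S (f i)) \<Longrightarrow> smooth_on S (\<lambda>x. \<Sum>i\<in>I. f i x)"
  by (simp add: smooth_on_def Ck_on_sum)

lemma smooth_on_scaleR:
  "open S \<Longrightarrow> smooth_on S f \<Longrightarrow> smooth_on S g \<Longrightarrow> smooth_on S (\<lambda>x. f x *\<^sub>R g x)"
  by (rule smooth_on_bounded_bilinear[OF bounded_bilinear_scaleR])

lemma smooth_on_mult:
  fixes f g :: "'a::real_normed_vector \<Rightarrow> 'b::real_normed_algebra"
  shows "open S \<Longrightarrow> smooth_on S f \<Longrightarrow> smooth_on S g \<Longrightarrow> smooth_on S (\<lambda>x. f x * g x)"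
  by (rule smooth_on_bounded_bilinear[OF bounded_bilinear_mult])

lemma smooth_on_inner:
  "open S \<Longrightarrow> smooth_on S f \<Longrightarrow> smooth_on S g \<Longrightarrow> smooth_on S (\<lambda>x. f x \<bullet> g x)"
  by (rule smooth_on_bounded_bilinear[OF bounded_bilinear_inner])

lemma smooth_on_inverse:
  fixes f :: "'a::real_normed_vector \<Rightarrow> real"
  assumes "open S" "smooth_on S f" "\<And>x. x \<in> S \<Longrightarrow> f x \<noteq> 0"
  shows "smooth_on S (\<lambda>x. inverse (f x))"
  by (rule smooth_on_compose[where T="- {0}"])
    (use assms in \<open>auto simp: smooth_on_def Ck_on_inverse\<close>)

lemma smooth_on_sqrt:
  assumes "open S" "smooth_on S f" "\<And>x. x \<in> S \<Longrightarrow> f x > 0"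
  shows "smooth_on S (\<lambda>x. sqrt (f x))"
  by (rule smooth_on_compose[where T="{0<..}"])
    (use assms in \<open>auto simp: smooth_on_def Ck_on_sqrt\<close>)

lemma smooth_on_sgn:
  fixes f :: "'a::real_normed_vector \<Rightarrow> 'b::real_inner"
  assumes "open S" "smooth_on S f" "\<And>x. x \<in> S \<Longrightarrow> f x \<noteq> 0"
  shows "smooth_on S (\<lambda>x. sgn (f x))"
  unfolding sgn_div_norm norm_eq_sqrt_inner
  using assms by (intro smooth_on_scaleR smooth_on_inverse smooth_on_sqrt smooth_on_inner) auto

lemma bounded_linear_vec_lambda_component:
  "bounded_linear (\<lambda>x. \<chi> j. if j = i then x else (0 :: 'b::real_normed_vector))"
proof (rule bounded_linear_intro[where K=1])
  fix x :: 'b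
  have "norm (\<chi> j. if j = i then x else 0) \<le> (\<Sum>j\<in>UNIV. norm ((\<chi> j. if j = i then x else (0::'b)) $ j))"
    unfolding norm_vec_def by (rule L2_set_le_sum) simp
  also have "\<dots> = norm x" by (simp add: if_distrib cong: if_cong)
  finally show "norm (\<chi> j. if j = i then x else 0) \<le> norm x * 1" by simp
qed (auto simp: vec_eq_iff)

lemma smooth_on_vec_lambda:
  fixes f :: "'a::real_normed_vector \<Rightarrow> 'i::finite \<Rightarrow> 'b::real_normed_vector"
  assumes "open S" "\<And>i. smooth_on S (\<lambda>x. f x i)"
  shows "smooth_on S (\<lambda>x. \<chi> i. f x i)"
proof -
  have eq: "(\<chi> i. f x i) = (\<Sum>i\<in>UNIV. (\<chi> j. if j = i then f x i else 0))" for x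
    by (simp add: vec_eq_iff if_distrib cong: if_cong)
  show ?thesis unfolding eq
    by (intro smooth_on_sum smooth_on_bounded_linear[OF bounded_linear_vec_lambda_component] assms)
qed

lemma smooth_on_vec_nth:
  "open S \<Longrightarrow> smooth_on S f \<Longrightarrow> smooth_on S (\<lambda>x. f x $ i)"
  by (rule smooth_on_bounded_linear[OF bounded_linear_vec_nth])

lemma smooth_on_subset_UNIV: "smooth_on UNIV f \<Longrightarrow> smooth_on_subset X f"
  unfolding smooth_on_subset_def by blast

lemma smooth_on_subset_inter_open:
  "open U \<Longrightarrow> smooth_on U f \<Longrightarrow> smooth_on_subset (X \<inter> U) f"
  unfolding smooth_on_subset_def by blast

section \<open>Symmetry of second derivatives\<close>

lemma mixed_difference:
  fixes F :: "'a::real_normed_vector \<Rightarrow> real"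
  assumes F: "smooth_on S F" and h: "h > 0"
    and S: "\<And>s t. 0 \<le> s \<Longrightarrow> s \<le> h \<Longrightarrow> 0 \<le> t \<Longrightarrow> t \<le> h \<Longrightarrow> x + s *\<^sub>R v + t *\<^sub>R w \<in> S"
  obtains s t where "0 \<le> s" "s \<le> h" "0 \<le> t" "t \<le> h"
    "F (x + h *\<^sub>R v + h *\<^sub>R w) - F (x + h *\<^sub>R v) - F (x + h *\<^sub>R w) + F x =
       h * h * frechet_derivative (\<lambda>y. frechet_derivative F (at y) v) (at (x + s *\<^sub>R v + t *\<^sub>R w)) w"
proof -
  have lin: "linear (frechet_derivative G (at y))" if "smooth_on S G" "y \<in> S" for G :: "'a \<Rightarrow> real" and y
    using smooth_on_has_derivative[OF that] has_derivative_linear by blast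
  have 1: "((\<lambda>s. F (x + s *\<^sub>R v + t *\<^sub>R w)) has_real_derivative
      frechet_derivative F (at (x + s *\<^sub>R v + t *\<^sub>R w)) v) (at s)"
    if "0 \<le> s" "s \<le> h" "0 \<le> t" "t \<le> h" for s t
  proof -
    have "((\<lambda>s. F (x + s *\<^sub>R v + t *\<^sub>R w)) has_derivative
        (\<lambda>r. frechet_derivative F (at (x + s *\<^sub>R v + t *\<^sub>R w)) (r *\<^sub>R v))) (at s)"
      by (rule has_derivative_compose[where f="\<lambda>s. x + s *\<^sub>R v + t *\<^sub>R w" and g=F, OF _
            smooth_on_has_derivative[OF F S[OF that]]])
        (auto intro!: derivative_eq_intros)
    then show ?thesis
      by (simp add: has_field_derivative_def linear_cmul[OF lin[OF F S[OF that]]] mult_commute_abs)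
  qed
  define DF where "DF y = frechet_derivative F (at y) v" for y
  have DF_eq: "DF = (\<lambda>y. frechet_derivative F (at y) v)" by (simp add: DF_def fun_eq_iff)
  have DF: "smooth_on S DF" unfolding DF_def by (rule smooth_on_frechet_derivative[OF F])
  have 2: "((\<lambda>t. DF (x + s *\<^sub>R v + t *\<^sub>R w)) has_real_derivative
      frechet_derivative DF (at (x + s *\<^sub>R v + t *\<^sub>R w)) w) (at t)"
    if "0 \<le> s" "s \<le> h" "0 \<le> t" "t \<le> h" for s t
  proof -
    have "((\<lambda>t. DF (x + s *\<^sub>R v + t *\<^sub>R w)) has_derivative
        (\<lambda>r. frechet_derivative DF (at (x + s *\<^sub>R v + t *\<^sub>R w)) (r *\<^sub>R w))) (at t)"
      by (rule has_derivative_compose[where f="\<lambda>t. x + s *\<^sub>R v + t *\<^sub>R w" and g=DF, OF _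
            smooth_on_has_derivative[OF DF S[OF that]]])
        (auto intro!: derivative_eq_intros)
    then show ?thesis
      by (simp add: has_field_derivative_def linear_cmul[OF lin[OF DF S[OF that]]] mult_commute_abs)
  qed
  \<comment> \<open>Mean value theorem in \<open>s\<close> for the increment of \<open>F\<close>
    along \<open>w\<close>; the next application is in \<open>t\<close>, to the derivative so
    obtained. The terms with factor 0 are kept so that both ends of the increment match the pattern
    of the derivative facts.\<close>
  have "\<exists>s>0. s < h \<and> (F (x + h *\<^sub>R v + h *\<^sub>R w) - F (x + h *\<^sub>R v + 0 *\<^sub>R w)) -
      (F (x + 0 *\<^sub>R v + h *\<^sub>R w) - F (x + 0 *\<^sub>R v + 0 *\<^sub>R w)) =
      (h - 0) * (DF (x + s *\<^sub>R v + h *\<^sub>R w) - DF (x + s *\<^sub>R v + 0 *\<^sub>R w))"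
    unfolding DF_def using h by (intro MVT2 DERIV_diff 1) auto
  then obtain s where s: "0 < s" "s < h" "(F (x + h *\<^sub>R v + h *\<^sub>R w) - F (x + h *\<^sub>R v)) -
      (F (x + h *\<^sub>R w) - F x) = h * (DF (x + s *\<^sub>R v + h *\<^sub>R w) - DF (x + s *\<^sub>R v + 0 *\<^sub>R w))"
    by auto
  have "\<exists>t>0. t < h \<and> DF (x + s *\<^sub>R v + h *\<^sub>R w) - DF (x + s *\<^sub>R v + 0 *\<^sub>R w) =
      (h - 0) * frechet_derivative DF (at (x + s *\<^sub>R v + t *\<^sub>R w)) w"
    using h s by (intro MVT2 2) auto
  then obtain t where t: "0 < t" "t < h" "DF (x + s *\<^sub>R v + h *\<^sub>R w) - DF (x + s *\<^sub>R v + 0 *\<^sub>R w) =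
      h * frechet_derivative DF (at (x + s *\<^sub>R v + t *\<^sub>R w)) w"
    by auto
  show ?thesis
    using s t by (intro that[of s t]) (auto simp: DF_eq[symmetric] algebra_simps)
qed

text \<open>The second difference over a parallelogram is symmetric in \<open>v\<close> and
  \<open>w\<close>, so the two mixed derivatives take a common value at two points near
  \<open>x\<close>. As the parallelogram shrinks, continuity carries the equality to
  \<open>x\<close>.\<close>

lemma symmetric_second_derivative_real:
  fixes F :: "'a::real_normed_vector \<Rightarrow> real"
  assumes F: "smooth_on S F" and S: "open S" and x: "x \<in> S"
  shows "frechet_derivative (\<lambda>y. frechet_derivative F (at y) v) (at x) w =
    frechet_derivative (\<lambda>y. frechet_derivative F (at y) w) (at x) v"
proof -
  define A where "A y = frechet_derivative (\<lambda>y. frechet_derivative F (at y) v) (at y) w" for y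
  define B where "B y = frechet_derivative (\<lambda>y. frechet_derivative F (at y) w) (at y) v" for y
  have "smooth_on S A" "smooth_on S B"
    unfolding A_def B_def by (intro smooth_on_frechet_derivative F)+
  then have "continuous_on S A" "continuous_on S B" by (auto dest: smooth_on_imp_continuous_on)
  then have cont: "isCont A x" "isCont B x"
    using S x by (auto simp: continuous_on_eq_continuous_at)
  have "dist (A x) (B x) \<le> 0 + e" if "e > 0" for e :: real
  proof -
    have "e / 2 > 0" using that by simp
    then obtain d1 where d1: "d1 > 0" "\<And>y. dist y x < d1 \<Longrightarrow> dist (A y) (A x) < e / 2"
      using cont(1) unfolding continuous_at_eps_delta by blast
    obtain d2 where d2: "d2 > 0" "\<And>y. dist y x < d2 \<Longrightarrow> dist (B y) (B x) < e / 2"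
      using cont(2) \<open>e / 2 > 0\<close> unfolding continuous_at_eps_delta by blast
    obtain d3 where d3: "d3 > 0" "ball x d3 \<subseteq> S" using S x open_contains_ball by blast
    define d where "d = min d1 (min d2 d3)"
    \<comment> \<open>The summand 1 keeps \<open>N\<close> positive even for vanishing
      \<open>v\<close> and \<open>w\<close>; with \<open>h = d / (2 * N)\<close> the parallelogram
      stays within distance \<open>d / 2\<close> of \<open>x\<close>.\<close>
    define N where "N = norm v + norm w + 1"
    define h where "h = d / (2 * N)"
    have n: "N > 0" by (simp add: N_def add_nonneg_pos)
    have d: "d > 0" using d1 d2 d3 by (simp add: d_def)
    have h: "h > 0" using d n by (simp add: h_def)
    have hd: "h * (norm v + norm w) < d"
    proof -
      have "h * (norm v + norm w) \<le> h * N" using h by (simp add: N_def)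
      also have "\<dots> = d / 2" using n by (simp add: h_def)
      finally show ?thesis using d by simp
    qed
    have near: "dist (x + s *\<^sub>R v + t *\<^sub>R w) x < d" if "0 \<le> s" "s \<le> h" "0 \<le> t" "t \<le> h" for s t
    proof -
      have "dist (x + s *\<^sub>R v + t *\<^sub>R w) x = norm (s *\<^sub>R v + t *\<^sub>R w)"
        by (simp add: dist_norm algebra_simps)
      also have "\<dots> \<le> s * norm v + t * norm w"
        using norm_triangle_ineq[of "s *\<^sub>R v" "t *\<^sub>R w"] that by simp
      also have "\<dots> \<le> h * norm v + h * norm w"
        using that by (intro add_mono mult_right_mono) auto
      finally show ?thesis using hd by (simp add: algebra_simps)
    qed
    have inS: "x + s *\<^sub>R v + t *\<^sub>R w \<in> S" if "0 \<le> s" "s \<le> h" "0 \<le> t" "t \<le> h" for s t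
      using near[OF that] d3 by (auto simp: d_def subset_iff dist_commute)
    have inS': "x + s *\<^sub>R w + t *\<^sub>R v \<in> S" if "0 \<le> s" "s \<le> h" "0 \<le> t" "t \<le> h" for s t
      using inS[OF that(3,4,1,2)] by (simp add: algebra_simps)
    obtain s t where st: "0 \<le> s" "s \<le> h" "0 \<le> t" "t \<le> h"
      "F (x + h *\<^sub>R v + h *\<^sub>R w) - F (x + h *\<^sub>R v) - F (x + h *\<^sub>R w) + F x = h * h * A (x + s *\<^sub>R v + t *\<^sub>R w)"
      using mixed_difference[OF F h inS] unfolding A_def by blast
    obtain s' t' where st': "0 \<le> s'" "s' \<le> h" "0 \<le> t'" "t' \<le> h"
      "F (x + h *\<^sub>R w + h *\<^sub>R v) - F (x + h *\<^sub>R w) - F (x + h *\<^sub>R v) + F x = h * h * B (x + s' *\<^sub>R w + t' *\<^sub>R v)"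
      using mixed_difference[OF F h inS'] unfolding B_def by blast
    have "h * h * A (x + s *\<^sub>R v + t *\<^sub>R w) = h * h * B (x + s' *\<^sub>R w + t' *\<^sub>R v)"
      unfolding st(5)[symmetric] st'(5)[symmetric] by (simp add: algebra_simps)
    then have eq: "A (x + s *\<^sub>R v + t *\<^sub>R w) = B (x + t' *\<^sub>R v + s' *\<^sub>R w)"
      using h by (simp add: algebra_simps)
    have "dist (A (x + s *\<^sub>R v + t *\<^sub>R w)) (A x) < e / 2"
      using near[OF st(1-4)] by (intro d1) (simp add: d_def)
    moreover have "dist (B (x + t' *\<^sub>R v + s' *\<^sub>R w)) (B x) < e / 2"
      using near[OF st'(3,4,1,2)] by (intro d2) (simp add: d_def)
    ultimately show ?thesis unfolding eq dist_real_def by linarith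
  qed
  then have "dist (A x) (B x) \<le> 0" by (rule field_le_epsilon)
  then show ?thesis by (simp add: A_def B_def)
qed

lemma symmetric_second_derivative:
  fixes F :: "'a::real_normed_vector \<Rightarrow> 'b::euclidean_space"
  assumes F: "smooth_on S F" and S: "open S" and x: "x \<in> S"
  shows "frechet_derivative (\<lambda>y. frechet_derivative F (at y) v) (at x) w =
    frechet_derivative (\<lambda>y. frechet_derivative F (at y) w) (at x) v"
proof (rule euclidean_eqI)
  fix b :: 'b assume "b \<in> Basis"
  have inner: "frechet_derivative (\<lambda>y. G y \<bullet> b) (at y) = (\<lambda>v. frechet_derivative G (at y) v \<bullet> b)"
    if "smooth_on S G" "y \<in> S" for G y
    using bounded_linear.has_derivative[OF bounded_linear_inner_left smooth_on_has_derivative[OF that]]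
      frechet_derivative_at by metis
  have Fb: "smooth_on S (\<lambda>y. F y \<bullet> b)"
    by (rule smooth_on_bounded_linear[OF bounded_linear_inner_left S F])
  have D: "frechet_derivative (\<lambda>y. frechet_derivative (\<lambda>y. F y \<bullet> b) (at y) v) (at x) w =
      frechet_derivative (\<lambda>y. frechet_derivative F (at y) v) (at x) w \<bullet> b" for v w
  proof -
    have "((\<lambda>y. frechet_derivative F (at y) v \<bullet> b) has_derivative
        (\<lambda>w. frechet_derivative (\<lambda>y. frechet_derivative F (at y) v) (at x) w \<bullet> b)) (at x)"
      by (intro bounded_linear.has_derivative[OF bounded_linear_inner_left]
          smooth_on_has_derivative[OF _ x] smooth_on_frechet_derivative F)
    then have "((\<lambda>y. frechet_derivative (\<lambda>y. F y \<bullet> b) (at y) v) has_derivative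
        (\<lambda>w. frechet_derivative (\<lambda>y. frechet_derivative F (at y) v) (at x) w \<bullet> b)) (at x)"
      by (rule has_derivative_transform_within_open[OF _ S x]) (simp add: inner[OF F])
    then show ?thesis using frechet_derivative_at by metis
  qed
  show "frechet_derivative (\<lambda>y. frechet_derivative F (at y) v) (at x) w \<bullet> b =
    frechet_derivative (\<lambda>y. frechet_derivative F (at y) w) (at x) v \<bullet> b"
    using symmetric_second_derivative_real[OF Fb S x] by (simp add: D)
qed

section \<open>The Cayley form in complex coordinates\<close>

lemma UNIV_8: "(UNIV :: 8 set) = {1, 2, 3, 4, 5, 6, 7, 8}"
proof -
  have "card {1 :: 8, 2, 3, 4, 5, 6, 7, 8} = 8" by simp
  then show ?thesis by (intro card_subset_eq[symmetric]) auto
qed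

lemma forall_8: "(\<forall>i::8. P i) \<longleftrightarrow> P 1 \<and> P 2 \<and> P 3 \<and> P 4 \<and> P 5 \<and> P 6 \<and> P 7 \<and> P 8"
  using UNIV_8 by (metis (no_types, lifting) UNIV_I empty_iff insert_iff)

lemma sum_8: "sum f (UNIV :: 8 set) = f 1 + f 2 + f 3 + f 4 + f 5 + f 6 + f 7 + f 8"
  unfolding UNIV_8 by (simp add: add.assoc)

text \<open>Laplace expansion along the first two rows, grouped into 2 by 2 minors, so that the
  terms of \<open>dx4\<close> become products of Pluecker coordinates \<open>pl\<close>.\<close>

lemma det_4:
  "det (A :: 'a::comm_ring_1^4^4) =
    (A$1$1 * A$2$2 - A$1$2 * A$2$1) * (A$3$3 * A$4$4 - A$3$4 * A$4$3)
    - (A$1$1 * A$2$3 - A$1$3 * A$2$1) * (A$3$2 * A$4$4 - A$3$4 * A$4$2)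
    + (A$1$1 * A$2$4 - A$1$4 * A$2$1) * (A$3$2 * A$4$3 - A$3$3 * A$4$2)
    + (A$1$2 * A$2$3 - A$1$3 * A$2$2) * (A$3$1 * A$4$4 - A$3$4 * A$4$1)
    - (A$1$2 * A$2$4 - A$1$4 * A$2$2) * (A$3$1 * A$4$3 - A$3$3 * A$4$1)
    + (A$1$3 * A$2$4 - A$1$4 * A$2$3) * (A$3$1 * A$4$2 - A$3$2 * A$4$1)"
proof -
  have f: "finite {2::4, 3, 4}" "1 \<notin> {2::4, 3, 4}" "finite {3::4, 4}" "2 \<notin> {3::4, 4}"
    "finite {4::4}" "3 \<notin> {4::4}" by auto
  show ?thesis
    unfolding det_def UNIV_4
    unfolding sum_over_permutations_insert[OF f(1,2)] sum_over_permutations_insert[OF f(3,4)]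
      sum_over_permutations_insert[OF f(5,6)] permutes_sing
    by (simp add: sign_swap_id permutation_swap_id sign_compose permutation_compose sign_id
        swap_id_eq algebra_simps)
qed

lemma vector_4:
  "(vector [w,x,y,z] :: ('a::zero)^4)$1 = w" "(vector [w,x,y,z] :: ('a::zero)^4)$2 = x"
  "(vector [w,x,y,z] :: ('a::zero)^4)$3 = y" "(vector [w,x,y,z] :: ('a::zero)^4)$4 = z"
  unfolding vector_def by simp_all

definition pl :: "octonion \<Rightarrow> octonion \<Rightarrow> 8 \<Rightarrow> 8 \<Rightarrow> real" where
  "pl a b i j = a$i * b$j - a$j * b$i"

lemma dx4_pl:
  "dx4 i j k l a b c d = pl a b i j * pl c d k l - pl a b i k * pl c d j l + pl a b i l * pl c d j k
    + pl a b j k * pl c d i l - pl a b j l * pl c d i k + pl a b k l * pl c d i j"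
  by (simp add: dx4_def det_4 pl_def vector_4)

lemma pl_linear:
  "pl (a + a') b i j = pl a b i j + pl a' b i j" "pl a (b + b') i j = pl a b i j + pl a b' i j"
  "pl (r *\<^sub>R a) b i j = r * pl a b i j" "pl a (r *\<^sub>R b) i j = r * pl a b i j"
  by (simp_all add: pl_def algebra_simps)

lemma cayley_form_linear:
  "linear (\<lambda>a. cayley_form a b c d)" "linear (\<lambda>b. cayley_form a b c d)"
  "linear (\<lambda>c. cayley_form a b c d)" "linear (\<lambda>d. cayley_form a b c d)"
proof -
  have "linear (\<lambda>a. dx4 i j k l a b c d)" "linear (\<lambda>b. dx4 i j k l a b c d)"
    "linear (\<lambda>c. dx4 i j k l a b c d)" "linear (\<lambda>d. dx4 i j k l a b c d)" for i j k l
    by (rule linearI; simp add: dx4_pl pl_linear; algebra)+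
  note lin = this
  show "linear (\<lambda>a. cayley_form a b c d)" "linear (\<lambda>b. cayley_form a b c d)"
    "linear (\<lambda>c. cayley_form a b c d)" "linear (\<lambda>d. cayley_form a b c d)"
    unfolding cayley_form_def by (intro linear_compose_add linear_compose_sub lin)+
qed

lemma cayley_form_swap:
  "cayley_form b a c d = - cayley_form a b c d" "cayley_form a c b d = - cayley_form a b c d"
  "cayley_form a b d c = - cayley_form a b c d"
proof -
  have "dx4 i j k l b a c d = - dx4 i j k l a b c d" "dx4 i j k l a c b d = - dx4 i j k l a b c d"
    "dx4 i j k l a b d c = - dx4 i j k l a b c d" for i j k l
    unfolding dx4_pl pl_def by algebra+
  then show "cayley_form b a c d = - cayley_form a b c d" "cayley_form a c b d = - cayley_form a b c d"
    "cayley_form a b d c = - cayley_form a b c d"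
    by (simp_all add: cayley_form_def)
qed

text \<open>The complex coordinates of \<open>J\<^sub>E\<close> at \<open>E = e\<^sub>1 \<and> e\<^sub>2\<close>: the signs come from \<open>J e\<^sub>6 = - e\<^sub>7\<close>, \<open>J e\<^sub>5 = - e\<^sub>8\<close>.\<close>

definition cz :: "octonion \<Rightarrow> complex^4" where
  "cz x = vector [Complex (x$1) (x$2), Complex (x$3) (x$4), Complex (x$6) (- x$7), Complex (x$5) (- x$8)]"

definition zc :: "complex^4 \<Rightarrow> octonion" where
  "zc z = (\<chi> i. if i = 1 then Re (z$1) else if i = 2 then Im (z$1) else if i = 3 then Re (z$2)
     else if i = 4 then Im (z$2) else if i = 5 then Re (z$4) else if i = 6 then Re (z$3)
     else if i = 7 then - Im (z$3) else - Im (z$4))"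

definition herm :: "complex^'n \<Rightarrow> complex^'n \<Rightarrow> complex" where
  "herm z w = (\<Sum>k\<in>UNIV. cnj (z$k) * w$k)"

definition kaehler :: "octonion \<Rightarrow> octonion \<Rightarrow> real" where
  "kaehler x y = Im (herm (cz x) (cz y))"

lemma kaehler_eq:
  "kaehler x y = x$1 * y$2 - x$2 * y$1 + (x$3 * y$4 - x$4 * y$3) - (x$6 * y$7 - x$7 * y$6) - (x$5 * y$8 - x$8 * y$5)"
  by (simp add: kaehler_def herm_def sum_4 cz_def vector_4)

text \<open>The three products of \<open>kaehler\<close> are half the square of the Kaehler form,
  evaluated on four vectors; the determinant is the complex volume form. Both sides are polynomials
  in the real coordinates and are compared as such.\<close>

lemma cayley_form_complex:
  "cayley_form a b c d = kaehler a b * kaehler c d - kaehler a c * kaehler b d + kaehler a d * kaehler b c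
     + Im (det (vector [cz a, cz b, cz c, cz d]))"
  unfolding cayley_form_def dx4_pl pl_def kaehler_eq det_4 cz_def vector_4 
   complex.sel plus_complex.sel minus_complex.sel times_complex.sel
  by algebra

lemma cz_zc [simp]: "cz (zc z) = z"
  by (simp add: vec_eq_iff forall_4 cz_def zc_def vector_4 complex_eq_iff)

lemma zc_cz [simp]: "zc (cz x) = x"
  by (simp add: vec_eq_iff forall_8 cz_def zc_def vector_4)

lemma cz_add: "cz (x + y) = cz x + cz y"
  by (simp add: vec_eq_iff forall_4 cz_def vector_4 complex_eq_iff)

lemma cz_scaleR: "cz (r *\<^sub>R x) = r *\<^sub>R cz x"
  by (simp add: vec_eq_iff forall_4 cz_def vector_4 complex_eq_iff)

lemma zc_add: "zc (z + w) = zc z + zc w"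
  by (simp add: vec_eq_iff forall_8 zc_def)

lemma zc_scaleR: "zc (r *\<^sub>R z) = r *\<^sub>R zc z"
  by (simp add: vec_eq_iff forall_8 zc_def)

lemma inner_cz: "x \<bullet> y = Re (herm (cz x) (cz y))"
  by (simp add: inner_vec_def sum_8 herm_def sum_4 cz_def vector_4)

section \<open>The action of SU(4)\<close>

definition realify :: "complex^4^4 \<Rightarrow> real^8^8" where
  "realify A = matrix (\<lambda>x. zc (A *v cz x))"

lemma matrix_vector_mult_scaleR_complex: "(A :: complex^'n^'m) *v (r *\<^sub>R z) = r *\<^sub>R (A *v z)"
  by (simp add: vec_eq_iff matrix_vector_mult_def scaleR_sum_right)

lemma realify_mult_vec: "realify A *v x = zc (A *v cz x)"
  unfolding realify_def
  by (subst matrix_works)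
    (auto intro!: linearI simp: cz_add cz_scaleR matrix_vector_right_distrib zc_add
      matrix_vector_mult_scaleR_complex zc_scaleR linear_matrix_vector_mul_eq)

lemma realify_mult: "realify (A ** B) = realify A ** realify B"
  by (simp add: matrix_eq realify_mult_vec matrix_vector_mul_assoc[symmetric])

text \<open>\<open>Spin7\<close> without the determinant condition. Membership here can be checked
  on the two forms alone; determinant one is recovered for squares at once and for all elements
  later.\<close>

definition Cay :: "(real^8^8) set" where
  "Cay = {g. orthogonal_matrix g \<and>
     (\<forall>a b c d. cayley_form (g *v a) (g *v b) (g *v c) (g *v d) = cayley_form a b c d)}"

lemma orthogonal_matrixI:
  fixes g :: "real^'n^'n"
  assumes "\<And>x y. (g *v x) \<bullet> (g *v y) = x \<bullet> y"
  shows "orthogonal_matrix g"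
  using assms orthogonal_transformation_matrix[of "(*v) g"]
  by (simp add: orthogonal_transformation_def)

lemma det_vector_matrix_mult:
  "det (vector [A *v a, A *v b, A *v c, A *v d] :: complex^4^4) = det A * det (vector [a, b, c, d] :: complex^4^4)"
proof -
  have "vector [A *v a, A *v b, A *v c, A *v d] = (vector [a, b, c, d] :: complex^4^4) ** transpose A"
    by (simp add: vec_eq_iff forall_4 vector_4 matrix_matrix_mult_def matrix_vector_mult_def
        transpose_def sum_4 mult.commute)
  then show ?thesis by (simp add: det_mul)
qed

text \<open>Unitarity preserves the real and the imaginary part of \<open>herm\<close>, hence the
  metric and the Kaehler form; determinant one preserves the complex volume form.\<close>

lemma realify_in_Cay:
  assumes "\<And>z w. herm (A *v z) (A *v w) = herm z w" "det A = 1"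
  shows "realify A \<in> Cay"
proof -
  have "orthogonal_matrix (realify A)"
    by (rule orthogonal_matrixI) (simp add: inner_cz realify_mult_vec assms)
  then show ?thesis
    by (simp add: Cay_def cayley_form_complex kaehler_def realify_mult_vec assms det_vector_matrix_mult)
qed

lemma Cay_square_in_Spin7:
  assumes "g \<in> Cay"
  shows "g ** g \<in> Spin7"
proof -
  have "det g * det g = 1" using assms det_orthogonal_matrix[of g] by (auto simp: Cay_def)
  then show ?thesis using assms
    by (auto simp: Cay_def Spin7_def det_mul orthogonal_matrix_mul matrix_vector_mul_assoc[symmetric])
qed

section \<open>Transitivity of Spin(7)\<close>

text \<open>The copy of SU(2) in the coordinates \<open>i\<close>, \<open>j\<close>, written so that
  for a unit pair it sends \<alpha>, \<beta> in these coordinates to 1, 0.\<close>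

definition su :: "4 \<Rightarrow> 4 \<Rightarrow> complex \<Rightarrow> complex \<Rightarrow> complex^4^4" where
  "su i j \<alpha> \<beta> = (\<chi> k l. if k = i then (if l = i then cnj \<alpha> else if l = j then cnj \<beta> else 0)
     else if k = j then (if l = i then - \<beta> else if l = j then \<alpha> else 0) else if k = l then 1 else 0)"

lemma su_mult_vec:
  assumes "i \<noteq> j"
  shows "su i j \<alpha> \<beta> *v z = (\<chi> k. if k = i then cnj \<alpha> * z$i + cnj \<beta> * z$j
     else if k = j then - \<beta> * z$i + \<alpha> * z$j else z$k)"
  using assms exhaust_4[of i] exhaust_4[of j]
  by (elim disjE; simp add: su_def vec_eq_iff forall_4 matrix_vector_mult_def sum_4)

lemma unit_pair_mult:
  assumes "(cmod \<alpha>)\<^sup>2 + (cmod \<beta>)\<^sup>2 = 1"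
  shows "cnj \<alpha> * \<alpha> + cnj \<beta> * \<beta> = 1"
  using assms unfolding cmod_power2 by (simp add: complex_eq_iff power2_eq_square)

lemma su_in_Cay:
  assumes "i \<noteq> j" "(cmod \<alpha>)\<^sup>2 + (cmod \<beta>)\<^sup>2 = 1"
  shows "realify (su i j \<alpha> \<beta>) \<in> Cay"
proof (rule realify_in_Cay)
  note u = unit_pair_mult[OF assms(2)]
  show "herm (su i j \<alpha> \<beta> *v z) (su i j \<alpha> \<beta> *v w) = herm z w" for z w
  proof -
    have "(\<alpha> * cnj zi + \<beta> * cnj zj) * (cnj \<alpha> * wi + cnj \<beta> * wj) +
       (- (cnj \<beta> * cnj zi) + cnj \<alpha> * cnj zj) * (- (\<beta> * wi) + \<alpha> * wj) = cnj zi * wi + cnj zj * wj" for zi zj wi wj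
      using u by algebra
    note e = this
    show ?thesis
      using assms(1) exhaust_4[of i] exhaust_4[of j] e[of "z$i" "z$j" "w$i" "w$j"]
      by (elim disjE; simp add: su_mult_vec herm_def sum_4 add_ac)
  qed
  have "\<beta> * cnj \<beta> + \<alpha> * cnj \<alpha> = 1" using u by algebra
  then show "det (su i j \<alpha> \<beta>) = 1"
    using assms(1) exhaust_4[of i] exhaust_4[of j]
    unfolding det_4 su_def vec_lambda_beta
    by (elim disjE; simp add: mult.commute add.commute)
qed

text \<open>With \<open>su i j \<alpha> \<beta>\<close> read as a unit quaternion \<open>q\<close>, the root is \<open>(1 + q) / \<bar>1 + q\<bar>\<close>. Since
  an orthogonal matrix that is a square has determinant 1, no 8 by 8 determinant has to be computed.\<close>

lemma su_square:
  assumes "i \<noteq> j" "(cmod \<alpha>)\<^sup>2 + (cmod \<beta>)\<^sup>2 = 1"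
  obtains \<gamma> \<delta> where "(cmod \<gamma>)\<^sup>2 + (cmod \<delta>)\<^sup>2 = 1" "su i j \<alpha> \<beta> = su i j \<gamma> \<delta> ** su i j \<gamma> \<delta>"
proof -
  have "\<exists>\<gamma> \<delta>. (cmod \<gamma>)\<^sup>2 + (cmod \<delta>)\<^sup>2 = 1 \<and> \<gamma> * \<gamma> - cnj \<delta> * \<delta> = \<alpha> \<and> \<delta> * cnj \<gamma> + \<gamma> * \<delta> = \<beta>"
  proof (cases "Re \<alpha> = -1")
    case True
    then have "(Im \<alpha>)\<^sup>2 + (cmod \<beta>)\<^sup>2 = 0" using assms(2) by (simp add: cmod_power2[of \<alpha>])
    then have "Im \<alpha> = 0" "\<beta> = 0" by (simp_all add: sum_power2_eq_zero_iff)
    \<comment> \<open>The quaternion is -1, where \<open>1 + q\<close> vanishes and cannot be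
      normalized; the imaginary unit is a square root.\<close>
    then show ?thesis using True by (intro exI[of _ \<i>] exI[of _ 0]) (simp add: complex_eq_iff)
  next
    case False
    have eq: "Re \<alpha> * Re \<alpha> + Im \<alpha> * Im \<alpha> + (Re \<beta> * Re \<beta> + Im \<beta> * Im \<beta>) = 1"
      using assms(2) unfolding cmod_power2 by (simp add: power2_eq_square)
    have "Re \<alpha> * Re \<alpha> \<le> 1" using eq zero_le_square[of "Im \<alpha>"]
        zero_le_square[of "Re \<beta>"] zero_le_square[of "Im \<beta>"] by linarith
    then have "\<bar>Re \<alpha>\<bar> \<le> 1" by (simp add: power2_eq_square[symmetric] abs_square_le_1)
    then have pos: "(1 + Re \<alpha>) / 2 > 0" using False by simp
    \<comment> \<open>\<open>2 * m\<close> is the length of \<open>1 + q\<close>, because its square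
      is \<open>2 + 2 * Re \<alpha>\<close>; thus \<open>n\<close> is the normalizing
      factor.\<close>
    define m where "m = sqrt ((1 + Re \<alpha>) / 2)"
    define n where "n = 1 / (2 * m)"
    have m: "m > 0" using pos by (simp add: m_def)
    have "m * m = (1 + Re \<alpha>) / 2" using pos by (simp add: m_def)
    then have mm: "2 * (m * m) = 1 + Re \<alpha>" by simp
    have mn: "2 * (m * n) = 1" using m by (simp add: n_def)
    have nn: "2 * (1 + Re \<alpha>) * (n * n) = 1" unfolding mm[symmetric] using mn by algebra
    have nm: "(1 + Re \<alpha>) * n = m" unfolding mm[symmetric] using mn by algebra
    show ?thesis
    proof (rule exI[of _ "n *\<^sub>R (1 + \<alpha>)"], rule exI[of _ "n *\<^sub>R \<beta>"], intro conjI)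
      show "(cmod (n *\<^sub>R (1 + \<alpha>)))\<^sup>2 + (cmod (n *\<^sub>R \<beta>))\<^sup>2 = 1"
        unfolding cmod_power2 using nn eq by simp algebra
      show "n *\<^sub>R (1 + \<alpha>) * n *\<^sub>R (1 + \<alpha>) - cnj (n *\<^sub>R \<beta>) * n *\<^sub>R \<beta> = \<alpha>"
        unfolding complex_eq_iff using nn eq by simp algebra
      show "n *\<^sub>R \<beta> * cnj (n *\<^sub>R (1 + \<alpha>)) + n *\<^sub>R (1 + \<alpha>) * n *\<^sub>R \<beta> = \<beta>"
        unfolding complex_eq_iff using nn eq by simp algebra
    qed
  qed
  then obtain \<gamma> \<delta> where gd: "(cmod \<gamma>)\<^sup>2 + (cmod \<delta>)\<^sup>2 = 1"
      "\<gamma> * \<gamma> - cnj \<delta> * \<delta> = \<alpha>" "\<delta> * cnj \<gamma> + \<gamma> * \<delta> = \<beta>" by blast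
  have "su i j \<alpha> \<beta> = su i j \<gamma> \<delta> ** su i j \<gamma> \<delta>"
    using assms(1)
    by (simp add: matrix_eq matrix_vector_mul_assoc[symmetric] su_mult_vec vec_eq_iff gd(2,3)[symmetric] algebra_simps)
  with gd show ?thesis using that by blast
qed

lemma su_in_Spin7:
  assumes "i \<noteq> j" "(cmod \<alpha>)\<^sup>2 + (cmod \<beta>)\<^sup>2 = 1"
  shows "realify (su i j \<alpha> \<beta>) \<in> Spin7"
  using su_square[OF assms] Cay_square_in_Spin7[OF su_in_Cay[OF assms(1)]] realify_mult by metis

text \<open>This rotation fixes \<open>e\<^sub>1\<close>, but it mixes \<open>e\<^sub>2\<close> and \<open>e\<^sub>3\<close>, so it is not in \<open>SU(4)\<close>.\<close>

definition rot :: "real \<Rightarrow> real \<Rightarrow> octonion \<Rightarrow> octonion" where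
  "rot c s x = (\<chi> k. if k = 2 then c * x$2 - s * x$3 else if k = 3 then s * x$2 + c * x$3
     else if k = 5 then c * x$5 - s * x$6 else if k = 6 then s * x$5 + c * x$6 else x$k)"

lemma linear_rot: "linear (rot c s)"
  by (rule linearI) (simp_all add: rot_def vec_eq_iff algebra_simps)

lemma matrix_rot: "matrix (rot c s) *v x = rot c s x"
  by (simp add: linear_rot)

lemma cayley_form_rot:
  assumes "c * c + s * s = 1"
  shows "cayley_form (rot c s x) (rot c s y) (rot c s z) (rot c s w) = cayley_form x y z w"
  using assms unfolding cayley_form_def dx4_pl pl_def rot_def
  apply simp
  by algebra

lemma rot_in_Cay:
  assumes "c * c + s * s = 1"
  shows "matrix (rot c s) \<in> Cay"
proof -
  have "orthogonal_matrix (matrix (rot c s))"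
  proof (rule orthogonal_matrixI)
    show "(matrix (rot c s) *v x) \<bullet> (matrix (rot c s) *v y) = x \<bullet> y" for x y
      using assms unfolding matrix_rot inner_vec_def sum_8 rot_def by simp algebra
  qed
  then show ?thesis using cayley_form_rot[OF assms]
    by (simp add: Cay_def matrix_rot)
qed

text \<open>A rotation is the square of the rotation by half the angle, so its determinant is
  obtained from \<open>Cay_square_in_Spin7\<close>.\<close>

lemma rot_in_Spin7:
  assumes "c * c + s * s = 1"
  shows "matrix (rot c s) \<in> Spin7"
proof -
  have "c\<^sup>2 + s\<^sup>2 = 1" using assms by (simp add: power2_eq_square)
  then obtain t where t: "c = cos t" "s = sin t" using sincos_total_2pi by metis
  have m: "c = cos (t/2) * cos (t/2) - sin (t/2) * sin (t/2)" "s = 2 * sin (t/2) * cos (t/2)"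
    using cos_double[of "t/2"] sin_double[of "t/2"] t by (simp_all add: power2_eq_square)
  have u: "cos (t/2) * cos (t/2) + sin (t/2) * sin (t/2) = 1"
    using sin_cos_squared_add2[of "t/2"] by (simp add: power2_eq_square)
  have "matrix (rot c s) = matrix (rot (cos (t/2)) (sin (t/2))) ** matrix (rot (cos (t/2)) (sin (t/2)))"
    unfolding matrix_eq matrix_vector_mul_assoc[symmetric] matrix_rot
    by (simp add: vec_eq_iff rot_def m algebra_simps)
  then show ?thesis using Cay_square_in_Spin7[OF rot_in_Cay[OF u]] by simp
qed

section \<open>The triple product and its equivariance\<close>

declare transpose_matrix_vector [simp del]

abbreviation ax :: "8 \<Rightarrow> octonion" where "ax i \<equiv> axis i 1"

text \<open>The triple cross product: the Cayley form with its last slot dualized by the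
  metric.\<close>

definition tc :: "octonion \<Rightarrow> octonion \<Rightarrow> octonion \<Rightarrow> octonion" where
  "tc a b c = (\<chi> l. cayley_form a b c (ax l))"

lemma tc_inner: "tc a b c \<bullet> d = cayley_form a b c d"
proof -
  have "cayley_form a b c (\<Sum>l\<in>UNIV. d$l *\<^sub>R ax l) = (\<Sum>l\<in>UNIV. d$l * cayley_form a b c (ax l))"
    using linear_sum[OF cayley_form_linear(4)[of a b c], of "\<lambda>l. d$l *\<^sub>R ax l" UNIV]
      linear_cmul[OF cayley_form_linear(4)[of a b c]] by simp
  moreover have "(\<Sum>l\<in>UNIV. d$l *\<^sub>R ax l) = d"
    using basis_expansion[of d] by (simp add: scalar_mult_eq_scaleR)
  ultimately show ?thesis by (simp add: inner_vec_def tc_def mult.commute)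
qed

lemma Spin7_orthogonal: "g \<in> Spin7 \<Longrightarrow> orthogonal_matrix g"
  by (simp add: Spin7_def)

lemma orthogonal_matrix_inner:
  fixes g :: "real^'n^'n"
  shows "orthogonal_matrix g \<Longrightarrow> (g *v x) \<bullet> (g *v y) = x \<bullet> y"
  using orthogonal_transformation_matrix[of "(*v) g"] by (simp add: orthogonal_transformation_def)

lemma Spin7_inner: "g \<in> Spin7 \<Longrightarrow> (g *v x) \<bullet> (g *v y) = x \<bullet> y"
  by (simp add: Spin7_orthogonal orthogonal_matrix_inner)

lemma Spin7_norm: "g \<in> Spin7 \<Longrightarrow> norm (g *v x) = norm x"
  by (simp add: norm_eq_sqrt_inner Spin7_inner)

lemma Spin7_cayley_form:
  "g \<in> Spin7 \<Longrightarrow> cayley_form (g *v a) (g *v b) (g *v c) (g *v d) = cayley_form a b c d"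
  by (simp add: Spin7_def)

lemma Spin7_transpose_mult:
  assumes "g \<in> Spin7"
  shows "transpose g ** g = mat 1" "g ** transpose g = mat 1"
  using Spin7_orthogonal[OF assms] by (auto simp: orthogonal_matrix_def)

lemma Spin7_transpose_vec:
  assumes "g \<in> Spin7"
  shows "transpose g *v (g *v x) = x" "g *v (transpose g *v x) = x"
  using Spin7_transpose_mult[OF assms] by (simp_all add: matrix_vector_mul_assoc)

lemma Spin7_one: "mat 1 \<in> Spin7"
  by (simp add: Spin7_def orthogonal_matrix_id)

lemma Spin7_mult: "g \<in> Spin7 \<Longrightarrow> h \<in> Spin7 \<Longrightarrow> g ** h \<in> Spin7"
  by (simp add: Spin7_def orthogonal_matrix_mul det_mul matrix_vector_mul_assoc[symmetric])

lemma Spin7_transpose: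
  assumes "g \<in> Spin7"
  shows "transpose g \<in> Spin7"
proof -
  have "cayley_form (transpose g *v a) (transpose g *v b) (transpose g *v c) (transpose g *v d) = cayley_form a b c d" for a b c d
    using Spin7_cayley_form[OF assms, of "transpose g *v a" "transpose g *v b" "transpose g *v c" "transpose g *v d"]
    by (simp add: Spin7_transpose_vec[OF assms])
  then show ?thesis using assms by (simp add: Spin7_def orthogonal_matrix_transpose det_transpose)
qed

lemma inner_transpose_matrix:
  "(g *v x) \<bullet> y = x \<bullet> (transpose g *v y)" for g :: "real^'n^'n"
  by (metis dot_lmul_matrix vector_transpose_matrix)

lemma tc_Spin7:
  assumes "g \<in> Spin7"
  shows "tc (g *v a) (g *v b) (g *v c) = g *v tc a b c"
proof -
  have "tc (g *v a) (g *v b) (g *v c) \<bullet> d = (g *v tc a b c) \<bullet> d" for d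
    using Spin7_cayley_form[OF assms, of a b c "transpose g *v d"]
    by (simp add: tc_inner inner_transpose_matrix Spin7_transpose_vec[OF assms])
  then show ?thesis by (metis vector_eq_rdot)
qed

section \<open>Moving orthonormal vectors to standard position\<close>

lemma cz_eq_iff: "cz x = cz y \<longleftrightarrow> x = y"
  by (metis zc_cz)

text \<open>The pair of coordinates \<open>i\<close>, \<open>j\<close> of \<open>x\<close>, divided
  by its length, is the unit pair of \<open>su\<close>; the rotation moves the whole length into
  coordinate \<open>i\<close>. The last conjunct is what lets later rotations leave vectors already
  in standard position untouched.\<close>

lemma givens:
  assumes "i \<noteq> j"
  shows "\<exists>g\<in>Spin7. cz (g *v x) $ j = 0 \<and> Im (cz (g *v x) $ i) = 0 \<and> Re (cz (g *v x) $ i) \<ge> 0 \<and>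
    (\<forall>k. k \<noteq> i \<longrightarrow> k \<noteq> j \<longrightarrow> cz (g *v x) $ k = cz x $ k) \<and>
    (\<forall>y. cz y $ i = 0 \<longrightarrow> cz y $ j = 0 \<longrightarrow> g *v y = y)"
proof (cases "cz x $ i = 0 \<and> cz x $ j = 0")
  case True
  then show ?thesis using Spin7_one by (intro bexI[of _ "mat 1"]) auto
next
  case False
  define r where "r = sqrt ((cmod (cz x $ i))\<^sup>2 + (cmod (cz x $ j))\<^sup>2)"
  have r: "r > 0" using False by (auto simp: r_def sum_power2_gt_zero_iff)
  have rr: "r\<^sup>2 = (cmod (cz x $ i))\<^sup>2 + (cmod (cz x $ j))\<^sup>2" by (simp add: r_def)
  define \<alpha> \<beta> where "\<alpha> = cz x $ i / r" and "\<beta> = cz x $ j / r"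
  have u: "(cmod \<alpha>)\<^sup>2 + (cmod \<beta>)\<^sup>2 = 1"
    using r by (simp add: \<alpha>_def \<beta>_def norm_divide power_divide add_divide_distrib[symmetric] rr[symmetric])
  have x: "cz x $ i = r * \<alpha>" "cz x $ j = r * \<beta>" using r by (simp_all add: \<alpha>_def \<beta>_def)
  have "cnj \<alpha> * (r * \<alpha>) + cnj \<beta> * (r * \<beta>) = r"
    using unit_pair_mult[OF u] by algebra
  then have *: "cnj \<alpha> * cz x $ i + cnj \<beta> * cz x $ j = r" by (simp add: x)
  have fix_y: "realify (su i j \<alpha> \<beta>) *v y = y" if "cz y $ i = 0" "cz y $ j = 0" for y
  proof -
    have "cz (realify (su i j \<alpha> \<beta>) *v y) = cz y"
      using that by (simp add: realify_mult_vec su_mult_vec[OF assms] vec_eq_iff)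
    then show ?thesis by (simp add: cz_eq_iff)
  qed
  show ?thesis
  proof (intro bexI[OF _ su_in_Spin7[OF assms u]] conjI allI impI fix_y)
    show "cz (realify (su i j \<alpha> \<beta>) *v x) $ j = 0"
      using assms by (simp add: realify_mult_vec su_mult_vec x)
    show "Im (cz (realify (su i j \<alpha> \<beta>) *v x) $ i) = 0" "Re (cz (realify (su i j \<alpha> \<beta>) *v x) $ i) \<ge> 0"
      using assms r * by (simp_all add: realify_mult_vec su_mult_vec)
  qed (use assms in \<open>auto simp: realify_mult_vec su_mult_vec\<close>)
qed

lemma inner_self_cz: "x \<bullet> x = (cmod (cz x $ 1))\<^sup>2 + (cmod (cz x $ 2))\<^sup>2 + (cmod (cz x $ 3))\<^sup>2 + (cmod (cz x $ 4))\<^sup>2"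
  unfolding cmod_power2 by (simp add: inner_vec_def sum_8 cz_def vector_4 power2_eq_square)

lemma cz_ax:
  "cz (ax 1) = vector [1, 0, 0, 0]" "cz (ax 2) = vector [\<i>, 0, 0, 0]" "cz (ax 3) = vector [0, 1, 0, 0]"
  "cz (ax 4) = vector [0, \<i>, 0, 0]" "cz (ax 5) = vector [0, 0, 0, 1]"
  by (simp_all add: cz_def vec_eq_iff forall_4 vector_4 axis_def complex_eq_iff)

lemma nonneg_unit_complex:
  assumes "Im z = 0" "Re z \<ge> 0" "(cmod z)\<^sup>2 = 1"
  shows "z = 1"
proof -
  have "(Re z)\<^sup>2 = 1" using assms unfolding cmod_power2 by simp
  then have "Re z = 1" using assms(2) by (simp add: power2_eq_1_iff)
  then show ?thesis using assms(1) by (simp add: complex_eq_iff)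
qed

lemma Spin7_transitive_1:
  assumes "norm x = 1"
  obtains g where "g \<in> Spin7" "g *v x = ax 1"
proof -
  obtain g1 where g1: "g1 \<in> Spin7" "cz (g1 *v x) $ 2 = 0"
    using givens[of 1 2 x] by (auto simp: forall_4)
  obtain g2 where g2: "g2 \<in> Spin7" "cz (g2 *v (g1 *v x)) $ 3 = 0" "cz (g2 *v (g1 *v x)) $ 2 = 0"
    using givens[of 1 3 "g1 *v x"] g1(2) by (auto simp: forall_4)
  let ?y = "g2 *v (g1 *v x)"
  obtain g3 where g3: "g3 \<in> Spin7" "cz (g3 *v ?y) $ 4 = 0" "cz (g3 *v ?y) $ 2 = 0" "cz (g3 *v ?y) $ 3 = 0"
     "Im (cz (g3 *v ?y) $ 1) = 0" "Re (cz (g3 *v ?y) $ 1) \<ge> 0"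
    using givens[of 1 4 ?y] g2(2,3) by (auto simp: forall_4)
  have "norm (g3 *v ?y) = 1" using assms g1 g2 g3 by (simp add: Spin7_norm)
  then have "(g3 *v ?y) \<bullet> (g3 *v ?y) = 1" by (simp add: dot_square_norm)
  then have "(cmod (cz (g3 *v ?y) $ 1))\<^sup>2 = 1" unfolding inner_self_cz g3(2-4) by simp
  then have "cz (g3 *v ?y) $ 1 = 1" using nonneg_unit_complex g3 by blast
  then have "cz (g3 *v ?y) = cz (ax 1)"
    by (simp add: vec_eq_iff forall_4 cz_ax vector_4 g3)
  then have "g3 *v ?y = ax 1" by (simp only: cz_eq_iff)
  then show ?thesis using that[of "g3 ** (g2 ** g1)"] g1 g2 g3
    by (simp add: Spin7_mult matrix_vector_mul_assoc[symmetric])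
qed

text \<open>Both rotations act in the last three complex coordinates, so the product lies in SU(3)
  and fixes \<open>ax 1\<close> and \<open>ax 2\<close>.\<close>

lemma Spin7_givens_23_24:
  obtains g where "g \<in> Spin7" "g *v ax 1 = ax 1" "g *v ax 2 = ax 2" "cz (g *v x) $ 3 = 0" "cz (g *v x) $ 4 = 0"
    "cz (g *v x) $ 1 = cz x $ 1" "Im (cz (g *v x) $ 2) = 0" "Re (cz (g *v x) $ 2) \<ge> 0"
proof -
  obtain g1 where g1: "g1 \<in> Spin7" "cz (g1 *v x) $ 3 = 0" "cz (g1 *v x) $ 1 = cz x $ 1"
     "\<And>y. cz y $ 2 = 0 \<Longrightarrow> cz y $ 3 = 0 \<Longrightarrow> g1 *v y = y"
    using givens[of 2 3 x] by (auto simp: forall_4)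
  let ?y = "g1 *v x"
  obtain g2 where g2: "g2 \<in> Spin7" "cz (g2 *v ?y) $ 4 = 0" "cz (g2 *v ?y) $ 3 = 0" "cz (g2 *v ?y) $ 1 = cz x $ 1"
     "\<And>y. cz y $ 2 = 0 \<Longrightarrow> cz y $ 4 = 0 \<Longrightarrow> g2 *v y = y"
     "Im (cz (g2 *v ?y) $ 2) = 0" "Re (cz (g2 *v ?y) $ 2) \<ge> 0"
    using givens[of 2 4 ?y] g1 by (auto simp: forall_4)
  show ?thesis using g1 g2
    by (intro that[of "g2 ** g1"])
      (simp_all add: Spin7_mult matrix_vector_mul_assoc[symmetric] cz_ax vector_4)
qed

lemma inner_ax: "x \<bullet> ax i = x $ i" "ax i \<bullet> x = x $ i"
  by (simp_all add: cart_eq_inner_axis inner_commute)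

lemma cz_nth: "cz x $ 1 = Complex (x$1) (x$2)" "cz x $ 2 = Complex (x$3) (x$4)"
  "cz x $ 3 = Complex (x$6) (- x$7)" "cz x $ 4 = Complex (x$5) (- x$8)"
  by (simp_all add: cz_def vector_4)

text \<open>An element of SU(4) that fixes \<open>ax 1\<close> also fixes \<open>ax 2\<close>, which
  is \<i> times \<open>ax 1\<close>, so it cannot change the component of \<open>x\<close> along
  \<open>ax 2\<close>. SU(3) brings \<open>x\<close> into the span of \<open>ax 2\<close> and
  \<open>ax 3\<close>, and \<open>rot\<close> completes the motion.\<close>

lemma Spin7_transitive_2:
  assumes "norm x = 1" "x \<bullet> ax 1 = 0"
  obtains g where "g \<in> Spin7" "g *v ax 1 = ax 1" "g *v x = ax 2"
proof -
  obtain g where g: "g \<in> Spin7" "g *v ax 1 = ax 1" "cz (g *v x) $ 3 = 0" "cz (g *v x) $ 4 = 0"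
    "cz (g *v x) $ 1 = cz x $ 1" "Im (cz (g *v x) $ 2) = 0"
    using Spin7_givens_23_24[of x] by metis
  let ?y = "g *v x"
  have y: "?y $ 6 = 0" "?y $ 7 = 0" "?y $ 5 = 0" "?y $ 8 = 0" "?y $ 1 = 0" "?y $ 4 = 0"
    using g(3-6) assms(2) by (auto simp: cz_nth inner_ax zero_complex.code)
  have "?y \<bullet> ?y = 1" using assms g(1) by (simp add: Spin7_norm dot_square_norm)
  then have u: "?y$2 * ?y$2 + ?y$3 * ?y$3 = 1" by (simp add: inner_vec_def sum_8 y)
  then have R: "matrix (rot (?y$2) (- ?y$3)) \<in> Spin7" by (intro rot_in_Spin7) simp
  have "rot (?y$2) (- ?y$3) ?y = ax 2" "rot (?y$2) (- ?y$3) (ax 1) = ax 1"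
    using u by (simp_all add: vec_eq_iff forall_8 rot_def y axis_def)
  then show ?thesis
    using g R by (intro that[of "matrix (rot (?y$2) (- ?y$3)) ** g"])
      (simp_all add: Spin7_mult matrix_vector_mul_assoc[symmetric] matrix_rot)
qed

lemma Spin7_transitive_3:
  assumes "norm x = 1" "x \<bullet> ax 1 = 0" "x \<bullet> ax 2 = 0"
  obtains g where "g \<in> Spin7" "g *v ax 1 = ax 1" "g *v ax 2 = ax 2" "g *v x = ax 3"
proof -
  obtain g where g: "g \<in> Spin7" "g *v ax 1 = ax 1" "g *v ax 2 = ax 2" "cz (g *v x) $ 3 = 0" "cz (g *v x) $ 4 = 0"
    "cz (g *v x) $ 1 = cz x $ 1" "Im (cz (g *v x) $ 2) = 0" "Re (cz (g *v x) $ 2) \<ge> 0"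
    using Spin7_givens_23_24[of x] by metis
  have 1: "cz (g *v x) $ 1 = 0" using g(6) assms by (simp add: cz_nth inner_ax zero_complex.code)
  have "(g *v x) \<bullet> (g *v x) = 1" using assms g(1) by (simp add: Spin7_norm dot_square_norm)
  then have "(cmod (cz (g *v x) $ 2))\<^sup>2 = 1" unfolding inner_self_cz g(4,5) 1 by simp
  then have "cz (g *v x) $ 2 = 1" using nonneg_unit_complex g by blast
  then have "cz (g *v x) = cz (ax 3)" by (simp add: vec_eq_iff forall_4 cz_ax vector_4 g(4,5) 1)
  then have "g *v x = ax 3" by (simp only: cz_eq_iff)
  then show ?thesis using that g by blast
qed

text \<open>The remaining freedom is the SU(2) in the complex coordinates 3 and 4, which fixes
  \<open>ax 1\<close> to \<open>ax 4\<close>. The pivot is coordinate 4 because its real part is the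
  real coordinate 5.\<close>

lemma Spin7_transitive_4:
  assumes "norm x = 1" "x \<bullet> ax 1 = 0" "x \<bullet> ax 2 = 0" "x \<bullet> ax 3 = 0" "x \<bullet> ax 4 = 0"
  obtains g where "g \<in> Spin7" "g *v ax 1 = ax 1" "g *v ax 2 = ax 2" "g *v ax 3 = ax 3" "g *v x = ax 5"
proof -
  obtain g where g: "g \<in> Spin7" "cz (g *v x) $ 3 = 0" "Im (cz (g *v x) $ 4) = 0" "Re (cz (g *v x) $ 4) \<ge> 0"
    "cz (g *v x) $ 1 = cz x $ 1" "cz (g *v x) $ 2 = cz x $ 2"
    "\<And>y. cz y $ 4 = 0 \<Longrightarrow> cz y $ 3 = 0 \<Longrightarrow> g *v y = y"
    using givens[of 4 3 x] by (auto simp: forall_4)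
  have 1: "cz (g *v x) $ 1 = 0" "cz (g *v x) $ 2 = 0"
    using g(5,6) assms by (simp_all add: cz_nth inner_ax zero_complex.code)
  have "(g *v x) \<bullet> (g *v x) = 1" using assms g(1) by (simp add: Spin7_norm dot_square_norm)
  then have "(cmod (cz (g *v x) $ 4))\<^sup>2 = 1" unfolding inner_self_cz g(2) 1 by simp
  then have "cz (g *v x) $ 4 = 1" using nonneg_unit_complex g by blast
  then have "cz (g *v x) = cz (ax 5)" by (simp add: vec_eq_iff forall_4 cz_ax vector_4 g(2) 1)
  then have "g *v x = ax 5" by (simp only: cz_eq_iff)
  then show ?thesis using that[of g] g(1,7) by (simp add: cz_ax vector_4)
qed

lemma ax_inner: "ax i \<bullet> ax j = (if i = j then 1 else 0)"
  by (simp add: inner_axis_axis)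

text \<open>The first four values show that \<open>ax 1\<close>, \<open>ax 2\<close>,
  \<open>ax 3\<close>, \<open>ax 5\<close> generate the standard basis under the triple product, and
  dictate the columns of \<open>adapted\<close>. The last two enter the Nijenhuis
  computation.\<close>

lemma tc_ax:
  "tc (ax 1) (ax 2) (ax 3) = ax 4" "tc (ax 3) (ax 2) (ax 5) = ax 6" "tc (ax 1) (ax 3) (ax 5) = ax 7"
  "tc (ax 2) (ax 1) (ax 5) = ax 8" "tc (ax 4) (ax 2) (ax 5) = ax 7" "tc (ax 8) (ax 2) (ax 3) = ax 7"
  by (simp_all add: vec_eq_iff forall_8 tc_def cayley_form_def dx4_pl pl_def axis_def)

text \<open>In complex coordinates this is multiplication by \<i> on the last three coordinates and
  0 on the first.\<close>

lemma tc_ax_12: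
  "tc (ax 1) (ax 2) x = (\<chi> i. if i = 3 then - x$4 else if i = 4 then x$3 else if i = 5 then x$8
     else if i = 6 then x$7 else if i = 7 then - x$6 else if i = 8 then - x$5 else 0)"
  by (simp add: vec_eq_iff forall_8 tc_def cayley_form_def dx4_pl pl_def axis_def)

lemma tc_linear: "linear (\<lambda>a. tc a b c)" "linear (\<lambda>b. tc a b c)" "linear (\<lambda>c. tc a b c)"
  by (rule linearI; simp add: tc_def vec_eq_iff linear_add[OF cayley_form_linear(1)]
      linear_add[OF cayley_form_linear(2)] linear_add[OF cayley_form_linear(3)]
      linear_cmul[OF cayley_form_linear(1)] linear_cmul[OF cayley_form_linear(2)]
      linear_cmul[OF cayley_form_linear(3)])+

lemmas tc_simps =
  linear_add[OF tc_linear(1)] linear_add[OF tc_linear(2)] linear_add[OF tc_linear(3)]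
  linear_diff[OF tc_linear(1)] linear_diff[OF tc_linear(2)] linear_diff[OF tc_linear(3)]
  linear_cmul[OF tc_linear(1)] linear_cmul[OF tc_linear(2)] linear_cmul[OF tc_linear(3)]
  linear_neg[OF tc_linear(1)] linear_neg[OF tc_linear(2)] linear_neg[OF tc_linear(3)]
  linear_0[OF tc_linear(1)] linear_0[OF tc_linear(2)] linear_0[OF tc_linear(3)]

lemma tc_swap: "tc b a c = - tc a b c" "tc a c b = - tc a b c"
  by (simp_all add: tc_def vec_eq_iff cayley_form_swap(1)[of b a] cayley_form_swap(2)[of a c])

lemma tc_refl: "tc a a c = 0" "tc a c c = 0" "tc a c a = 0"
proof -
  show *: "tc a a c = 0" "tc a c c = 0" for a c
    using tc_swap(1)[of a a c] tc_swap(2)[of a c c] by (simp_all add: eq_neg_iff_add_eq_0 scaleR_2[symmetric])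
  show "tc a c a = 0" using tc_swap(2)[of a c a] *(1) by simp
qed

lemma Spin7_transitive_quadruple:
  assumes "norm x1 = 1" "norm x2 = 1" "norm x3 = 1" "norm x5 = 1"
    and "x1 \<bullet> x2 = 0" "x1 \<bullet> x3 = 0" "x2 \<bullet> x3 = 0"
    and "x5 \<bullet> x1 = 0" "x5 \<bullet> x2 = 0" "x5 \<bullet> x3 = 0" "x5 \<bullet> tc x1 x2 x3 = 0"
  obtains g where "g \<in> Spin7" "g *v x1 = ax 1" "g *v x2 = ax 2" "g *v x3 = ax 3" "g *v x5 = ax 5"
proof -
  obtain g1 where g1: "g1 \<in> Spin7" "g1 *v x1 = ax 1" using Spin7_transitive_1 assms(1) by blast
  have "norm (g1 *v x2) = 1" "(g1 *v x2) \<bullet> ax 1 = 0"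
    using assms by (simp_all add: Spin7_norm Spin7_inner g1(1) g1(2)[symmetric] inner_commute)
  then obtain g2 where g2: "g2 \<in> Spin7" "g2 *v ax 1 = ax 1" "g2 *v (g1 *v x2) = ax 2"
    using Spin7_transitive_2 by blast
  define h2 where "h2 = g2 ** g1"
  have h2: "h2 \<in> Spin7" "h2 *v x1 = ax 1" "h2 *v x2 = ax 2"
    using g1 g2 by (simp_all add: h2_def Spin7_mult matrix_vector_mul_assoc[symmetric])
  have "norm (h2 *v x3) = 1" "(h2 *v x3) \<bullet> ax 1 = 0" "(h2 *v x3) \<bullet> ax 2 = 0"
    using assms by (simp_all add: Spin7_norm Spin7_inner h2(1) h2(2,3)[symmetric] inner_commute)
  then obtain g3 where g3: "g3 \<in> Spin7" "g3 *v ax 1 = ax 1" "g3 *v ax 2 = ax 2" "g3 *v (h2 *v x3) = ax 3"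
    using Spin7_transitive_3 by blast
  define h3 where "h3 = g3 ** h2"
  have h3: "h3 \<in> Spin7" "h3 *v x1 = ax 1" "h3 *v x2 = ax 2" "h3 *v x3 = ax 3"
    using g3 h2 by (simp_all add: h3_def Spin7_mult matrix_vector_mul_assoc[symmetric])
  \<comment> \<open>By equivariance the triple product moves along to \<open>ax 4\<close>; so the
    last hypothesis becomes orthogonality of the fourth vector to \<open>ax 4\<close>.\<close>
  have "ax 4 = h3 *v tc x1 x2 x3"
    using tc_Spin7[OF h3(1), of x1 x2 x3] by (simp add: h3 tc_ax)
  then have "norm (h3 *v x5) = 1" "(h3 *v x5) \<bullet> ax 1 = 0" "(h3 *v x5) \<bullet> ax 2 = 0" "(h3 *v x5) \<bullet> ax 3 = 0"
      "(h3 *v x5) \<bullet> ax 4 = 0"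
    using assms by (simp_all add: Spin7_norm Spin7_inner h3(1) h3(2-4)[symmetric] inner_commute)
  then obtain g4 where g4: "g4 \<in> Spin7" "g4 *v ax 1 = ax 1" "g4 *v ax 2 = ax 2" "g4 *v ax 3 = ax 3"
      "g4 *v (h3 *v x5) = ax 5"
    using Spin7_transitive_4 by blast
  show ?thesis
    using g4 h3 by (intro that[of "g4 ** h3"]) (simp_all add: Spin7_mult matrix_vector_mul_assoc[symmetric])
qed

text \<open>Equivariance of the triple product makes columns 1, 2, 3, 5 of an adapted frame
  determine the others. In this explicit form the frame depends polynomially, hence smoothly, on the
  four vectors.\<close>

definition adapted :: "octonion \<Rightarrow> octonion \<Rightarrow> octonion \<Rightarrow> octonion \<Rightarrow> real^8^8" where
  "adapted x1 x2 x3 x5 = (\<chi> i j. (if j = 1 then x1 else if j = 2 then x2 else if j = 3 then x3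
     else if j = 4 then tc x1 x2 x3 else if j = 5 then x5 else if j = 6 then tc x3 x2 x5
     else if j = 7 then tc x1 x3 x5 else tc x2 x1 x5) $ i)"

lemma column_adapted:
  "column 1 (adapted x1 x2 x3 x5) = x1" "column 2 (adapted x1 x2 x3 x5) = x2"
  "column 3 (adapted x1 x2 x3 x5) = x3" "column 4 (adapted x1 x2 x3 x5) = tc x1 x2 x3"
  "column 5 (adapted x1 x2 x3 x5) = x5" "column 6 (adapted x1 x2 x3 x5) = tc x3 x2 x5"
  "column 7 (adapted x1 x2 x3 x5) = tc x1 x3 x5" "column 8 (adapted x1 x2 x3 x5) = tc x2 x1 x5"
  by (simp_all add: column_def adapted_def vec_eq_iff)

lemma matrix_eq_columns: "A = B \<longleftrightarrow> (\<forall>j. column j A = column j B)"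
  by (auto simp: column_def vec_eq_iff)

lemma adapted_of_transform:
  fixes g :: "real^8^8"
  assumes "\<And>a b c. g *v tc a b c = tc (g *v a) (g *v b) (g *v c)"
  shows "adapted (g *v ax 1) (g *v ax 2) (g *v ax 3) (g *v ax 5) = g"
  unfolding matrix_eq_columns forall_8 column_adapted assms[symmetric] tc_ax
  by (simp add: matrix_vector_mult_basis)

text \<open>Transitivity supplies some \<open>g\<close> taking the quadruple to the standard one;
  its transpose takes the standard one back, and such a matrix can only be the explicit one.\<close>

lemma adapted_in_Spin7:
  assumes "norm x1 = 1" "norm x2 = 1" "norm x3 = 1" "norm x5 = 1"
    and "x1 \<bullet> x2 = 0" "x1 \<bullet> x3 = 0" "x2 \<bullet> x3 = 0"
    and "x5 \<bullet> x1 = 0" "x5 \<bullet> x2 = 0" "x5 \<bullet> x3 = 0" "x5 \<bullet> tc x1 x2 x3 = 0"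
  shows "adapted x1 x2 x3 x5 \<in> Spin7"
proof -
  obtain g where g: "g \<in> Spin7" "g *v x1 = ax 1" "g *v x2 = ax 2" "g *v x3 = ax 3" "g *v x5 = ax 5"
    using Spin7_transitive_quadruple[OF assms] by blast
  have "adapted x1 x2 x3 x5 = transpose g"
    using adapted_of_transform[of "transpose g"] tc_Spin7[OF Spin7_transpose[OF g(1)]]
    by (simp add: g(2-5)[symmetric] Spin7_transpose_vec[OF g(1)])
  then show ?thesis using Spin7_transpose[OF g(1)] by simp
qed

text \<open>The determinant condition is automatic: a matrix in \<open>Cay\<close> agrees with an element of \<open>Spin7\<close>
  on a quadruple that generates \<open>\<O>\<close> under the triple product.\<close>

lemma Cay_subset_Spin7: "Cay \<subseteq> Spin7"
proof
  fix g assume g: "g \<in> Cay"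
  then have o: "orthogonal_matrix g" by (simp add: Cay_def)
  have og: "g *v (transpose g *v d) = d" for d
    using o by (simp add: orthogonal_matrix_def matrix_vector_mul_assoc)
  have tc: "g *v tc a b c = tc (g *v a) (g *v b) (g *v c)" for a b c
  proof -
    have "(g *v tc a b c) \<bullet> d = tc (g *v a) (g *v b) (g *v c) \<bullet> d" for d
    proof -
      have "cayley_form (g *v a) (g *v b) (g *v c) (g *v (transpose g *v d)) = cayley_form a b c (transpose g *v d)"
        using g unfolding Cay_def by blast
      then show ?thesis by (simp add: tc_inner inner_transpose_matrix og)
    qed
    then show ?thesis by (metis vector_eq_rdot)
  qed
  have i: "(g *v x) \<bullet> (g *v y) = x \<bullet> y" for x y by (rule orthogonal_matrix_inner[OF o])
  have "adapted (g *v ax 1) (g *v ax 2) (g *v ax 3) (g *v ax 5) \<in> Spin7"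
    by (rule adapted_in_Spin7)
      (simp_all add: norm_eq_sqrt_inner i tc[symmetric] tc_ax ax_inner)
  then show "g \<in> Spin7" by (simp add: adapted_of_transform[OF tc])
qed

section \<open>Tangent spaces and the almost complex structure\<close>

lemma wedge_vec_nth: "wedge u v $ i $ j = u$i * v$j - v$i * u$j"
  by (simp add: wedge_def)

lemma transpose_wedge: "transpose (wedge u v) = - wedge u v"
  by (simp add: wedge_def vec_eq_iff transpose_def)

lemma act2_wedge: "act2 g (wedge u v) = wedge (g *v u) (g *v v)"
proof -
  have "act2 g (wedge u v) *v x = wedge (g *v u) (g *v v) *v x" for x
    by (simp add: act2_def matrix_vector_mul_assoc[symmetric] wedge_mult inner_transpose_matrix
        matrix_vector_mult_diff_distrib matrix_vector_mult_scaleR)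
  then show ?thesis by (simp add: matrix_eq)
qed

lemma act2_mult: "act2 (g ** h) E = act2 g (act2 h E)"
  by (simp add: act2_def matrix_transpose_mul matrix_mul_assoc)

lemma act2_one: "act2 (mat 1) E = E"
  by (simp add: act2_def)

lemma column_ax: "column j g = g *v ax j"
  by (simp add: matrix_vector_mult_basis)

lemma frame_plane_act2: "frame_plane F = act2 F (wedge (ax 1) (ax 2))"
  by (simp add: frame_plane_def act2_wedge column_ax)

lemma Spin7_column_inner:
  "F \<in> Spin7 \<Longrightarrow> column i F \<bullet> column j F = (if i = j then 1 else 0)"
  by (simp add: column_ax Spin7_inner ax_inner)

lemma frame_plane_in_G2O: "F \<in> Spin7 \<Longrightarrow> frame_plane F \<in> G2O"
  unfolding G2O_def frame_plane_def
  by (intro CollectI exI[of _ "column 1 F"] exI[of _ "column 2 F"])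
    (simp add: norm_eq_sqrt_inner Spin7_column_inner)

lemma G2O_frame_exists:
  assumes "norm u = 1" "norm v = 1" "u \<bullet> v = 0"
  obtains F where "F \<in> Spin7" "column 1 F = u" "column 2 F = v"
proof -
  obtain g1 where g1: "g1 \<in> Spin7" "g1 *v u = ax 1" using Spin7_transitive_1 assms(1) by blast
  have "norm (g1 *v v) = 1" "(g1 *v v) \<bullet> ax 1 = 0"
    using assms by (simp_all add: Spin7_norm Spin7_inner g1(1) g1(2)[symmetric] inner_commute)
  then obtain g2 where g2: "g2 \<in> Spin7" "g2 *v ax 1 = ax 1" "g2 *v (g1 *v v) = ax 2"
    using Spin7_transitive_2 by blast
  define h where "h = g2 ** g1"
  have h: "h \<in> Spin7" "h *v u = ax 1" "h *v v = ax 2"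
    using g1 g2 by (simp_all add: h_def Spin7_mult matrix_vector_mul_assoc[symmetric])
  show ?thesis
    by (rule that[OF Spin7_transpose[OF h(1)]])
      (simp_all add: column_ax h(2,3)[symmetric] Spin7_transpose_vec[OF h(1)])
qed

lemma G2O_frame:
  assumes "E \<in> G2O"
  obtains F where "F \<in> Spin7" "frame_plane F = E"
  using assms unfolding G2O_def by (auto simp: frame_plane_def elim: G2O_frame_exists)

text \<open>The division by 2 compensates for counting each pair of indices twice. The formula is
  linear in an arbitrary matrix, so it also applies to tangent vectors and supplies the derivative
  of K_E.\<close>

definition Kop :: "bivector \<Rightarrow> real^8^8" where
  "Kop E = (\<chi> i j. (\<Sum>k\<in>UNIV. \<Sum>l\<in>UNIV. E$k$l * cayley_form (ax k) (ax l) (ax j) (ax i)) / 2)"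

lemma linear_Kop: "linear Kop"
  by (rule linearI)
    (simp_all add: Kop_def vec_eq_iff algebra_simps sum.distrib add_divide_distrib sum_distrib_left)

lemma ax_expansion: "(\<Sum>l\<in>UNIV. d$l *\<^sub>R ax l) = d"
  using basis_expansion[of d] by (simp add: scalar_mult_eq_scaleR)

lemma cayley_form_sum:
  "(\<Sum>k\<in>UNIV. \<Sum>l\<in>UNIV. u$k * v$l * cayley_form (ax k) (ax l) c d) = cayley_form u v c d"
proof -
  have "cayley_form u v c d = cayley_form (\<Sum>k\<in>UNIV. u$k *\<^sub>R ax k) (\<Sum>l\<in>UNIV. v$l *\<^sub>R ax l) c d"
    by (simp only: ax_expansion)
  also have "\<dots> = (\<Sum>k\<in>UNIV. u$k * cayley_form (ax k) (\<Sum>l\<in>UNIV. v$l *\<^sub>R ax l) c d)"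
    unfolding linear_sum[OF cayley_form_linear(1)] linear_cmul[OF cayley_form_linear(1)] by simp
  also have "\<dots> = (\<Sum>k\<in>UNIV. u$k * (\<Sum>l\<in>UNIV. v$l * cayley_form (ax k) (ax l) c d))"
    unfolding linear_sum[OF cayley_form_linear(2)] linear_cmul[OF cayley_form_linear(2)] by simp
  finally show ?thesis by (simp add: sum_distrib_left mult.assoc)
qed

lemma Kop_wedge_nth: "Kop (wedge u v) $ i $ j = cayley_form u v (ax j) (ax i)"
proof -
  have "(\<Sum>k\<in>UNIV. \<Sum>l\<in>UNIV. wedge u v $k$l * cayley_form (ax k) (ax l) c d) =
      (\<Sum>k\<in>UNIV. \<Sum>l\<in>UNIV. u$k * v$l * cayley_form (ax k) (ax l) c d) -
      (\<Sum>k\<in>UNIV. \<Sum>l\<in>UNIV. v$k * u$l * cayley_form (ax k) (ax l) c d)" for c d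
    by (simp add: wedge_vec_nth left_diff_distrib sum_subtractf)
  then show ?thesis
    unfolding cayley_form_sum by (simp add: Kop_def cayley_form_swap(1)[of v u])
qed

lemma Kop_wedge: "Kop (wedge u v) *v x = tc u v x"
proof -
  have "(\<Sum>j\<in>UNIV. cayley_form u v (ax j) d * x$j) = cayley_form u v x d" for d
  proof -
    have "cayley_form u v x d = cayley_form u v (\<Sum>j\<in>UNIV. x$j *\<^sub>R ax j) d"
      by (simp only: ax_expansion)
    also have "\<dots> = (\<Sum>j\<in>UNIV. x$j * cayley_form u v (ax j) d)"
      unfolding linear_sum[OF cayley_form_linear(3)] linear_cmul[OF cayley_form_linear(3)] by simp
    finally show ?thesis by (simp add: mult.commute)
  qed
  then show ?thesis
    by (simp add: vec_eq_iff matrix_vector_mult_def Kop_wedge_nth tc_def)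
qed

lemma transpose_Kop_wedge: "transpose (Kop (wedge u v)) = - Kop (wedge u v)"
  by (simp add: vec_eq_iff transpose_def Kop_wedge_nth) (blast intro: cayley_form_swap(3))
 

lemma G2O_E:
  assumes "E \<in> G2O"
  obtains u v where "E = wedge u v" "norm u = 1" "norm v = 1" "u \<bullet> v = 0"
  using assms by (auto simp: G2O_def)

lemma G2O_I: "norm u = 1 \<Longrightarrow> norm v = 1 \<Longrightarrow> u \<bullet> v = 0 \<Longrightarrow> wedge u v \<in> G2O"
  by (auto simp: G2O_def)

lemma act2_in_G2O: "g \<in> Spin7 \<Longrightarrow> E \<in> G2O \<Longrightarrow> act2 g E \<in> G2O"
  by (elim G2O_E) (simp add: act2_wedge G2O_I Spin7_norm Spin7_inner)

text \<open>The defining equations of the tangent space come from differentiating \<open>E\<^sup>T = -E\<close>, \<open>E\<^sup>3 = -E\<close>.\<close>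

definition TG2O :: "bivector \<Rightarrow> bivector set" where
  "TG2O E = {X. transpose X = - X \<and> X ** E ** E + E ** X ** E + E ** E ** X = - X}"

lemma wedge_add_left: "wedge (u + u') v = wedge u v + wedge u' v"
  and wedge_add_right: "wedge u (v + v') = wedge u v + wedge u v'"
  and wedge_scaleR_left: "wedge (r *\<^sub>R u) v = r *\<^sub>R wedge u v"
  and wedge_scaleR_right: "wedge u (r *\<^sub>R v) = r *\<^sub>R wedge u v"
  and wedge_minus_left: "wedge (- u) v = - wedge u v"
  and wedge_minus_right: "wedge u (- v) = - wedge u v"
  and wedge_diff_left: "wedge (u - u') v = wedge u v - wedge u' v"
  and wedge_diff_right: "wedge u (v - v') = wedge u v - wedge u v'"
  by (simp_all add: wedge_def vec_eq_iff algebra_simps)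

lemma matrix_vector_mult_minus: "(- A) *v x = - (A *v x)" "A *v (- x) = - (A *v x)" for A :: "real^'n^'m"
  by (simp_all add: matrix_vector_mult_def vec_eq_iff sum_negf)

lemma matrix_vector_mult_scaleR_left: "(r *\<^sub>R A) *v x = r *\<^sub>R (A *v x)" for A :: "real^'n^'m"
  by (simp add: matrix_vector_mult_def vec_eq_iff sum_distrib_left mult.assoc)

lemmas mv_simps = matrix_vector_mul_assoc[symmetric] matrix_vector_mult_minus matrix_vector_mult_scaleR_left
  matrix_vector_mult_add_rdistrib matrix_vector_mult_diff_rdistrib matrix_vector_right_distrib
  matrix_vector_mult_diff_distrib matrix_vector_mult_scaleR

lemma TG2O_I:
  assumes "norm u = 1" "norm v = 1" "u \<bullet> v = 0"
    and "a \<bullet> u = 0" "a \<bullet> v = 0" "b \<bullet> u = 0" "b \<bullet> v = 0"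
  shows "wedge a v + wedge u b \<in> TG2O (wedge u v)"
proof -
  have [simp]: "u \<bullet> u = 1" "v \<bullet> v = 1" "v \<bullet> u = 0" "u \<bullet> a = 0" "v \<bullet> a = 0" "u \<bullet> b = 0" "v \<bullet> b = 0"
    using assms by (simp_all add: inner_commute dot_square_norm)
  let ?X = "wedge a v + wedge u b" and ?E = "wedge u v"
  have "transpose ?X = - ?X" by (simp add: transpose_def wedge_def vec_eq_iff)
  moreover have "?X ** ?E ** ?E + ?E ** ?X ** ?E + ?E ** ?E ** ?X = - ?X"
    unfolding matrix_eq
    by (simp add: mv_simps wedge_mult assms inner_diff_right inner_add_right)
  ultimately show ?thesis by (simp add: TG2O_def)
qed

lemma skew_inner: "transpose X = - X \<Longrightarrow> (X *v x) \<bullet> y = - (x \<bullet> (X *v y))" for X :: "real^'n^'n"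
  by (simp add: inner_transpose_matrix matrix_vector_mult_minus)

lemma skew_inner_self: "transpose X = - X \<Longrightarrow> x \<bullet> (X *v x) = 0" for X :: "real^'n^'n"
  using skew_inner[of X x x] by (simp add: inner_commute)

text \<open>In blocks for the plane and its complement, the cubic equation kills the block of the
  complement and makes the component along \<open>wedge u v\<close> three times itself. What remains
  is the mixed block, that is Hom(E, complement of E).\<close>

lemma TG2O_D:
  assumes uv: "norm u = 1" "norm v = 1" "u \<bullet> v = 0" and X: "X \<in> TG2O (wedge u v)"
  defines "a \<equiv> X *v v" and "b \<equiv> - (X *v u)"
  shows "X = wedge a v + wedge u b" "a \<bullet> u = 0" "a \<bullet> v = 0" "b \<bullet> u = 0" "b \<bullet> v = 0"
proof -
  have uv': "u \<bullet> u = 1" "v \<bullet> v = 1" "v \<bullet> u = 0"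
    using uv by (simp_all add: inner_commute dot_square_norm)
  have sk: "transpose X = - X" and eq: "X ** wedge u v ** wedge u v + wedge u v ** X ** wedge u v + wedge u v ** wedge u v ** X = - X"
    using X by (auto simp: TG2O_def)
  define l where "l = u \<bullet> (X *v v)"
  have i: "u \<bullet> (X *v u) = 0" "v \<bullet> (X *v v) = 0" "v \<bullet> (X *v u) = - l"
    using skew_inner[OF sk, of u v] by (simp_all add: l_def skew_inner_self[OF sk] inner_commute)
  have j: "u \<bullet> (X *v x) = b \<bullet> x" "v \<bullet> (X *v x) = - (a \<bullet> x)" for x
    using skew_inner[OF sk, of u x] skew_inner[OF sk, of v x] by (simp_all add: a_def b_def)
  have X_uv: "X *v u = - b" "X *v v = a" by (simp_all add: a_def b_def)
  have al: "a \<bullet> u = l" "a \<bullet> v = 0" "b \<bullet> v = l" "b \<bullet> u = 0"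
    using i by (simp_all add: a_def b_def l_def inner_commute)
  note al' = al[unfolded inner_commute[of a] inner_commute[of b]]
  have "X *v x = - ((X ** wedge u v ** wedge u v + wedge u v ** X ** wedge u v + wedge u v ** wedge u v ** X) *v x)" for x
    by (simp add: eq matrix_vector_mult_minus)
  then have Xx: "X *v x = (v \<bullet> x) *\<^sub>R a - (a \<bullet> x) *\<^sub>R v + (b \<bullet> x) *\<^sub>R u - (u \<bullet> x) *\<^sub>R b + l *\<^sub>R ((v \<bullet> x) *\<^sub>R u - (u \<bullet> x) *\<^sub>R v)" for x
    by (simp add: mv_simps wedge_mult inner_diff_right inner_add_right uv' uv j X_uv al al')
      (simp add: algebra_simps)
  \<comment> \<open>The left side is \<open>l\<close> by definition, hence
    \<open>l = 0\<close>.\<close>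
  have "u \<bullet> (X *v v) = 3 * l"
    unfolding Xx[of v] inner_add_right inner_diff_right inner_scaleR_right by (simp add: al al' uv uv')
  then have l: "l = 0" by (simp add: l_def)
  show "X = wedge a v + wedge u b"
    unfolding matrix_eq using Xx by (simp add: l mv_simps wedge_mult algebra_simps)
  show "a \<bullet> u = 0" "a \<bullet> v = 0" "b \<bullet> u = 0" "b \<bullet> v = 0" using al l by auto
qed

lemma G2O_equations:
  assumes "E \<in> G2O"
  shows "transpose E = - E" "E ** E ** E = - E"
proof -
  obtain u v where E: "E = wedge u v" "norm u = 1" "norm v = 1" "u \<bullet> v = 0" using G2O_E[OF assms] .
  then have "u \<bullet> u = 1" "v \<bullet> v = 1" "v \<bullet> u = 0" by (simp_all add: inner_commute dot_square_norm)
  then show "transpose E = - E" "E ** E ** E = - E"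
    by (simp_all add: E transpose_wedge matrix_eq mv_simps wedge_mult inner_diff_right algebra_simps)
qed

lemma bounded_bilinear_matrix_mult: "bounded_bilinear ((**) :: real^'m^'n \<Rightarrow> real^'k^'m \<Rightarrow> real^'k^'n)"
  by (rule bilinear_conv_bounded_bilinear[THEN iffD1], unfold bilinear_def)
    (auto intro!: linearI simp: matrix_matrix_mult_def vec_eq_iff algebra_simps sum.distrib sum_distrib_left)

lemma bounded_linear_transpose: "bounded_linear (transpose :: real^'m^'n \<Rightarrow> real^'n^'m)"
  by (rule linear_conv_bounded_linear[THEN iffD1])
    (auto intro!: linearI simp: transpose_def vec_eq_iff)

lemma subspace_TG2O: "subspace (TG2O E)"
proof -
  have "linear (\<lambda>X :: bivector. transpose X + X)"
    by (rule linearI) (simp_all add: transpose_def vec_eq_iff algebra_simps)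
  moreover have "linear (\<lambda>X. X ** E ** E + E ** X ** E + E ** E ** X + X)"
    by (rule linearI) (simp_all add: matrix_eq mv_simps scaleR_add_right)
  moreover have "TG2O E = {X. transpose X + X = 0} \<inter> {X. X ** E ** E + E ** X ** E + E ** E ** X + X = 0}"
    by (auto simp: TG2O_def eq_neg_iff_add_eq_0)
  ultimately show ?thesis by (simp add: subspace_inter linear_subspace_kernel)
qed

lemma TG2O_of_derivative:
  assumes f: "(f has_derivative L) (at y)" and S: "open S" "y \<in> S" "\<And>x. x \<in> S \<Longrightarrow> f x \<in> G2O"
  shows "L h \<in> TG2O (f y)"
proof -
  note eq = G2O_equations[OF S(3)]
  have m: "((\<lambda>x. - f x) has_derivative (\<lambda>h. - L h)) (at y)" by (rule has_derivative_minus[OF f])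
  have "((\<lambda>x. transpose (f x)) has_derivative (\<lambda>h. transpose (L h))) (at y)"
    by (rule bounded_linear.has_derivative[OF bounded_linear_transpose f])
  moreover have "((\<lambda>x. transpose (f x)) has_derivative (\<lambda>h. - L h)) (at y)"
    by (rule has_derivative_transform_within_open[OF m S(1,2)]) (simp add: eq)
  ultimately have "(\<lambda>h. transpose (L h)) = (\<lambda>h. - L h)" by (rule has_derivative_unique)
  then have 1: "transpose (L h) = - L h" by metis
  have "((\<lambda>x. f x ** f x ** f x) has_derivative (\<lambda>h. (f y ** f y) ** L h + (f y ** L h + L h ** f y) ** f y)) (at y)"
    by (intro bounded_bilinear.FDERIV[OF bounded_bilinear_matrix_mult] f)
  moreover have "((\<lambda>x. f x ** f x ** f x) has_derivative (\<lambda>h. - L h)) (at y)"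
    by (rule has_derivative_transform_within_open[OF m S(1,2)]) (simp add: eq)
  ultimately have "(\<lambda>h. (f y ** f y) ** L h + (f y ** L h + L h ** f y) ** f y) = (\<lambda>h. - L h)"
    by (rule has_derivative_unique)
  then have "(f y ** f y) ** L h + (f y ** L h + L h ** f y) ** f y = - L h" by metis
  then show ?thesis
    using 1 by (simp add: TG2O_def bounded_bilinear.add_left[OF bounded_bilinear_matrix_mult] algebra_simps)
qed

lemma tangent_space_subset_TG2O: "tangent_space G2O E \<subseteq> TG2O E"
proof
  fix X assume "X \<in> tangent_space G2O E"
  then obtain c where c: "range c \<subseteq> G2O" "c 0 = E" "(c has_vector_derivative X) (at (0::real))"
    unfolding tangent_space_def by blast
  then have "(c has_derivative (\<lambda>h. h *\<^sub>R X)) (at 0)" by (simp add: has_vector_derivative_def)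
  from TG2O_of_derivative[OF this open_UNIV UNIV_I, of 1] show "X \<in> TG2O E" using c(1,2) by auto
qed

text \<open>A Gram-Schmidt step does not change the bivector, and the square root of the Gram
  determinant is the product of the two lengths after that step.\<close>

lemma wedge_normalized:
  assumes N: "(u \<bullet> u) * (v \<bullet> v) - (u \<bullet> v)\<^sup>2 > 0"
  shows "inverse (sqrt ((u \<bullet> u) * (v \<bullet> v) - (u \<bullet> v)\<^sup>2)) *\<^sub>R wedge u v \<in> G2O"
proof -
  have u0: "u \<noteq> 0" using N by auto
  then have uu: "u \<bullet> u > 0" by simp
  define w where "w = v - ((u \<bullet> v) / (u \<bullet> u)) *\<^sub>R u"
  have uw: "u \<bullet> w = 0" using uu by (simp add: w_def inner_diff_right)
  have "(u \<bullet> u) * (w \<bullet> w) = (u \<bullet> u) * (v \<bullet> v) - (u \<bullet> v)\<^sup>2"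
    using uu by (simp add: w_def inner_diff_right inner_diff_left inner_commute field_simps power2_eq_square)
  then have nn: "norm u * norm w = sqrt ((u \<bullet> u) * (v \<bullet> v) - (u \<bullet> v)\<^sup>2)"
    by (simp add: norm_eq_sqrt_inner real_sqrt_mult[symmetric])
  then have w0: "w \<noteq> 0" using N by auto
  have "wedge u w = wedge u v"
    by (simp add: w_def wedge_diff_right wedge_scaleR_right) (simp add: wedge_def vec_eq_iff)
  then have "wedge (sgn u) (sgn w) = inverse (norm u * norm w) *\<^sub>R wedge u v"
    by (simp add: sgn_div_norm wedge_scaleR_left wedge_scaleR_right mult.commute)
  moreover have "wedge (sgn u) (sgn w) \<in> G2O"
    using u0 w0 uw by (intro G2O_I) (simp_all add: norm_sgn sgn_div_norm)
  ultimately show ?thesis by (simp add: nn)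
qed

text \<open>The curve is the wedge of \<open>e1 + t *\<^sub>R a\<close> and
  \<open>e2 + t *\<^sub>R b\<close>, divided by its length. As \<open>a\<close> and \<open>b\<close>
  are orthogonal to the plane, the squared length \<open>N\<close> is 1 up to second order, so the
  division does not alter the velocity at 0. Cauchy-Schwarz keeps \<open>N\<close> positive for all
  \<open>t\<close>; the curve must be defined on the whole line.\<close>

lemma tangent_space_G2O:
  assumes "E \<in> G2O"
  shows "tangent_space G2O E = TG2O E"
proof (intro equalityI tangent_space_subset_TG2O subsetI)
  fix X assume X: "X \<in> TG2O E"
  obtain e1 e2 where E: "E = wedge e1 e2" and e: "norm e1 = 1" "norm e2 = 1" "e1 \<bullet> e2 = 0" using G2O_E[OF assms] .
  obtain a b where ab: "X = wedge a e2 + wedge e1 b" "a \<bullet> e1 = 0" "a \<bullet> e2 = 0" "b \<bullet> e1 = 0" "b \<bullet> e2 = 0"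
    using TG2O_D[OF e X[unfolded E]] by blast
  define u where "u t = e1 + t *\<^sub>R a" for t :: real
  define v where "v t = e2 + t *\<^sub>R b" for t :: real
  define N where "N t = (u t \<bullet> u t) * (v t \<bullet> v t) - (u t \<bullet> v t)\<^sup>2" for t
  define c where "c t = inverse (sqrt (N t)) *\<^sub>R wedge (u t) (v t)" for t
  have ee: "e1 \<bullet> e1 = 1" "e2 \<bullet> e2 = 1" "e2 \<bullet> e1 = 0" using e by (simp_all add: inner_commute dot_square_norm)
  have N: "N t = (1 + t\<^sup>2 * (a \<bullet> a)) * (1 + t\<^sup>2 * (b \<bullet> b)) - t ^ 4 * (a \<bullet> b)\<^sup>2" for t
    using ab(2-5) by (simp add: N_def u_def v_def inner_add_left inner_add_right ee e inner_commute power2_eq_square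
        eval_nat_numeral algebra_simps)
  have Npos: "N t > 0" for t
  proof -
    have "(a \<bullet> b)\<^sup>2 \<le> (a \<bullet> a) * (b \<bullet> b)" by (rule Cauchy_Schwarz_ineq)
    then have "t ^ 4 * (a \<bullet> b)\<^sup>2 \<le> t ^ 4 * ((a \<bullet> a) * (b \<bullet> b))" by (simp add: mult_left_mono)
    moreover have "t\<^sup>2 * (a \<bullet> a) \<ge> 0" "t\<^sup>2 * (b \<bullet> b) \<ge> 0" by simp_all
    moreover have "(1 + t\<^sup>2 * (a \<bullet> a)) * (1 + t\<^sup>2 * (b \<bullet> b)) =
        1 + t\<^sup>2 * (a \<bullet> a) + t\<^sup>2 * (b \<bullet> b) + t ^ 4 * ((a \<bullet> a) * (b \<bullet> b))"
      by (simp add: algebra_simps power2_eq_square eval_nat_numeral)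
    ultimately show ?thesis unfolding N by linarith
  qed
  have su: "smooth_on UNIV u" "smooth_on UNIV v"
    unfolding u_def v_def by (intro smooth_on_add smooth_on_const smooth_on_scaleR smooth_on_id open_UNIV)+
  have sN: "smooth_on UNIV N"
    unfolding N_def power2_eq_square by (intro smooth_on_diff smooth_on_mult smooth_on_inner su open_UNIV)
  have "smooth_on UNIV c"
    unfolding c_def
    by (intro smooth_on_scaleR smooth_on_inverse smooth_on_sqrt smooth_on_bounded_bilinear[OF bounded_bilinear_wedge] su sN open_UNIV)
      (use Npos in \<open>auto simp: less_imp_neq[OF Npos, symmetric]\<close>)
  moreover have "range c \<subseteq> G2O"
    unfolding c_def N_def using wedge_normalized Npos[unfolded N_def] by blast
  moreover have "c 0 = E" by (simp add: c_def N u_def v_def E)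
  moreover have "(c has_vector_derivative X) (at 0)"
  proof -
    have "(N has_real_derivative 0) (at 0)"
      unfolding N[abs_def] by (auto intro!: derivative_eq_intros)
    then have "((\<lambda>t. inverse (sqrt (N t))) has_real_derivative 0) (at 0)"
      using Npos[of 0] by (auto intro!: derivative_eq_intros)
    then have 1: "((\<lambda>t. inverse (sqrt (N t))) has_vector_derivative 0) (at 0)"
      by (simp add: has_real_derivative_iff_has_vector_derivative)
    have "(u has_vector_derivative a) (at 0)" "(v has_vector_derivative b) (at 0)"
      unfolding u_def v_def by (auto intro!: derivative_eq_intros)
    then have "((\<lambda>t. wedge (u t) (v t)) has_vector_derivative wedge (u 0) b + wedge a (v 0)) (at 0)"
      by (intro bounded_bilinear.has_vector_derivative[OF bounded_bilinear_wedge])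
    from bounded_bilinear.has_vector_derivative[OF bounded_bilinear_scaleR 1 this]
    show ?thesis by (simp add: c_def[abs_def] N u_def v_def ab(1) add.commute)
  qed
  ultimately show "X \<in> tangent_space G2O E" unfolding tangent_space_def by blast
qed

text \<open>By equivariance it suffices to treat \<open>ax 1\<close> and \<open>ax 2\<close>, where
  \<open>tc\<close> is multiplication by \<i> on the complement and squares to minus the
  projection.\<close>

lemma tc_tc:
  assumes "norm u = 1" "norm v = 1" "u \<bullet> v = 0"
  shows "tc u v (tc u v x) = - x + (u \<bullet> x) *\<^sub>R u + (v \<bullet> x) *\<^sub>R v"
proof -
  obtain F where F: "F \<in> Spin7" "column 1 F = u" "column 2 F = v"
    using G2O_frame_exists[OF assms] by blast
  define y where "y = transpose F *v x"
  have x: "x = F *v y" by (simp add: y_def Spin7_transpose_vec[OF F(1)])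
  have 0: "tc (ax 1) (ax 2) (tc (ax 1) (ax 2) y) = - y + (ax 1 \<bullet> y) *\<^sub>R ax 1 + (ax 2 \<bullet> y) *\<^sub>R ax 2"
    unfolding tc_ax_12 inner_ax by (simp add: vec_eq_iff forall_8) (simp add: axis_def)
  show ?thesis
    unfolding F(2,3)[symmetric] column_ax x tc_Spin7[OF F(1)] Spin7_inner[OF F(1)] 0
    by (simp add: mv_simps)
qed

lemma tc_inner_cycle: "tc u v x \<bullet> y = - (x \<bullet> tc u v y)"
  by (simp add: tc_inner inner_commute[of x] cayley_form_swap(3)[of u v x y])

lemma tc_perp: "tc u v x \<bullet> u = 0" "tc u v x \<bullet> v = 0" "tc u v x \<bullet> x = 0"
  "u \<bullet> tc u v x = 0" "v \<bullet> tc u v x = 0" "x \<bullet> tc u v x = 0"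
  using tc_inner_cycle[of u v x u] tc_inner_cycle[of u v x v] tc_inner_cycle[of u v x x]
  by (simp_all add: tc_refl inner_commute)

lemma norm_tc:
  assumes "norm u = 1" "norm v = 1" "u \<bullet> v = 0" "u \<bullet> x = 0" "v \<bullet> x = 0"
  shows "norm (tc u v x) = norm x"
  unfolding norm_eq_sqrt_inner tc_inner_cycle[of u v x] tc_tc[OF assms(1-3)] assms(4,5) by simp

text \<open>\<open>Kop E\<close> vanishes on the plane, so there the commutator is
  \<open>Kop E\<close> after \<open>X\<close>, which is the structure on Hom(E, complement of E).
  The second product makes the result skew again.\<close>

definition Jop :: "bivector \<Rightarrow> bivector \<Rightarrow> bivector" where
  "Jop E X = Kop E ** X - X ** Kop E"

lemma Jop_wedge:
  "Jop (wedge u v) (wedge a b) = wedge (tc u v a) b + wedge a (tc u v b)"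
proof -
  have "x \<bullet> tc u v y = - (y \<bullet> tc u v x)" for x y
    using tc_inner_cycle[of u v y x] by (simp add: inner_commute)
  note c = this[of _ a] this[of _ b]
  show ?thesis
    unfolding matrix_eq
    by (simp add: Jop_def mv_simps wedge_mult Kop_wedge tc_simps algebra_simps inner_commute[of "tc u v y" for y])
      (simp add: c)
qed

lemma linear_Jop: "linear (Jop E)"
  by (rule linearI)
    (simp_all add: Jop_def matrix_eq mv_simps scaleR_diff_right)

lemma Jop_TG2O_wedge:
  assumes "norm u = 1" "norm v = 1" "u \<bullet> v = 0"
  shows "Jop (wedge u v) (wedge a v + wedge u b) = wedge (tc u v a) v + wedge u (tc u v b)"
  by (simp add: linear_add[OF linear_Jop] Jop_wedge tc_refl) (simp add: wedge_def vec_eq_iff)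

lemma Jop_in_TG2O:
  assumes "E \<in> G2O" "X \<in> TG2O E"
  shows "Jop E X \<in> TG2O E" "Jop E (Jop E X) = - X"
proof -
  obtain u v where E: "E = wedge u v" and e: "norm u = 1" "norm v = 1" "u \<bullet> v = 0" using G2O_E[OF assms(1)] .
  obtain a b where ab: "X = wedge a v + wedge u b" "a \<bullet> u = 0" "a \<bullet> v = 0" "b \<bullet> u = 0" "b \<bullet> v = 0"
    using TG2O_D[OF e assms(2)[unfolded E]] by blast
  show "Jop E X \<in> TG2O E"
    unfolding E ab(1) Jop_TG2O_wedge[OF e] by (rule TG2O_I[OF e]) (simp_all add: tc_perp)
  show "Jop E (Jop E X) = - X"
    using ab(2-5) unfolding E ab(1) Jop_TG2O_wedge[OF e] tc_tc[OF e]
    by (simp add: inner_commute[of u] inner_commute[of v] wedge_minus_left wedge_minus_right)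
qed

lemma Kop_column:
  assumes "F \<in> Spin7"
  shows "Kop (frame_plane F) *v column 1 F = 0" "Kop (frame_plane F) *v column 2 F = 0"
    "Kop (frame_plane F) *v column 3 F = column 4 F" "Kop (frame_plane F) *v column 4 F = - column 3 F"
    "Kop (frame_plane F) *v column 5 F = - column 8 F" "Kop (frame_plane F) *v column 6 F = - column 7 F"
    "Kop (frame_plane F) *v column 7 F = column 6 F" "Kop (frame_plane F) *v column 8 F = column 5 F"
proof -
  have "Kop (frame_plane F) *v column j F = F *v tc (ax 1) (ax 2) (ax j)" for j
    by (simp add: frame_plane_def Kop_wedge column_ax tc_Spin7[OF assms])
  moreover have "tc (ax 1) (ax 2) (ax 1) = 0" "tc (ax 1) (ax 2) (ax 2) = 0"
    "tc (ax 1) (ax 2) (ax 3) = ax 4" "tc (ax 1) (ax 2) (ax 4) = - ax 3"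
    "tc (ax 1) (ax 2) (ax 5) = - ax 8" "tc (ax 1) (ax 2) (ax 6) = - ax 7"
    "tc (ax 1) (ax 2) (ax 7) = ax 6" "tc (ax 1) (ax 2) (ax 8) = ax 5"
    unfolding tc_ax_12 by (simp_all add: vec_eq_iff forall_8) (simp_all add: axis_def)
  ultimately show "Kop (frame_plane F) *v column 1 F = 0" "Kop (frame_plane F) *v column 2 F = 0"
    "Kop (frame_plane F) *v column 3 F = column 4 F" "Kop (frame_plane F) *v column 4 F = - column 3 F"
    "Kop (frame_plane F) *v column 5 F = - column 8 F" "Kop (frame_plane F) *v column 6 F = - column 7 F"
    "Kop (frame_plane F) *v column 7 F = column 6 F" "Kop (frame_plane F) *v column 8 F = column 5 F"
    by (simp_all add: column_ax matrix_vector_mult_minus)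
qed

lemma omega_Jop:
  assumes F: "F \<in> Spin7"
  shows "omega F (Jop (frame_plane F) X) 3 i = - omega F X 4 i" "omega F (Jop (frame_plane F) X) 4 i = omega F X 3 i"
    "omega F (Jop (frame_plane F) X) 5 i = omega F X 8 i" "omega F (Jop (frame_plane F) X) 6 i = omega F X 7 i"
    "omega F (Jop (frame_plane F) X) 7 i = - omega F X 6 i" "omega F (Jop (frame_plane F) X) 8 i = - omega F X 5 i"
proof -
  let ?K = "Kop (frame_plane F)"
  have sk: "transpose ?K = - ?K" by (simp add: frame_plane_def transpose_Kop_wedge)
  have "column j F \<bullet> (?K *v y) = - ((?K *v column j F) \<bullet> y)" for j y
    using skew_inner[OF sk, of "column j F" y] by simp
  then show "omega F (Jop (frame_plane F) X) 3 i = - omega F X 4 i" "omega F (Jop (frame_plane F) X) 4 i = omega F X 3 i"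
    "omega F (Jop (frame_plane F) X) 5 i = omega F X 8 i" "omega F (Jop (frame_plane F) X) 6 i = omega F X 7 i"
    "omega F (Jop (frame_plane F) X) 7 i = - omega F X 6 i" "omega F (Jop (frame_plane F) X) 8 i = - omega F X 5 i"
    by (simp_all add: omega_def Jop_def mv_simps Kop_column[OF F] inner_diff_right)
qed

lemma forms10_Jop:
  assumes "F \<in> Spin7"
  shows "forms10 F (Jop (frame_plane F) X) = map ((*) \<i>) (forms10 F X)"
  by (simp add: forms10_def omega_Jop[OF assms] complex_eq_iff)

lemma Spin7_columns_ext:
  assumes "F \<in> Spin7" "\<And>j. column j F \<bullet> x = column j F \<bullet> y"
  shows "x = y"
proof -
  have "transpose F *v x = transpose F *v y"
    unfolding vec_eq_iff using assms(2) by (simp add: column_def matrix_vector_mult_def transpose_def inner_vec_def)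
  then show ?thesis using Spin7_transpose_vec(2)[OF assms(1)] by metis
qed

text \<open>The six complex values are the twelve real components of \<open>X\<close> in Hom(E,
  complement of E); the components along the first two columns vanish for tangent vectors.\<close>

lemma forms10_inj:
  assumes F: "F \<in> Spin7" and X: "X \<in> TG2O (frame_plane F)" and Y: "Y \<in> TG2O (frame_plane F)"
    and eq: "forms10 F X = forms10 F Y"
  shows "X = Y"
proof -
  let ?u = "column 1 F" and ?v = "column 2 F"
  have e: "norm ?u = 1" "norm ?v = 1" "?u \<bullet> ?v = 0"
    by (simp_all add: norm_eq_sqrt_inner Spin7_column_inner[OF F])
  note DX = TG2O_D[OF e X[unfolded frame_plane_def]]
  note DY = TG2O_D[OF e Y[unfolded frame_plane_def]]
  have "\<forall>j. column j F \<bullet> (X *v ?v) = column j F \<bullet> (Y *v ?v)"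
    using eq DX(2,3) DY(2,3) by (simp add: forall_8 forms10_def omega_def inner_commute)
  then have 1: "X *v ?v = Y *v ?v" using Spin7_columns_ext[OF F] by blast
  have "\<forall>j. column j F \<bullet> (X *v ?u) = column j F \<bullet> (Y *v ?u)"
    using eq DX(4,5) DY(4,5) by (simp add: forall_8 forms10_def omega_def inner_commute)
  then have 2: "X *v ?u = Y *v ?u" using Spin7_columns_ext[OF F] by blast
  show "X = Y" using DX(1) DY(1) 1 2 by simp
qed

text \<open>\<open>Jop\<close> is defined without a frame, so it satisfies the condition in every
  adapted frame at once. Uniqueness follows from a single frame, which exists by transitivity on
  orthonormal pairs.\<close>

lemma J_G2O_eq:
  assumes E: "E \<in> G2O" and X: "X \<in> TG2O E"
  shows "J_G2O E X = Jop E X"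
  unfolding J_G2O_def tangent_space_G2O[OF E]
proof (rule the_equality)
  show "Jop E X \<in> TG2O E \<and> (\<forall>F\<in>Spin7. frame_plane F = E \<longrightarrow> forms10 F (Jop E X) = map ((*) \<i>) (forms10 F X))"
    using Jop_in_TG2O[OF assms] forms10_Jop by blast
  fix Y assume Y: "Y \<in> TG2O E \<and> (\<forall>F\<in>Spin7. frame_plane F = E \<longrightarrow> forms10 F Y = map ((*) \<i>) (forms10 F X))"
  obtain F where F: "F \<in> Spin7" "frame_plane F = E" using G2O_frame[OF E] .
  then show "Y = Jop E X" using forms10_inj[OF F(1)] Y Jop_in_TG2O[OF assms] forms10_Jop[OF F(1), of X] by metis
qed

lemma J_G2O_forms10_iff:
  assumes F: "F \<in> Spin7" and X: "X \<in> TG2O (frame_plane F)" and Y: "Y \<in> TG2O (frame_plane F)"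
  shows "Y = J_G2O (frame_plane F) X \<longleftrightarrow> forms10 F Y = map ((*) \<i>) (forms10 F X)"
  using forms10_inj[OF F Y Jop_in_TG2O(1)[OF frame_plane_in_G2O[OF F] X]]
    forms10_Jop[OF F, of X] J_G2O_eq[OF frame_plane_in_G2O[OF F] X] by metis

section \<open>Invariance and smoothness of the almost complex structure\<close>

lemma act2_product:
  assumes "g \<in> Spin7"
  shows "act2 g (A ** B) = act2 g A ** act2 g B"
proof -
  have "act2 g A ** act2 g B = g ** A ** (transpose g ** g) ** B ** transpose g"
    by (simp add: act2_def matrix_mul_assoc)
  then show ?thesis by (simp add: Spin7_transpose_mult[OF assms] act2_def matrix_mul_assoc)
qed

lemma linear_act2: "linear (act2 g)"
  by (rule linearI) (simp_all add: act2_def matrix_eq mv_simps)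

lemma transpose_act2: "transpose (act2 g X) = act2 g (transpose X)"
  by (simp add: act2_def matrix_transpose_mul matrix_mul_assoc)

lemma act2_in_TG2O:
  assumes "g \<in> Spin7" "X \<in> TG2O E"
  shows "act2 g X \<in> TG2O (act2 g E)"
  using assms(2) unfolding TG2O_def mem_Collect_eq
    act2_product[OF assms(1), symmetric] linear_add[OF linear_act2, symmetric]
  by (simp add: transpose_act2 linear_neg[OF linear_act2])

lemma Kop_act2:
  assumes "g \<in> Spin7" "E \<in> G2O"
  shows "Kop (act2 g E) = act2 g (Kop E)"
proof -
  obtain u v where E: "E = wedge u v" using G2O_E[OF assms(2)] .
  have "Kop (act2 g E) *v x = act2 g (Kop E) *v x" for x
    using tc_Spin7[OF assms(1), of u v "transpose g *v x"]
    unfolding E act2_wedge Kop_wedge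
    by (simp add: act2_def mv_simps Kop_wedge Spin7_transpose_vec[OF assms(1)])
  then show ?thesis by (simp add: matrix_eq)
qed

lemma J_G2O_act2:
  assumes g: "g \<in> Spin7" and E: "E \<in> G2O" and X: "X \<in> TG2O E"
  shows "J_G2O (act2 g E) (act2 g X) = act2 g (J_G2O E X)"
  unfolding J_G2O_eq[OF E X] J_G2O_eq[OF act2_in_G2O[OF g E] act2_in_TG2O[OF g X]]
    Jop_def Kop_act2[OF g E] act2_product[OF g, symmetric] linear_diff[OF linear_act2] ..

lemma smooth_on_Jop:
  assumes "open S" "smooth_on S f" "smooth_on S h"
  shows "smooth_on S (\<lambda>x. Jop (f x) (h x))"
  unfolding Jop_def
  by (intro smooth_on_diff smooth_on_bounded_bilinear[OF bounded_bilinear_matrix_mult]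
      smooth_on_linear[OF linear_Kop] assms)

lemma almost_complex_structure_J_G2O: "almost_complex_structure G2O J_G2O"
  unfolding almost_complex_structure_def
proof (intro conjI ballI allI)
  fix E u assume E: "E \<in> G2O" and u: "u \<in> tangent_space G2O E"
  note u' = u[unfolded tangent_space_G2O[OF E]]
  show "J_G2O E u \<in> tangent_space G2O E" "J_G2O E (J_G2O E u) = - u"
    using Jop_in_TG2O[OF E u'] by (simp_all add: tangent_space_G2O[OF E] J_G2O_eq[OF E] u')
  fix v a b assume v: "v \<in> tangent_space G2O E"
  note v' = v[unfolded tangent_space_G2O[OF E]]
  have "a *\<^sub>R u + b *\<^sub>R v \<in> TG2O E"
    using u' v' subspace_TG2O by (intro subspace_add subspace_scale)
  then show "J_G2O E (a *\<^sub>R u + b *\<^sub>R v) = a *\<^sub>R J_G2O E u + b *\<^sub>R J_G2O E v"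
    by (simp add: J_G2O_eq[OF E] u' v' linear_add[OF linear_Jop] linear_cmul[OF linear_Jop])
next
  \<comment> \<open>\<open>Jop\<close> is bilinear on all pairs of matrices and so is a global
    smooth extension of the almost complex structure.\<close>
  have "smooth_on UNIV (\<lambda>p :: bivector \<times> bivector. Jop (fst p) (snd p))"
    by (intro smooth_on_Jop smooth_on_bounded_linear[OF bounded_linear_fst] smooth_on_bounded_linear[OF bounded_linear_snd]
        smooth_on_id open_UNIV)
  then show "smooth_on_subset {(x, u). x \<in> G2O \<and> u \<in> tangent_space G2O x} (\<lambda>(x, u). J_G2O x u)"
    unfolding smooth_on_subset_def by (auto intro!: exI[of _ UNIV] simp: J_G2O_eq tangent_space_G2O)
qed

section \<open>The homogeneous space Spin(7)/U(3)\<close>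

definition adj :: "complex^'n^'m \<Rightarrow> complex^'m^'n" where
  "adj A = (\<chi> i j. cnj (A $ j $ i))"

lemma U3_iff: "A \<in> U3 \<longleftrightarrow> A ** adj A = mat 1"
  by (simp add: U3_def adj_def)

lemma adj_mult: "adj (A ** B) = adj B ** adj A"
  by (simp add: adj_def vec_eq_iff matrix_matrix_mult_def mult.commute)

lemma adj_adj [simp]: "adj (adj A) = A"
  by (simp add: adj_def vec_eq_iff)

lemma U3_adj_mult: "A \<in> U3 \<Longrightarrow> adj A ** A = mat 1"
  by (simp add: U3_iff matrix_left_right_inverse)

lemma matrix_group_U3: "matrix_group U3"
  unfolding matrix_group_def
proof (intro conjI ballI)
  show "mat 1 \<in> U3" by (simp add: U3_iff adj_def vec_eq_iff matrix_matrix_mult_def mat_def forall_3 sum_3)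
  fix A B :: "complex^3^3" assume A: "A \<in> U3" and B: "B \<in> U3"
  have "A ** B ** (adj B ** adj A) = A ** (B ** adj B) ** adj A" by (simp add: matrix_mul_assoc)
  then show "A ** B \<in> U3" using A B by (simp add: U3_iff adj_mult)
next
  fix A :: "complex^3^3" assume A: "A \<in> U3"
  then show "\<exists>B\<in>U3. A ** B = mat 1 \<and> B ** A = mat 1"
    using U3_adj_mult[OF A] by (intro bexI[of _ "adj A"]) (simp_all add: U3_iff)
qed

lemma matrix_group_Spin7: "matrix_group Spin7"
  unfolding matrix_group_def using Spin7_one Spin7_mult Spin7_transpose Spin7_transpose_mult by blast

lemma det_adj_3: "det (adj A :: complex^3^3) = cnj (det A)"
  by (simp add: det_3 adj_def mult_ac)

text \<open>\<open>cnj (det A)\<close> is \<open>(det A)\<^sup>-\<^sup>1\<close> on \<open>U3\<close>, but unlike the inverse it is smooth on all matrices.\<close>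

definition iota :: "complex^3^3 \<Rightarrow> complex^4^4" where
  "iota A = (\<chi> i j. if i = 1 \<and> j = 1 then cnj (det A) else if i = 1 \<or> j = 1 then 0
     else A $ (if i = 2 then 1 else if i = 3 then 2 else 3) $ (if j = 2 then 1 else if j = 3 then 2 else 3))"

lemma iota_mult: "iota (A ** B) = iota A ** iota B"
  unfolding iota_def det_mul by (simp add: vec_eq_iff forall_4 matrix_matrix_mult_def sum_4 sum_3)

lemma iota_one: "iota (mat 1) = mat 1"
  unfolding iota_def det_I by (simp add: vec_eq_iff forall_4 mat_def)

lemma iota_adj: "iota (adj A) = adj (iota A)"
  unfolding iota_def det_adj_3 by (simp add: adj_def vec_eq_iff forall_4)

lemma det_iota: "det (iota A) = cnj (det A) * det A"
  by (simp add: det_4 iota_def) (simp add: det_3 algebra_simps)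

lemma cnj_det_U3: "A \<in> U3 \<Longrightarrow> cnj (det A) * det A = 1"
  by (metis U3_iff det_I det_adj_3 det_mul mult.commute)

lemma herm_adj: "herm (A *v z) w = herm z (adj A *v w)"
proof -
  have "herm (A *v z) w = (\<Sum>k\<in>UNIV. \<Sum>l\<in>UNIV. cnj (A$k$l) * cnj (z$l) * w$k)"
    by (simp add: herm_def matrix_vector_mult_def sum_distrib_right)
  also have "\<dots> = (\<Sum>l\<in>UNIV. \<Sum>k\<in>UNIV. cnj (A$k$l) * cnj (z$l) * w$k)" by (rule sum.swap)
  also have "\<dots> = herm z (adj A *v w)"
    by (simp add: herm_def matrix_vector_mult_def adj_def sum_distrib_left mult_ac)
  finally show ?thesis .
qed

definition phi0 :: "complex^3^3 \<Rightarrow> real^8^8" where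
  "phi0 A = realify (iota A)"

text \<open>Reads off the lower right 3 by 3 block in complex coordinates. Being linear on all real
  matrices, it makes the inverse of the isotropy isomorphism smooth.\<close>

definition rho :: "real^8^8 \<Rightarrow> complex^3^3" where
  "rho h = (\<chi> i j. cz (h *v zc (axis (if j = 1 then 2 else if j = 2 then 3 else 4) 1))
     $ (if i = 1 then 2 else if i = 2 then 3 else 4))"

lemma matrix_axis_nth: "((M :: complex^'n^'m) *v axis j 1) $ i = M $ i $ j"
  by (simp add: matrix_vector_mult_def axis_def if_distrib cong: if_cong)

lemma axis_nth_if: "axis i a $ j = (if j = i then a else 0)"
  by (simp add: axis_def)

lemma rho_phi0: "rho (phi0 A) = A"
  by (simp add: vec_eq_iff forall_3 rho_def phi0_def realify_mult_vec matrix_axis_nth iota_def)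

lemma phi0_mult: "phi0 (A ** B) = phi0 A ** phi0 B"
  by (simp add: phi0_def iota_mult realify_mult)

lemma phi0_in_Spin7:
  assumes "A \<in> U3"
  shows "phi0 A \<in> Spin7"
proof -
  have "adj (iota A) ** iota A = mat 1"
    by (simp add: iota_adj[symmetric] iota_mult[symmetric] U3_adj_mult[OF assms] iota_one)
  then have "realify (iota A) \<in> Cay"
    by (intro realify_in_Cay) (simp_all add: herm_adj matrix_vector_mul_assoc det_iota cnj_det_U3[OF assms])
  then show ?thesis using Cay_subset_Spin7 by (auto simp: phi0_def)
qed

lemma phi0_stabilizes:
  assumes "A \<in> U3"
  shows "act2 (phi0 A) (wedge (ax 1) (ax 2)) = wedge (ax 1) (ax 2)"
proof -
  define d where "d = cnj (det A)"
  have "d * cnj d = 1" using cnj_det_U3[OF assms] by (simp add: d_def)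
  then have d: "Re d * Re d + Im d * Im d = 1" by (simp add: complex_eq_iff)
  have z: "iota A *v vector [x, 0, 0, 0] = vector [d * x, 0, 0, 0]" for x
    by (simp add: vec_eq_iff forall_4 matrix_vector_mult_def sum_4 vector_4 iota_def d_def)
  have "phi0 A *v ax 1 = Re d *\<^sub>R ax 1 + Im d *\<^sub>R ax 2" "phi0 A *v ax 2 = Re d *\<^sub>R ax 2 - Im d *\<^sub>R ax 1"
    unfolding phi0_def realify_mult_vec cz_ax z
    by (simp_all add: vec_eq_iff forall_8 zc_def vector_4 axis_def)
  then have "act2 (phi0 A) (wedge (ax 1) (ax 2)) = (Re d * Re d + Im d * Im d) *\<^sub>R wedge (ax 1) (ax 2)"
    by (simp add: act2_wedge) (simp add: vec_eq_iff wedge_def algebra_simps)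
  then show ?thesis by (simp add: d)
qed

text \<open>E takes \<open>ax 1\<close> to \<open>- ax 2\<close>, so on the plane it is -E that is
  multiplication by \<i>, while \<open>Kop\<close> provides it on the complement.\<close>

lemma Kop_E0_minus_E0:
  "Kop (wedge (ax 1) (ax 2)) *v x - wedge (ax 1) (ax 2) *v x = zc (\<i> *s cz x)"
  unfolding Kop_wedge wedge_mult tc_ax_12 inner_ax
  by (simp add: vec_eq_iff forall_8 zc_def cz_def vector_4) (simp add: axis_def)

text \<open>An element fixing E commutes with E and with K_E, hence with their difference, which is
  multiplication by \<i>. It is therefore complex linear, then unitary, then of determinant one
  because the complex volume form is what remains of the Cayley form. Preserving the plane makes the
  matrix block diagonal, and the 1 by 1 block is the inverse determinant of the other.\<close>

lemma stabilizer_in_image_phi0: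
  assumes h: "h \<in> Spin7" and st: "act2 h (wedge (ax 1) (ax 2)) = wedge (ax 1) (ax 2)"
  shows "rho h \<in> U3" "h = phi0 (rho h)"
proof -
  let ?E = "wedge (ax 1) (ax 2)"
  have com: "h ** X = X ** h" if "act2 h X = X" for X
  proof -
    have "h ** X = act2 h X ** h" by (simp add: act2_def matrix_mul_assoc[symmetric] Spin7_transpose_mult[OF h])
    then show ?thesis by (simp add: that)
  qed
  have "act2 h (Kop ?E) = Kop ?E"
    using Kop_act2[OF h, of ?E] st by (simp add: G2O_I ax_inner)
  then have comJ: "h *v zc (\<i> *s cz x) = zc (\<i> *s cz (h *v x))" for x
    unfolding Kop_E0_minus_E0[symmetric] matrix_vector_mult_diff_distrib
    by (simp add: matrix_vector_mul_assoc com st)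
  define f where "f z = cz (h *v zc z)" for z
  have fi: "f (\<i> *s z) = \<i> *s f z" for z
    using comJ[of "zc z"] by (simp add: f_def)
  have fadd: "f (z + w) = f z + f w" for z w
    by (simp add: f_def zc_add matrix_vector_right_distrib cz_add)
  have fsc: "f (r *\<^sub>R z) = r *\<^sub>R f z" for r z
    by (simp add: f_def zc_scaleR matrix_vector_mult_scaleR cz_scaleR)
  have cs: "c *s z = Re c *\<^sub>R z + Im c *\<^sub>R (\<i> *s z)" for c and z :: "complex^4"
    by (simp add: vec_eq_iff complex_eq_iff)
  have "f (c *s z) = c *s f z" for c z
    unfolding cs[of c] by (simp add: fadd fsc fi)
  then have lin: "Vector_Spaces.linear (*s) (*s) f"
    by (simp add: Vector_Spaces.linear_iff fadd vec.vector_space_axioms)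
  define M where "M = matrix f"
  have M: "M *v z = f z" for z by (simp add: M_def matrix_works[OF lin])
  have hM: "cz (h *v x) = M *v cz x" for x by (simp add: M f_def)
  have h_eq: "h = realify M" by (simp add: matrix_eq realify_mult_vec hM[symmetric])
  have re: "Re (herm (M *v z) (M *v w)) = Re (herm z w)" for z w
    using Spin7_inner[OF h, of "zc z" "zc w"] by (simp add: inner_cz hM)
  have hi: "herm z (\<i> *s w) = \<i> * herm z w" for z w :: "complex^4"
    by (simp add: herm_def sum_distrib_left mult_ac)
  \<comment> \<open>Up to sign the imaginary part of \<open>herm z w\<close> is its real part with
    \<open>w\<close> replaced by \<i> times \<open>w\<close>.\<close>
  have herm: "herm (M *v z) (M *v w) = herm z w" for z w
    using re[of z w] re[of z "\<i> *s w"] by (simp add: M fi hi complex_eq_iff)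
  have MM: "adj M ** M = mat 1"
  proof -
    have "herm (axis i 1) v = v $ i" for i and v :: "complex^4"
      by (simp add: herm_def axis_def if_distrib if_distribR cong: if_cong)
    then have "(adj M ** M) $ i $ j = (mat 1 :: complex^4^4) $ i $ j" for i j
      using herm[of "axis i 1" "axis j 1"]
      by (simp add: herm_adj matrix_vector_mul_assoc matrix_axis_nth mat_def axis_nth_if)
    then show ?thesis by (simp add: vec_eq_iff)
  qed
  then have MM': "M ** adj M = mat 1" by (simp add: matrix_left_right_inverse)
  have k: "kaehler (h *v x) (h *v y) = kaehler x y" for x y
    by (simp add: kaehler_def hM herm)
  have D: "Im (det M * det (vector [a, b, c, d] :: complex^4^4)) = Im (det (vector [a, b, c, d] :: complex^4^4))" for a b c d
    using Spin7_cayley_form[OF h, of "zc a" "zc b" "zc c" "zc d"]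
    by (simp add: cayley_form_complex k hM det_vector_matrix_mult)
  \<comment> \<open>Scaling the first vector gives every complex number as determinant, so
    \<open>Im (det M * c) = Im c\<close> for all \<open>c\<close>; the values 1 and \<i> determine
    \<open>det M\<close>.\<close>
  have "det (vector [axis 1 c, axis 2 1, axis 3 1, axis 4 1] :: complex^4^4) = c" for c
    by (simp add: det_4 vector_4 axis_def)
  with D have "Im (det M * c) = Im c" for c by metis
  from this[of 1] this[of \<i>] have detM: "det M = 1" by (simp add: complex_eq_iff)
  \<comment> \<open>\<open>ax 1\<close> is E applied to \<open>ax 2\<close>, and \<open>h\<close>
    commutes with E; so the image of \<open>ax 1\<close> is in the plane, and the first column of
    \<open>M\<close> vanishes below its top entry. Unitarity then clears the first row.\<close>
  have "h *v ax 1 = h *v (?E *v ax 2)" by (simp add: wedge_mult ax_inner)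
  also have "\<dots> = ?E *v (h *v ax 2)" by (simp add: matrix_vector_mul_assoc com st)
  finally have h1: "h *v ax 1 = ?E *v (h *v ax 2)" .
  have "axis 1 1 = cz (ax 1)" by (simp add: cz_ax vec_eq_iff forall_4 vector_4 axis_nth_if)
  then have "M *v axis 1 1 = cz (h *v ax 1)" by (simp add: hM)
  then have "(M *v axis 1 1) $ 2 = 0" "(M *v axis 1 1) $ 3 = 0" "(M *v axis 1 1) $ 4 = 0"
    unfolding h1 by (simp_all add: cz_nth wedge_mult axis_def complex_eq_iff)
  then have col: "M $ 2 $ 1 = 0" "M $ 3 $ 1 = 0" "M $ 4 $ 1 = 0" by (simp_all add: matrix_axis_nth)
  have "(adj M ** M) $ 1 $ j = (mat 1 :: complex^4^4) $ 1 $ j" for j by (simp add: MM)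
  then have r: "cnj (M $ 1 $ 1) * M $ 1 $ j = (if 1 = j then 1 else 0)" for j
    by (simp add: matrix_matrix_mult_def adj_def sum_4 col mat_def)
  have row: "M $ 1 $ 2 = 0" "M $ 1 $ 3 = 0" "M $ 1 $ 4 = 0"
    using r[of 1] r[of 2] r[of 3] r[of 4] by auto
  have rho: "rho h = (\<chi> i j. M $ (if i = 1 then 2 else if i = 2 then 3 else 4) $ (if j = 1 then 2 else if j = 2 then 3 else 4))"
    by (simp add: rho_def hM matrix_axis_nth)
  have "M $ 1 $ 1 * det (rho h) = 1"
    using detM unfolding det_4 det_3 rho by (simp add: col row algebra_simps)
  then have "M $ 1 $ 1 = cnj (det (rho h))"
    using r[of 1] by (metis complex_cnj_cnj complex_cnj_mult complex_cnj_one mult.commute mult.left_neutral mult.assoc)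
  then have "M = iota (rho h)"
    by (simp add: vec_eq_iff forall_4 iota_def col row) (simp add: rho)
  then show "h = phi0 (rho h)" unfolding phi0_def using h_eq by metis
  have "\<forall>i j. (M ** adj M) $ i $ j = (mat 1 :: complex^4^4) $ i $ j" by (simp add: MM')
  then have "\<forall>i j. (rho h ** adj (rho h)) $ i $ j = (mat 1 :: complex^3^3) $ i $ j"
    unfolding rho by (simp add: forall_3 forall_4 adj_def matrix_matrix_mult_def sum_3 sum_4 mat_def col)
  then show "rho h \<in> U3" by (simp add: U3_iff vec_eq_iff)
qed

lemma smooth_on_matrix_mult:
  fixes f :: "'a::real_normed_vector \<Rightarrow> real^'m^'n" and g :: "'a \<Rightarrow> real^'k^'m"
  shows "open S \<Longrightarrow> smooth_on S f \<Longrightarrow> smooth_on S g \<Longrightarrow> smooth_on S (\<lambda>x. f x ** g x)"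
  by (rule smooth_on_bounded_bilinear[OF bounded_bilinear_matrix_mult])

lemma smooth_on_transpose:
  fixes f :: "'a::real_normed_vector \<Rightarrow> real^'m^'n"
  shows "open S \<Longrightarrow> smooth_on S f \<Longrightarrow> smooth_on S (\<lambda>x. transpose (f x))"
  by (rule smooth_on_bounded_linear[OF bounded_linear_transpose])

lemma bounded_bilinear_matrix_vector_mult: "bounded_bilinear ((*v) :: real^'m^'n \<Rightarrow> real^'m \<Rightarrow> real^'n)"
  by (rule bilinear_conv_bounded_bilinear[THEN iffD1], unfold bilinear_def)
    (auto intro!: linearI simp: mv_simps)

lemma smooth_on_matrix_vector_mult:
  fixes f :: "'a::real_normed_vector \<Rightarrow> real^'m^'n"
  shows "open S \<Longrightarrow> smooth_on S f \<Longrightarrow> smooth_on S g \<Longrightarrow> smooth_on S (\<lambda>x. f x *v g x)"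
  by (rule smooth_on_bounded_bilinear[OF bounded_bilinear_matrix_vector_mult])

lemma smooth_on_wedge:
  "open S \<Longrightarrow> smooth_on S f \<Longrightarrow> smooth_on S g \<Longrightarrow> smooth_on S (\<lambda>x. wedge (f x) (g x))"
  by (rule smooth_on_bounded_bilinear[OF bounded_bilinear_wedge])

lemma smooth_on_tc:
  assumes "open S" "smooth_on S f" "smooth_on S g" "smooth_on S h"
  shows "smooth_on S (\<lambda>x. tc (f x) (g x) (h x))"
  unfolding Kop_wedge[symmetric]
  by (intro smooth_on_matrix_vector_mult smooth_on_linear[OF linear_Kop] smooth_on_wedge assms)

lemma smooth_on_act2:
  assumes "open S" "smooth_on S f" "smooth_on S h"
  shows "smooth_on S (\<lambda>x. act2 (f x) (h x))"
  unfolding act2_def by (intro smooth_on_matrix_mult smooth_on_transpose assms)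

lemma smooth_on_If:
  "(P \<Longrightarrow> smooth_on S f) \<Longrightarrow> (\<not> P \<Longrightarrow> smooth_on S g) \<Longrightarrow> smooth_on S (\<lambda>x. if P then f x else g x)"
  by (cases P) simp_all

lemma smooth_on_adapted:
  assumes "open S" "smooth_on S a" "smooth_on S b" "smooth_on S c" "smooth_on S d"
  shows "smooth_on S (\<lambda>x. adapted (a x) (b x) (c x) (d x))"
  unfolding adapted_def
  by (intro smooth_on_vec_lambda smooth_on_vec_nth smooth_on_If smooth_on_tc assms)

lemma linear_realify: "linear realify"
proof (rule linearI)
  have "(A + B) *v z = A *v z + B *v z" for A B :: "complex^4^4" and z
    by (simp add: matrix_vector_mult_add_rdistrib)
  then show "realify (A + B) = realify A + realify B" for A B
    by (simp add: matrix_eq realify_mult_vec zc_add mv_simps)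
  have "(r *\<^sub>R A) *v z = r *\<^sub>R (A *v z)" for A :: "complex^4^4" and z r
    by (simp add: vec_eq_iff matrix_vector_mult_def scaleR_sum_right)
  then show "realify (r *\<^sub>R A) = r *\<^sub>R realify A" for r A
    by (simp add: matrix_eq realify_mult_vec zc_scaleR mv_simps)
qed

lemma smooth_phi0: "smooth_on UNIV phi0"
proof -
  have nth: "smooth_on UNIV (\<lambda>A :: complex^3^3. A $ i $ j)" for i j
    by (intro smooth_on_vec_nth smooth_on_id open_UNIV)
  have "smooth_on UNIV (\<lambda>A :: complex^3^3. det A)"
    unfolding det_3 by (intro smooth_on_add smooth_on_diff smooth_on_mult nth open_UNIV)
  then have cd: "smooth_on UNIV (\<lambda>A :: complex^3^3. cnj (det A))"
    by (rule smooth_on_bounded_linear[OF bounded_linear_cnj open_UNIV])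
  have "smooth_on UNIV iota"
    unfolding iota_def by (intro smooth_on_vec_lambda smooth_on_If smooth_on_const cd nth open_UNIV)
  then show ?thesis unfolding phi0_def by (rule smooth_on_linear[OF linear_realify open_UNIV])
qed

lemma linear_rho: "linear rho"
  by (rule linearI) (simp_all add: rho_def vec_eq_iff mv_simps cz_add cz_scaleR)

lemma smooth_on_subset_congI: "smooth_on UNIV g \<Longrightarrow> (\<And>x. x \<in> X \<Longrightarrow> g x = f x) \<Longrightarrow> smooth_on_subset X f"
  unfolding smooth_on_subset_def by auto

text \<open>Conjugation by \<open>F\<close> reduces to the standard plane. The inverse isomorphism
  is the restriction of the linear map \<psi>, which is defined on all matrices.\<close>

lemma isotropy_U3:
  assumes F: "F \<in> Spin7"
  shows "\<exists>\<phi>. smooth_group_iso U3 {g \<in> Spin7. act2 g (frame_plane F) = frame_plane F} \<phi>"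
proof
  let ?E = "wedge (ax 1) (ax 2)" and ?S = "{g \<in> Spin7. act2 g (frame_plane F) = frame_plane F}"
  define \<phi> where "\<phi> A = F ** phi0 A ** transpose F" for A
  define \<psi> where "\<psi> g = rho (transpose F ** g ** F)" for g
  note FF = Spin7_transpose_mult[OF F]
  have FF': "transpose F ** (F ** A) = A" "F ** (transpose F ** A) = A" for A :: "real^8^8"
    by (simp_all add: FF matrix_mul_assoc)
  have \<psi>\<phi>: "\<psi> (\<phi> A) = A" for A
    by (simp add: \<phi>_def \<psi>_def matrix_mul_assoc[symmetric] FF FF' rho_phi0)
  have \<phi>S: "\<phi> A \<in> ?S" if A: "A \<in> U3" for A
  proof
    have "act2 (\<phi> A) (frame_plane F) = act2 F (act2 (phi0 A) (act2 (transpose F ** F) ?E))"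
      by (simp add: \<phi>_def frame_plane_act2 act2_mult)
    then show "\<phi> A \<in> Spin7 \<and> act2 (\<phi> A) (frame_plane F) = frame_plane F"
      by (simp add: FF act2_one phi0_stabilizes[OF A] frame_plane_act2 \<phi>_def Spin7_mult F Spin7_transpose phi0_in_Spin7[OF A])
  qed
  have \<psi>S: "\<psi> g \<in> U3 \<and> \<phi> (\<psi> g) = g" if g: "g \<in> ?S" for g
  proof -
    let ?h = "transpose F ** g ** F"
    have h: "?h \<in> Spin7" using g F by (simp add: Spin7_mult Spin7_transpose)
    have "act2 ?h ?E = act2 (transpose F) (act2 g (frame_plane F))"
      by (simp add: act2_mult frame_plane_act2)
    also have "\<dots> = act2 (transpose F ** F) ?E" using g by (simp add: frame_plane_act2 act2_mult)
    finally have "act2 ?h ?E = ?E" by (simp add: FF act2_one)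
    from stabilizer_in_image_phi0[OF h this]
    have "\<psi> g \<in> U3" "phi0 (\<psi> g) = ?h" by (simp_all add: \<psi>_def)
    then show ?thesis by (simp add: \<phi>_def matrix_mul_assoc[symmetric] FF FF')
  qed
  have bij: "bij_betw \<phi> U3 ?S"
    by (rule bij_betw_byWitness[where f'=\<psi>]) (use \<psi>\<phi> \<phi>S \<psi>S in auto)
  have inv: "inv_into U3 \<phi> g = \<psi> g" if "g \<in> ?S" for g
    using inv_into_f_f[OF bij_betw_imp_inj_on[OF bij], of "\<psi> g"] \<psi>S[OF that] by simp
  have s\<psi>: "smooth_on UNIV \<psi>"
    unfolding \<psi>_def
    by (intro smooth_on_linear[OF linear_rho] smooth_on_matrix_mult smooth_on_const smooth_on_id open_UNIV)
  have s\<phi>: "smooth_on UNIV \<phi>"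
    unfolding \<phi>_def by (intro smooth_on_matrix_mult smooth_on_const smooth_phi0 open_UNIV)
  show "smooth_group_iso U3 ?S \<phi>"
    unfolding smooth_group_iso_def
  proof (intro conjI ballI bij smooth_on_subset_UNIV[OF s\<phi>] smooth_on_subset_congI[OF s\<psi>])
    show "\<phi> (A ** B) = \<phi> A ** \<phi> B" for A B
      by (simp add: \<phi>_def phi0_mult matrix_mul_assoc[symmetric] FF')
  qed (use inv in auto)
qed

text \<open>On its plane \<open>E\<close> is a rotation by a right angle, so \<open>- E\<^sup>2\<close> projects to the plane and \<open>- E\<close> turns a
  unit vector of the plane into the second vector of an oriented orthonormal basis.\<close>

definition plane_proj :: "octonion \<Rightarrow> bivector \<Rightarrow> octonion" where
  "plane_proj y E = - (E *v (E *v y))"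

definition pf1 :: "octonion \<Rightarrow> bivector \<Rightarrow> octonion" where
  "pf1 y E = sgn (plane_proj y E)"

definition pf2 :: "octonion \<Rightarrow> bivector \<Rightarrow> octonion" where
  "pf2 y E = - (E *v pf1 y E)"

lemma plane_proj_wedge:
  "norm u = 1 \<Longrightarrow> norm v = 1 \<Longrightarrow> u \<bullet> v = 0 \<Longrightarrow>
    plane_proj y (wedge u v) = (u \<bullet> y) *\<^sub>R u + (v \<bullet> y) *\<^sub>R v"
  by (simp add: plane_proj_def wedge_mult inner_diff_right inner_commute[of v u] dot_square_norm mv_simps)

text \<open>The pair differs from the given oriented basis \<open>u\<close>, \<open>v\<close> by the
  rotation with cosine \<open>c\<close> and sine \<open>s\<close>, so it has the same wedge.\<close>

lemma plane_frame:
  assumes E: "E \<in> G2O" and y: "plane_proj y E \<noteq> 0"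
  shows "norm (pf1 y E) = 1" "norm (pf2 y E) = 1" "pf1 y E \<bullet> pf2 y E = 0" "E = wedge (pf1 y E) (pf2 y E)"
proof -
  obtain u v where uv: "E = wedge u v" "norm u = 1" "norm v = 1" "u \<bullet> v = 0" using G2O_E[OF E] .
  have uv': "u \<bullet> u = 1" "v \<bullet> v = 1" "v \<bullet> u = 0" using uv by (simp_all add: inner_commute dot_square_norm)
  define c where "c = inverse (norm (plane_proj y E)) * (u \<bullet> y)"
  define s where "s = inverse (norm (plane_proj y E)) * (v \<bullet> y)"
  have 1: "pf1 y E = c *\<^sub>R u + s *\<^sub>R v"
    by (simp add: pf1_def sgn_div_norm c_def s_def scaleR_add_right) (simp add: uv plane_proj_wedge scaleR_add_right)
  have 2: "pf2 y E = c *\<^sub>R v - s *\<^sub>R u"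
    unfolding pf2_def 1 by (simp add: uv(1) mv_simps wedge_mult uv' uv(4))
  show n: "norm (pf1 y E) = 1" using y by (simp add: pf1_def norm_sgn)
  then have "pf1 y E \<bullet> pf1 y E = 1" by (simp add: dot_square_norm)
  then have cs: "c * c + s * s = 1"
    by (simp add: 1 inner_add_left inner_add_right uv' uv(4))
  have "pf2 y E \<bullet> pf2 y E = 1" using cs
    by (simp add: 2 inner_diff_left inner_diff_right uv' uv(4))
  then show "norm (pf2 y E) = 1" by (simp add: norm_eq_sqrt_inner)
  show "pf1 y E \<bullet> pf2 y E = 0"
    unfolding 1 2 by (simp add: inner_add_left inner_diff_right uv' uv(4))
  have "wedge (pf1 y E) (pf2 y E) = (c * c + s * s) *\<^sub>R wedge u v"
    unfolding 1 2 by (simp add: wedge_def vec_eq_iff algebra_simps)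
  then show "E = wedge (pf1 y E) (pf2 y E)" by (simp add: cs uv(1))
qed

section \<open>Smooth local sections\<close>

lemma smooth_plane_proj: "open S \<Longrightarrow> smooth_on S (plane_proj y)"
  unfolding plane_proj_def
  by (intro smooth_on_minus smooth_on_matrix_vector_mult smooth_on_const smooth_on_id)

lemma open_plane_proj: "open {E. plane_proj y E \<noteq> 0}"
  using continuous_open_preimage[OF smooth_on_imp_continuous_on[OF smooth_plane_proj[OF open_UNIV]] open_UNIV, of "- {0}" y]
  by (simp add: vimage_def open_Compl)

lemma smooth_plane_frame:
  "smooth_on {E. plane_proj y E \<noteq> 0} (pf1 y)" "smooth_on {E. plane_proj y E \<noteq> 0} (pf2 y)"
proof -
  show 1: "smooth_on {E. plane_proj y E \<noteq> 0} (pf1 y)"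
    unfolding pf1_def by (intro smooth_on_sgn smooth_plane_proj open_plane_proj) simp
  then show "smooth_on {E. plane_proj y E \<noteq> 0} (pf2 y)"
    unfolding pf2_def by (intro smooth_on_minus smooth_on_matrix_vector_mult smooth_on_id open_plane_proj)
qed

lemma open_nonzero:
  fixes f :: "'a::real_normed_vector \<Rightarrow> 'b::real_normed_vector"
  assumes "open S" "smooth_on S f"
  shows "open {x \<in> S. f x \<noteq> 0}"
proof -
  have "{x \<in> S. f x \<noteq> 0} = S \<inter> f -` (- {0})" by auto
  then show ?thesis
    using continuous_open_preimage[OF smooth_on_imp_continuous_on[OF assms(2)] assms(1) open_Compl[OF closed_singleton]] by simp
qed

text \<open>Columns 1, 3 and 5 of one frame at \<open>y\<close> serve as reference vectors: near
  \<open>y\<close> their projections, to the plane, to its complement, and to the complement of the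
  four vectors already found, do not vanish. \<open>U0\<close>, \<open>U1\<close> and
  \<open>U\<close> record these conditions.\<close>

lemma adapted_section:
  assumes y: "y \<in> G2O"
  obtains U s where "open U" "y \<in> U" "smooth_on U s"
    "\<And>z. z \<in> G2O \<Longrightarrow> z \<in> U \<Longrightarrow> s z \<in> Spin7 \<and> frame_plane (s z) = z"
proof -
  obtain F where F: "F \<in> Spin7" "frame_plane F = y" using G2O_frame[OF y] .
  define y1 y2 y3 y5 where "y1 = column 1 F" and "y2 = column 2 F" and "y3 = column 3 F" and "y5 = column 5 F"
  have yw: "y = wedge y1 y2" using F by (simp add: frame_plane_def y1_def y2_def)
  have on: "y1 \<bullet> y1 = 1" "y2 \<bullet> y2 = 1" "y3 \<bullet> y3 = 1" "y5 \<bullet> y5 = 1" "y1 \<bullet> y2 = 0" "y1 \<bullet> y3 = 0" "y1 \<bullet> y5 = 0"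
    "y2 \<bullet> y1 = 0" "y2 \<bullet> y3 = 0" "y2 \<bullet> y5 = 0" "y3 \<bullet> y5 = 0"
    by (simp_all add: y1_def y2_def y3_def y5_def Spin7_column_inner[OF F(1)])
  have tc: "tc y1 y2 y3 = column 4 F"
    by (simp add: y1_def y2_def y3_def column_ax tc_Spin7[OF F(1)] tc_ax)
  have norms: "norm y1 = 1" "norm y2 = 1" "norm y3 = 1" by (simp_all add: norm_eq_sqrt_inner on)
  define U0 where "U0 = {z. plane_proj y1 z \<noteq> 0}"
  \<comment> \<open>The square of \<open>z\<close> is minus the projection to the plane, so for
    \<open>z\<close> in the Grassmannian \<open>q z\<close> is the projection of \<open>y3\<close>
    to the complement.\<close>
  define q where "q z = y3 + z *v (z *v y3)" for z :: bivector
  define U1 where "U1 = {z \<in> U0. q z \<noteq> 0}"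
  define e1 e2 e3 where "e1 = pf1 y1" and "e2 = pf2 y1" and "e3 z = sgn (q z)" for z
  define e4 where "e4 z = tc (e1 z) (e2 z) (e3 z)" for z
  define r where "r z = y5 - (e1 z \<bullet> y5) *\<^sub>R e1 z - (e2 z \<bullet> y5) *\<^sub>R e2 z - (e3 z \<bullet> y5) *\<^sub>R e3 z - (e4 z \<bullet> y5) *\<^sub>R e4 z" for z
  define U where "U = {z \<in> U1. r z \<noteq> 0}"
  define s where "s z = adapted (e1 z) (e2 z) (e3 z) (sgn (r z))" for z
  have oU0: "open U0" unfolding U0_def by (rule open_plane_proj)
  have sq: "smooth_on U0 q"
    unfolding q_def by (intro smooth_on_add smooth_on_matrix_vector_mult smooth_on_const smooth_on_id oU0)
  have oU1: "open U1" unfolding U1_def by (rule open_nonzero[OF oU0 sq])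
  have U10: "U1 \<subseteq> U0" by (auto simp: U1_def)
  have s1: "smooth_on U1 e1" "smooth_on U1 e2"
    unfolding e1_def e2_def
    using smooth_on_subset_open[OF smooth_plane_frame(1) U10[unfolded U0_def]]
      smooth_on_subset_open[OF smooth_plane_frame(2) U10[unfolded U0_def]] by blast+
  have s3: "smooth_on U1 e3"
    unfolding e3_def by (intro smooth_on_sgn oU1 smooth_on_subset_open[OF sq U10]) (simp add: U1_def)
  have s4: "smooth_on U1 e4" unfolding e4_def by (intro smooth_on_tc oU1 s1 s3)
  have sr: "smooth_on U1 r"
    unfolding r_def by (intro smooth_on_diff smooth_on_scaleR smooth_on_inner smooth_on_const oU1 s1 s3 s4)
  have oU: "open U" unfolding U_def by (rule open_nonzero[OF oU1 sr])
  have U1: "U \<subseteq> U1" by (auto simp: U_def)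
  note sU = s1[THEN smooth_on_subset_open[OF _ U1]] s3[THEN smooth_on_subset_open[OF _ U1]]
    sr[THEN smooth_on_subset_open[OF _ U1]]
  have ss: "smooth_on U s"
    unfolding s_def by (intro smooth_on_adapted smooth_on_sgn oU sU) (simp add: U_def)
  have "plane_proj y1 y = y1"
    unfolding yw plane_proj_wedge[OF norms(1,2) on(5)] by (simp add: on)
  then have at1: "e1 y = y1" "y \<in> U0"
    using norms(1) by (auto simp: e1_def pf1_def sgn_div_norm U0_def)
  then have at2: "e2 y = y2" by (simp add: e2_def pf2_def e1_def yw wedge_mult on)
  have "q y = y3" by (simp add: q_def yw wedge_mult on)
  then have at3: "e3 y = y3" "y \<in> U1" using norms(3) at1(2) by (auto simp: e3_def sgn_div_norm U1_def)
  have "e4 y = column 4 F" by (simp add: e4_def at1 at2 at3 tc)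
  moreover have "column 4 F \<bullet> y5 = 0" by (simp add: y5_def Spin7_column_inner[OF F(1)])
  ultimately have "r y = y5" by (simp add: r_def at1 at2 at3 on)
  then have "y \<in> U" using at3(2) on(4) by (auto simp: U_def)
  moreover have "s z \<in> Spin7 \<and> frame_plane (s z) = z" if z: "z \<in> G2O" "z \<in> U" for z
  proof -
    have z0: "plane_proj y1 z \<noteq> 0" "q z \<noteq> 0" "r z \<noteq> 0" using z(2) by (auto simp: U_def U1_def U0_def)
    note pf = plane_frame[OF z(1) z0(1), folded e1_def e2_def]
    have on12: "e1 z \<bullet> e1 z = 1" "e2 z \<bullet> e2 z = 1" "e2 z \<bullet> e1 z = 0"
      using pf by (simp_all add: dot_square_norm inner_commute)
    have zx: "z *v x = (e2 z \<bullet> x) *\<^sub>R e1 z - (e1 z \<bullet> x) *\<^sub>R e2 z" for x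
      using arg_cong[OF pf(4), of "\<lambda>w. w *v x"] by (simp only: wedge_mult)
    have "q z = y3 - (e1 z \<bullet> y3) *\<^sub>R e1 z - (e2 z \<bullet> y3) *\<^sub>R e2 z"
      by (simp add: q_def zx inner_diff_right on12 pf(3) mv_simps)
    then have "e1 z \<bullet> q z = 0" "e2 z \<bullet> q z = 0" by (simp_all add: inner_diff_right on12 pf(3))
    then have p3: "e1 z \<bullet> e3 z = 0" "e2 z \<bullet> e3 z = 0" by (simp_all add: e3_def sgn_div_norm)
    have n3: "norm (e3 z) = 1" using z0 by (simp add: e3_def norm_sgn)
    have n4: "norm (e4 z) = 1" using norm_tc[OF pf(1-3) p3] n3 by (simp add: e4_def)
    have p4: "e1 z \<bullet> e4 z = 0" "e2 z \<bullet> e4 z = 0" "e3 z \<bullet> e4 z = 0" by (simp_all add: e4_def tc_perp)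
    note ip = on12 pf(3) p3 p4 p3[unfolded inner_commute[of _ "e3 z"]] p4[unfolded inner_commute[of _ "e4 z"]]
      n3[unfolded norm_eq_1] n4[unfolded norm_eq_1]
    have "e1 z \<bullet> r z = 0" "e2 z \<bullet> r z = 0" "e3 z \<bullet> r z = 0" "e4 z \<bullet> r z = 0"
      unfolding r_def by (simp_all add: inner_diff_right ip)
    then have p5: "sgn (r z) \<bullet> e1 z = 0" "sgn (r z) \<bullet> e2 z = 0" "sgn (r z) \<bullet> e3 z = 0" "sgn (r z) \<bullet> e4 z = 0"
      by (simp_all add: sgn_div_norm inner_commute)
    have "s z \<in> Spin7"
      unfolding s_def
      using p5(4) by (intro adapted_in_Spin7 pf p3 n3 p5) (simp_all add: norm_sgn z0 e4_def)
    moreover have "frame_plane (s z) = z"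
      unfolding frame_plane_def s_def column_adapted using pf(4) by simp
    ultimately show ?thesis by blast
  qed
  ultimately show ?thesis using that oU ss by blast
qed

lemma homogeneous_space_G2O: "homogeneous_space G2O Spin7 act2 U3"
  unfolding homogeneous_space_def
proof (intro conjI ballI matrix_group_Spin7 matrix_group_U3)
  show "G2O \<noteq> {}" using frame_plane_in_G2O[OF Spin7_one] by blast
  have "smooth_on UNIV (\<lambda>p :: (real^8^8) \<times> bivector. act2 (fst p) (snd p))"
    by (intro smooth_on_act2 smooth_on_bounded_linear[OF bounded_linear_fst] smooth_on_bounded_linear[OF bounded_linear_snd]
        smooth_on_id open_UNIV)
  then show "smooth_on_subset (Spin7 \<times> G2O) (\<lambda>(g, x). act2 g x)"
    by (intro smooth_on_subset_UNIV) (simp add: case_prod_unfold)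
next
  fix x assume "x \<in> G2O"
  then obtain F where F: "F \<in> Spin7" "frame_plane F = x" using G2O_frame by blast
  then show "\<exists>\<phi>. smooth_group_iso U3 {g \<in> Spin7. act2 g x = x} \<phi>" using isotropy_U3[OF F(1)] by simp
  have to: "G ** transpose F \<in> Spin7 \<and> act2 (G ** transpose F) x = frame_plane G" if "G \<in> Spin7" for G
  proof -
    have "act2 (G ** transpose F) x = act2 G (act2 (transpose F ** F) (wedge (ax 1) (ax 2)))"
      by (simp add: F(2)[symmetric] frame_plane_act2 act2_mult)
    then show ?thesis using that F(1)
      by (simp add: Spin7_mult Spin7_transpose Spin7_transpose_mult act2_one frame_plane_act2)
  qed
  fix y assume y: "y \<in> G2O"
  then obtain G where "G \<in> Spin7" "frame_plane G = y" using G2O_frame by blast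
  then show "\<exists>g\<in>Spin7. act2 g x = y" using to by blast
  obtain U s where U: "open U" "y \<in> U" "smooth_on U s"
    "\<And>z. z \<in> G2O \<Longrightarrow> z \<in> U \<Longrightarrow> s z \<in> Spin7 \<and> frame_plane (s z) = z"
    using adapted_section[OF y] by blast
  have "smooth_on U (\<lambda>z. s z ** transpose F)"
    by (intro smooth_on_matrix_mult smooth_on_const U)
  then have "smooth_on_subset (G2O \<inter> U) (\<lambda>z. s z ** transpose F)"
    by (rule smooth_on_subset_inter_open[OF U(1)])
  then show "\<exists>U s. open U \<and> y \<in> U \<and> smooth_on_subset (G2O \<inter> U) s \<and> (\<forall>z\<in>G2O \<inter> U. s z \<in> Spin7 \<and> act2 (s z) x = z)"
    using U to by (intro exI[of _ U] exI[of _ "\<lambda>z. s z ** transpose F"]) auto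
qed (auto simp: act2_in_G2O act2_one act2_mult)

section \<open>Nonintegrability\<close>

lemma bounded_bilinear_Jop: "bounded_bilinear Jop"
proof (rule bilinear_conv_bounded_bilinear[THEN iffD1], unfold bilinear_def, intro conjI allI linear_Jop)
  show "linear (\<lambda>E. Jop E X)" for X
    by (rule linearI) (simp_all add: Jop_def linear_add[OF linear_Kop] linear_cmul[OF linear_Kop]
        matrix_eq mv_simps scaleR_diff_right)
qed

lemma commutator_in_TG2O:
  assumes "transpose S = - S" "E \<in> G2O"
  shows "S ** E - E ** S \<in> TG2O E"
proof -
  note E = G2O_equations[OF assms(2)]
  have E3: "E *v (E *v (E *v x)) = - (E *v x)" for x
    using arg_cong[OF E(2), of "\<lambda>M. M *v x"] by (simp add: mv_simps)
  have "transpose (S ** E - E ** S) = transpose (S ** E) - transpose (E ** S)"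
    by (simp add: transpose_def vec_eq_iff)
  also have "\<dots> = - (S ** E - E ** S)"
    by (simp add: matrix_transpose_mul assms(1) E(1) matrix_eq mv_simps)
  finally show ?thesis
    by (simp add: TG2O_def matrix_eq mv_simps E3)
qed

text \<open>Expanding the field \<open>Y\<close> in \<open>Basis\<close> reduces the product rule to
  derivatives in fixed directions. The second derivative is visibly linear in the outer direction;
  symmetry transfers this to the inner one.\<close>

lemma frechet_derivative_field:
  fixes f :: "'a::euclidean_space \<Rightarrow> 'b::euclidean_space"
  assumes f: "smooth_on U f" and U: "open U" and x: "x \<in> U" and Y: "(Y has_derivative Y') (at x)"
  shows "((\<lambda>y. frechet_derivative f (at y) (Y y)) has_derivative
    (\<lambda>z. frechet_derivative (\<lambda>y. frechet_derivative f (at y) (Y x)) (at x) z + frechet_derivative f (at x) (Y' z))) (at x)"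
proof -
  have lin: "linear (frechet_derivative f (at y))" if "y \<in> U" for y
    using smooth_on_has_derivative[OF f that] has_derivative_linear by blast
  have exp: "(\<Sum>b\<in>Basis. (v \<bullet> b) *\<^sub>R frechet_derivative f (at y) b) = frechet_derivative f (at y) v" if "y \<in> U" for y v
    using linear_sum[OF lin[OF that], of "\<lambda>b. (v \<bullet> b) *\<^sub>R b" Basis]
    by (simp add: linear_cmul[OF lin[OF that]] euclidean_representation)
  define Q where "Q z v = frechet_derivative (\<lambda>y. frechet_derivative f (at y) v) (at x) z" for z v
  have d: "((\<lambda>y. frechet_derivative f (at y) v) has_derivative (\<lambda>z. Q z v)) (at x)" for v
    using smooth_on_has_derivative[OF smooth_on_frechet_derivative[OF f] x] by (simp add: Q_def)
  have "Q z v = Q v z" for z v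
    unfolding Q_def by (rule symmetric_second_derivative[OF f U x])
  then have "Q z = (\<lambda>v. Q v z)" for z by blast
  then have linQ: "linear (Q z)" for z using has_derivative_linear[OF d[of z]] by metis
  have expQ: "(\<Sum>b\<in>Basis. (v \<bullet> b) *\<^sub>R Q z b) = Q z v" for z v
    using linear_sum[OF linQ, of z "\<lambda>b. (v \<bullet> b) *\<^sub>R b" Basis]
    by (simp add: linear_cmul[OF linQ] euclidean_representation)
  have "((\<lambda>y. \<Sum>b\<in>Basis. (Y y \<bullet> b) *\<^sub>R frechet_derivative f (at y) b) has_derivative
      (\<lambda>z. \<Sum>b\<in>Basis. (Y x \<bullet> b) *\<^sub>R Q z b + (Y' z \<bullet> b) *\<^sub>R frechet_derivative f (at x) b)) (at x)"
    by (intro has_derivative_sum bounded_bilinear.FDERIV[OF bounded_bilinear_scaleR] d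
        bounded_linear.has_derivative[OF bounded_linear_inner_left] Y)
  then have "((\<lambda>y. \<Sum>b\<in>Basis. (Y y \<bullet> b) *\<^sub>R frechet_derivative f (at y) b) has_derivative
      (\<lambda>z. Q z (Y x) + frechet_derivative f (at x) (Y' z))) (at x)"
    by (simp add: sum.distrib exp[OF x] expQ)
  then have "((\<lambda>y. frechet_derivative f (at y) (Y y)) has_derivative
      (\<lambda>z. Q z (Y x) + frechet_derivative f (at x) (Y' z))) (at x)"
    by (rule has_derivative_transform_within_open[OF _ U x]) (simp add: exp)
  then show ?thesis by (simp add: Q_def)
qed

lemma vector_derivative_unique_eventually:
  assumes "(f has_vector_derivative a) (at x)" "(g has_vector_derivative b) (at x)" "\<forall>\<^sub>F t in nhds x. f t = g t"
  shows "a = b"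
proof -
  have "(g has_vector_derivative a) (at x)"
    by (rule has_vector_derivative_cong_ev[THEN iffD1, OF _ _ assms(1)])
      (use assms(3) eventually_nhds_x_imp_x[OF assms(3)] in auto)
  then show ?thesis using assms(2) vector_derivative_unique_at by blast
qed

lemma eventually_in_open_along_curve:
  assumes "(c has_vector_derivative Z) (at (0::real))" "open U" "c 0 \<in> U"
  shows "\<forall>\<^sub>F t in nhds 0. c t \<in> U"
proof -
  have "continuous (at 0) c" using assms(1) has_vector_derivative_continuous by blast
  then have "(c \<longlongrightarrow> c 0) (nhds 0)" by (simp add: tendsto_nhds_iff isCont_def)
  then show ?thesis using assms(2,3) topological_tendstoD by blast
qed

lemma smooth_on_along_curve:
  assumes "smooth_on U f" "c 0 \<in> U" "(c has_vector_derivative Z) (at (0::real))"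
  shows "((\<lambda>t. f (c t)) has_vector_derivative frechet_derivative f (at (c 0)) Z) (at 0)"
  using vector_derivative_diff_chain_within[OF assms(3), of f "frechet_derivative f (at (c 0))"]
    has_derivative_at_withinI[OF smooth_on_has_derivative[OF assms(1,2)]] by (simp add: o_def)

lemma bounded_linear_vector_scale: "bounded_linear (\<lambda>w :: complex^'k. c *s w)"
  by (rule linear_conv_bounded_linear[THEN iffD1])
    (auto intro!: linearI simp: vec_eq_iff algebra_simps)

text \<open>The condition \<open>df (J V) = \<i> df V\<close> for \<open>V(E) = [S, E]\<close>, differentiated in a direction \<open>Z\<close>
  commuting with \<open>S\<close>.\<close>

lemma holomorphic_chart_second_order:
  fixes f :: "bivector \<Rightarrow> complex^'k"
  assumes ch: "holomorphic_chart G2O J_G2O U f" and E: "E \<in> G2O" "E \<in> U"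
    and S: "transpose S = - S" and Z: "Z \<in> TG2O E" and com: "S ** Z - Z ** S = 0"
  defines "A \<equiv> S ** E - E ** S"
  shows "frechet_derivative (\<lambda>y. frechet_derivative f (at y) (Jop E A)) (at E) Z + frechet_derivative f (at E) (Jop Z A)
    = \<i> *s frechet_derivative (\<lambda>y. frechet_derivative f (at y) A) (at E) Z"
proof -
  have f: "smooth_on U f" and U: "open U" and J: "\<And>y v. y \<in> G2O \<Longrightarrow> y \<in> U \<Longrightarrow> v \<in> TG2O y \<Longrightarrow>
      frechet_derivative f (at y) (J_G2O y v) = \<i> *s frechet_derivative f (at y) v"
    using ch tangent_space_G2O by (auto simp: holomorphic_chart_def)
  obtain c where c: "range c \<subseteq> G2O" "c 0 = E" "(c has_vector_derivative Z) (at (0::real))"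
    using Z tangent_space_G2O[OF E(1)] unfolding tangent_space_def by blast
  define V where "V y = S ** y - y ** S" for y :: bivector
  have "linear V" by (rule linearI) (simp_all add: V_def matrix_eq mv_simps scaleR_diff_right)
  then have dV: "(V has_derivative V) (at E)"
    by (simp add: linear_conv_bounded_linear bounded_linear_imp_has_derivative)
  \<comment> \<open>Because \<open>S\<close> commutes with \<open>Z\<close>, the field
    \<open>V\<close> has no first-order change along \<open>Z\<close>, and the first derivative of
    \<open>f\<close> survives on \<open>Jop Z A\<close> alone.\<close>
  have VZ: "V Z = 0" by (simp add: V_def com)
  have VE: "V E = A" by (simp add: V_def A_def)
  have dJ: "((\<lambda>y. Jop y (V y)) has_derivative (\<lambda>z. Jop E (V z) + Jop z (V E))) (at E)"
    by (rule bounded_bilinear.FDERIV[OF bounded_bilinear_Jop has_derivative_ident dV])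
  note chain = vector_derivative_diff_chain_within[OF c(3), unfolded o_def c(2), OF has_derivative_at_withinI]
  note D1 = chain[OF frechet_derivative_field[OF f U E(2) dJ]]
  note D2 = bounded_linear.has_vector_derivative[OF bounded_linear_vector_scale[of \<i>] chain[OF frechet_derivative_field[OF f U E(2) dV]]]
  have "\<forall>\<^sub>F t in nhds 0. c t \<in> U"
    using eventually_in_open_along_curve[OF c(3) U] c(2) E(2) by simp
  then have ev: "\<forall>\<^sub>F t in nhds 0. frechet_derivative f (at (c t)) (Jop (c t) (V (c t))) = \<i> *s frechet_derivative f (at (c t)) (V (c t))"
  proof eventually_elim
    case (elim t)
    have ct: "c t \<in> G2O" using c(1) by auto
    have "V (c t) \<in> TG2O (c t)" unfolding V_def by (rule commutator_in_TG2O[OF S ct])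
    then show ?case using J[OF ct elim] J_G2O_eq[OF ct] by metis
  qed
  have "frechet_derivative (\<lambda>y. frechet_derivative f (at y) (Jop E (V E))) (at E) Z + frechet_derivative f (at E) (Jop E (V Z) + Jop Z (V E))
    = \<i> *s (frechet_derivative (\<lambda>y. frechet_derivative f (at y) (V E)) (at E) Z + frechet_derivative f (at E) (V Z))"
    by (rule vector_derivative_unique_eventually[OF D1 D2 ev])
  moreover have "frechet_derivative f (at E) 0 = 0"
    using smooth_on_has_derivative[OF f E(2)] has_derivative_linear linear_0 by blast
  ultimately show ?thesis by (simp add: VZ VE linear_0[OF linear_Jop])
qed

text \<open>Along a curve with velocity \<open>Z\<close> the image under \<open>f\<close> has
  velocity 0; the smooth inverse of the chart recovers the curve, whose velocity is then 0 as
  well.\<close>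

lemma holomorphic_chart_injective:
  fixes f :: "bivector \<Rightarrow> complex^'k"
  assumes ch: "holomorphic_chart G2O J_G2O U f" and E: "E \<in> G2O" "E \<in> U"
    and Z: "Z \<in> TG2O E" and 0: "frechet_derivative f (at E) Z = 0"
  shows "Z = 0"
proof -
  let ?h = "inv_into (G2O \<inter> U) f"
  have f: "smooth_on U f" and U: "open U" and inj: "inj_on f (G2O \<inter> U)" and h: "smooth_on (f ` (G2O \<inter> U)) ?h"
    using ch by (auto simp: holomorphic_chart_def)
  obtain c where c: "range c \<subseteq> G2O" "c 0 = E" "(c has_vector_derivative Z) (at (0::real))"
    using Z tangent_space_G2O[OF E(1)] unfolding tangent_space_def by blast
  have fc: "((\<lambda>t. f (c t)) has_vector_derivative 0) (at 0)"
    using smooth_on_along_curve[OF f _ c(3)] E(2) 0 by (simp add: c(2))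
  have "((\<lambda>t. ?h (f (c t))) has_vector_derivative frechet_derivative ?h (at (f (c 0))) 0) (at 0)"
    by (rule smooth_on_along_curve[OF h _ fc]) (use E c(2) in auto)
  moreover have "frechet_derivative ?h (at (f (c 0))) 0 = 0"
    using smooth_on_has_derivative[OF h, of "f (c 0)"] has_derivative_linear linear_0 E c(2) by blast
  ultimately have hf: "((\<lambda>t. ?h (f (c t))) has_vector_derivative 0) (at 0)" by simp
  have "\<forall>\<^sub>F t in nhds 0. c t \<in> U"
    using eventually_in_open_along_curve[OF c(3) U] c(2) E(2) by simp
  then have ev: "\<forall>\<^sub>F t in nhds 0. ?h (f (c t)) = c t"
    by eventually_elim (use c(1) inv_into_f_f[OF inj] in blast)
  show "Z = 0" using vector_derivative_unique_eventually[OF hf c(3) ev] by simp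
qed

lemma wedge_ax_mult: "wedge (ax i) (ax j) *v ax k = (if j = k then ax i else 0) - (if i = k then ax j else 0)"
  by (auto simp: wedge_mult ax_inner)

lemma commutator_wedge:
  "transpose S = - S \<Longrightarrow> S ** wedge u v - wedge u v ** S = wedge (S *v u) v + wedge u (S *v v)"
  unfolding matrix_eq
  by (simp add: mv_simps wedge_mult inner_transpose_matrix algebra_simps)

text \<open>At the standard plane the second-order identity is applied to four pairs of
  \<open>S\<close> and \<open>Z\<close>. Eliminating the second derivatives by symmetry, the
  derivative of the chart sends \<open>?w 7 2\<close> to \<i> times the image of
  \<open>?w 6 2\<close>, whereas holomorphy gives the opposite sign. So it kills a nonzero tangent
  vector, against injectivity.\<close>

lemma not_integrable_J_G2O: "\<not> integrable_acs TYPE('k::finite) G2O J_G2O"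
proof
  let ?E = "wedge (ax 1) (ax 2)"
  let ?w = "\<lambda>i j. wedge (ax i) (ax j)"
  assume "integrable_acs TYPE('k) G2O J_G2O"
  moreover have E: "?E \<in> G2O" by (simp add: G2O_I ax_inner)
  ultimately obtain U and f :: "bivector \<Rightarrow> complex^'k" where U: "?E \<in> U" and ch: "holomorphic_chart G2O J_G2O U f"
    unfolding integrable_acs_def by blast
  have f: "smooth_on U f" "open U" and J: "\<And>v. v \<in> TG2O ?E \<Longrightarrow>
      frechet_derivative f (at ?E) (J_G2O ?E v) = \<i> *s frechet_derivative f (at ?E) v"
    using ch tangent_space_G2O[OF E] U E by (auto simp: holomorphic_chart_def)
  define D where "D v = frechet_derivative f (at ?E) v" for v
  have linD: "linear D"
    unfolding D_def[abs_def] using smooth_on_has_derivative[OF f(1) U] has_derivative_linear by blast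
  define Q where "Q z v = frechet_derivative (\<lambda>y. frechet_derivative f (at y) v) (at ?E) z" for z v
  have Qsym: "Q z v = Q v z" for z v unfolding Q_def by (rule symmetric_second_derivative[OF f U])
  have linQ: "linear (\<lambda>z. Q z v)" for v
    unfolding Q_def using smooth_on_has_derivative[OF smooth_on_frechet_derivative[OF f(1)] U] has_derivative_linear by blast
  have "Q z = (\<lambda>v. Q v z)" for z using Qsym by blast
  then have linQ': "linear (Q z)" for z using linQ[of z] by metis
  have w0: "wedge x 0 = 0" for x by (simp add: wedge_def vec_eq_iff)
  have T: "?w j 2 \<in> TG2O ?E" if "j \<noteq> 1" "j \<noteq> 2" for j
    using TG2O_I[of "ax 1" "ax 2" "ax j" 0] that by (simp add: ax_inner w0)
  have tcs: "tc (ax 1) (ax 2) (ax 3) = ax 4" "tc (ax 1) (ax 2) (ax 5) = - ax 8" "tc (ax 1) (ax 2) (ax 6) = - ax 7"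
    unfolding tc_ax_12 by (simp_all add: vec_eq_iff forall_8) (simp_all add: axis_def)
  have "tc (ax 5) (ax 2) (ax 3) = - ax 6"
    using tc_swap(1)[of "ax 2" "ax 5" "ax 3"] tc_swap(2)[of "ax 2" "ax 3" "ax 5"] tc_swap(1)[of "ax 3" "ax 2" "ax 5"]
    by (simp add: tc_ax)
  note tcs = tcs this tc_ax
  note JJ = Jop_wedge tcs tc_refl wedge_minus_left wedge_minus_right
  have sk: "transpose (?w i j) = - ?w i j" for i j by (rule transpose_wedge)
  \<comment> \<open>For \<open>S = ?w j 1\<close> the commutator with E is \<open>?w j 2\<close>,
    and \<open>S\<close> commutes with \<open>?w k 2\<close> when the indices are disjoint.\<close>
  have cm: "?w 3 1 ** ?E - ?E ** ?w 3 1 = ?w 3 2" "?w 5 1 ** ?E - ?E ** ?w 5 1 = ?w 5 2"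
    "?w 5 1 ** ?w 4 2 - ?w 4 2 ** ?w 5 1 = 0" "?w 3 1 ** ?w 8 2 - ?w 8 2 ** ?w 3 1 = 0"
    "?w 5 1 ** ?w 3 2 - ?w 3 2 ** ?w 5 1 = 0" "?w 3 1 ** ?w 5 2 - ?w 5 2 ** ?w 3 1 = 0"
    unfolding commutator_wedge[OF sk] wedge_ax_mult by (simp_all add: w0) (simp_all add: wedge_def vec_eq_iff)
  have eq: "Q Z (Jop ?E (S ** ?E - ?E ** S)) + D (Jop Z (S ** ?E - ?E ** S)) = \<i> *s Q Z (S ** ?E - ?E ** S)"
    if "transpose S = - S" "Z \<in> TG2O ?E" "S ** Z - Z ** S = 0" for S Z
    unfolding Q_def D_def by (rule holomorphic_chart_second_order[OF ch E U that])
  have a: "Q (?w 4 2) (- ?w 8 2) + D (?w 7 2) = \<i> *s Q (?w 4 2) (?w 5 2)"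
    using eq[OF sk T cm(3)] by (simp add: cm JJ w0)
  have b: "Q (?w 8 2) (?w 4 2) + D (?w 7 2) = \<i> *s Q (?w 8 2) (?w 3 2)"
    using eq[OF sk T cm(4)] by (simp add: cm JJ w0)
  have c: "Q (?w 3 2) (- ?w 8 2) + D (?w 6 2) = \<i> *s Q (?w 3 2) (?w 5 2)"
    using eq[OF sk T cm(5)] by (simp add: cm JJ w0)
  have d: "Q (?w 5 2) (?w 4 2) + D (- ?w 6 2) = \<i> *s Q (?w 5 2) (?w 3 2)"
    using eq[OF sk T cm(6)] by (simp add: cm JJ w0)
  have "Jop ?E (?w 6 2) = - ?w 7 2" by (simp add: JJ w0)
  then have e: "D (- ?w 7 2) = \<i> *s D (?w 6 2)"
    using J[OF T[of 6]] by (simp add: D_def J_G2O_eq[OF E T])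
  have "D (?w 7 2) = 0"
    unfolding vec_eq_iff
  proof
    fix i
    have 1: "- (Q (?w 4 2) (?w 8 2) $ i) + D (?w 7 2) $ i = \<i> * Q (?w 4 2) (?w 5 2) $ i"
      "Q (?w 4 2) (?w 8 2) $ i + D (?w 7 2) $ i = \<i> * Q (?w 3 2) (?w 8 2) $ i"
      "- (Q (?w 3 2) (?w 8 2) $ i) + D (?w 6 2) $ i = \<i> * Q (?w 3 2) (?w 5 2) $ i"
      "Q (?w 4 2) (?w 5 2) $ i - D (?w 6 2) $ i = \<i> * Q (?w 3 2) (?w 5 2) $ i"
      "- (D (?w 7 2) $ i) = \<i> * D (?w 6 2) $ i"
      using arg_cong[OF a, of "\<lambda>v. v $ i"] arg_cong[OF b, of "\<lambda>v. v $ i"] arg_cong[OF c, of "\<lambda>v. v $ i"]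
        arg_cong[OF d, of "\<lambda>v. v $ i"] arg_cong[OF e, of "\<lambda>v. v $ i"]
        Qsym[of "?w 8 2" "?w 4 2"] Qsym[of "?w 8 2" "?w 3 2"] Qsym[of "?w 5 2" "?w 4 2"] Qsym[of "?w 5 2" "?w 3 2"]
      by (simp_all add: linear_neg[OF linQ'] linear_neg[OF linD])
    \<comment> \<open>Adding the first two equations gives twice \<open>D (?w 7 2)\<close> as \<i>
      times a sum of two second derivatives. The fourth minus the third says that this sum is twice
      \<open>D (?w 6 2)\<close>. The fifth contradicts the resulting sign unless both
      vanish.\<close>
    have "4 * D (?w 7 2) $ i = 0" using 1 i_squared by algebra
    then show "D (?w 7 2) $ i = 0 $ i" by simp
  qed
  then have "?w 7 2 = 0" using holomorphic_chart_injective[OF ch E U T] by (simp add: D_def)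
  then have "?w 7 2 $ 7 $ 2 = 0" by simp
  then show False by (simp add: wedge_vec_nth axis_def)
qed

section \<open>Cayley planes and complex pencils\<close>

lemma dim_orthogonal_4:
  fixes a b c d :: "'a::euclidean_space"
  assumes "a \<noteq> 0" "b \<noteq> 0" "c \<noteq> 0" "d \<noteq> 0"
    and "a \<bullet> b = 0" "a \<bullet> c = 0" "a \<bullet> d = 0" "b \<bullet> c = 0" "b \<bullet> d = 0" "c \<bullet> d = 0"
  shows "dim (span {a, b, c, d}) = 4"
proof -
  have ne: "a \<noteq> b" "a \<noteq> c" "a \<noteq> d" "b \<noteq> c" "b \<noteq> d" "c \<noteq> d" using assms by auto
  have "pairwise orthogonal {a, b, c, d}"
    using assms by (auto simp: pairwise_def orthogonal_def inner_commute)
  then have "independent {a, b, c, d}"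
    using assms by (intro pairwise_orthogonal_independent) auto
  then show ?thesis using ne by (simp add: dim_span dim_eq_card_independent)
qed

lemma Spin7_triple:
  assumes "norm u = 1" "norm v = 1" "norm w = 1" "u \<bullet> v = 0" "u \<bullet> w = 0" "v \<bullet> w = 0"
  obtains h where "h \<in> Spin7" "h *v u = ax 1" "h *v v = ax 2" "h *v w = ax 3"
proof -
  obtain F where F: "F \<in> Spin7" "column 1 F = u" "column 2 F = v"
    using G2O_frame_exists assms by blast
  let ?G = "transpose F"
  have G: "?G \<in> Spin7" by (rule Spin7_transpose[OF F(1)])
  have Gu: "?G *v u = ax 1" "?G *v v = ax 2"
    unfolding F(2,3)[symmetric] column_ax by (simp_all add: Spin7_transpose_vec[OF F(1)])
  have "norm (?G *v w) = 1" "(?G *v w) \<bullet> ax 1 = 0" "(?G *v w) \<bullet> ax 2 = 0"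
    unfolding Gu[symmetric] using assms by (simp_all add: Spin7_norm[OF G] Spin7_inner[OF G] inner_commute)
  then obtain g where "g \<in> Spin7" "g *v ax 1 = ax 1" "g *v ax 2 = ax 2" "g *v (?G *v w) = ax 3"
    using Spin7_transitive_3 by blast
  then show ?thesis using that[of "g ** ?G"] G Gu
    by (simp add: Spin7_mult matrix_vector_mul_assoc[symmetric])
qed

text \<open>Spin(7) moves the span to the first four coordinates. There the Cayley form is the
  determinant, which is 1 or -1 on an orthonormal basis.\<close>

lemma cayley_plane_span:
  assumes on: "norm u = 1" "norm v = 1" "norm w = 1" "u \<bullet> v = 0" "u \<bullet> w = 0" "v \<bullet> w = 0"
  shows "cayley_plane (span {u, v, w, tc u v w})"
proof -
  obtain h where h: "h \<in> Spin7" "h *v u = ax 1" "h *v v = ax 2" "h *v w = ax 3"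
    using Spin7_triple[OF on] by blast
  have h4: "h *v tc u v w = ax 4" using tc_Spin7[OF h(1), of u v w] h tc_ax(1) by simp
  let ?Z = "{x. (h *v x) $ 5 = 0 \<and> (h *v x) $ 6 = 0 \<and> (h *v x) $ 7 = 0 \<and> (h *v x) $ 8 = 0}"
  have "subspace ?Z" by (auto simp: subspace_def mv_simps)
  moreover have "{u, v, w, tc u v w} \<subseteq> ?Z" by (simp add: h h4 axis_nth_if)
  ultimately have Z: "span {u, v, w, tc u v w} \<subseteq> ?Z" by (rule span_minimal[rotated])
  have dim: "dim (span {u, v, w, tc u v w}) = 4"
    using on norm_tc[OF on(1,2,4,5,6)] by (intro dim_orthogonal_4) (auto simp: tc_perp)
  show ?thesis
    unfolding cayley_plane_def
  proof (intro conjI allI impI dim subspace_span)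
    fix x :: "4 \<Rightarrow> octonion"
    assume x: "range x \<subseteq> span {u, v, w, tc u v w} \<and> (\<forall>i j. x i \<bullet> x j = (if i = j then 1 else 0))"
    define y where "y i = h *v x i" for i
    have z: "y i $ 5 = 0" "y i $ 6 = 0" "y i $ 7 = 0" "y i $ 8 = 0" for i
      using x Z by (auto simp: y_def)
    have yy: "y i \<bullet> y j = (if i = j then 1 else 0)" for i j
      using x by (simp add: y_def Spin7_inner[OF h(1)])
    define W :: "real^4^4" where "W = vector [vector [y 1 $ 1, y 1 $ 2, y 1 $ 3, y 1 $ 4],
      vector [y 2 $ 1, y 2 $ 2, y 2 $ 3, y 2 $ 4], vector [y 3 $ 1, y 3 $ 2, y 3 $ 3, y 3 $ 4],
      vector [y 4 $ 1, y 4 $ 2, y 4 $ 3, y 4 $ 4]]"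
    have "\<forall>i j. y i \<bullet> y j = (if i = j then 1 else 0)" using yy by blast
    then have "W ** transpose W = mat 1"
      unfolding vec_eq_iff forall_4 inner_vec_def sum_8 z
      by (simp add: W_def matrix_matrix_mult_def transpose_def sum_4 vector_4 mat_def)
    then have "orthogonal_matrix W" by (simp add: orthogonal_matrix_def matrix_left_right_inverse)
    then have "\<bar>det W\<bar> = 1" using det_orthogonal_matrix[of W] by auto
    moreover have "cayley_form (y 1) (y 2) (y 3) (y 4) = dx4 1 2 3 4 (y 1) (y 2) (y 3) (y 4)"
      by (simp add: cayley_form_def dx4_pl pl_def z)
    ultimately show "\<bar>cayley_form (x 1) (x 2) (x 3) (x 4)\<bar> = 1"
      by (simp add: dx4_def W_def y_def Spin7_cayley_form[OF h(1)])
  qed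
qed

text \<open>Scalar multiplication by \<open>z\<close>, on vectors where \<open>K\<^sup>2 = -1\<close>.\<close>

definition cs :: "real^8^8 \<Rightarrow> complex \<Rightarrow> octonion \<Rightarrow> octonion" where
  "cs K z x = Re z *\<^sub>R x + Im z *\<^sub>R (K *v x)"

section \<open>Complex dependence in a pencil, and lines in Cayley planes\<close>

lemma cs_linear: "linear (cs K z)"
  by (rule linearI) (simp_all add: cs_def mv_simps algebra_simps)

lemma cs_diff: "cs K z x - cs K w x = cs K (z - w) x"
  by (simp add: cs_def algebra_simps)

lemma cs_cs: "K *v (K *v x) = - x \<Longrightarrow> cs K z (cs K w x) = cs K (z * w) x"
  by (simp add: cs_def mv_simps algebra_simps)

lemma cs_0 [simp]: "cs K 0 x = 0" "cs K z 0 = 0" and cs_1 [simp]: "cs K 1 x = x"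
  by (simp_all add: cs_def)

lemma cs_eq_0:
  assumes "K *v (K *v x) = - x" "cs K z x = 0" "z \<noteq> 0"
  shows "x = 0"
  using cs_cs[OF assms(1), of "inverse z" z] assms(2,3) by simp

text \<open>If \<open>a\<close> and \<open>b\<close> are complex independent, the multipliers at
  \<open>a\<close>, \<open>b\<close> and \<open>a + b\<close> must coincide, which is the first
  alternative. Otherwise both lie on the complex line of a nonzero one among them, and the
  hypothesis puts \<open>c\<close> and \<open>d\<close> on that line.\<close>

lemma pencil:
  assumes K: "K *v (K *v a) = - a" "K *v (K *v b) = - b" "K *v (K *v c) = - c" "K *v (K *v d) = - d"
    and ab: "a \<noteq> 0 \<or> b \<noteq> 0"
    and P: "\<And>r s. r *\<^sub>R a + s *\<^sub>R b \<noteq> 0 \<Longrightarrow> \<exists>z. r *\<^sub>R c + s *\<^sub>R d = cs K z (r *\<^sub>R a + s *\<^sub>R b)"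
  shows "(\<exists>z. c = cs K z a \<and> d = cs K z b) \<or> (\<exists>p z1 z2 z3 z4. p \<in> {a, b} \<and> p \<noteq> 0 \<and>
    a = cs K z1 p \<and> b = cs K z2 p \<and> c = cs K z3 p \<and> d = cs K z4 p)"
proof -
  have line: "\<exists>z2 z3 z4. b = cs K z2 a \<and> c = cs K z3 a \<and> d = cs K z4 a"
    if a0: "a \<noteq> 0" and b: "b = cs K w a" for w
  proof -
    obtain z3 where z3: "c = cs K z3 a" using P[of 1 0] a0 by auto
    have "\<exists>z4. d = cs K z4 a"
    proof (cases "b = 0")
      case True
      \<comment> \<open>With \<open>b = 0\<close> the hypothesis says nothing at \<open>b\<close>
        itself; it is used at \<open>a + b = a\<close> instead.\<close>
      then obtain z where "c + d = cs K z a" using P[of 1 1] a0 by auto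
      then have "d = cs K (z - z3) a" unfolding cs_diff[symmetric] using z3 by (simp add: algebra_simps)
      then show ?thesis by blast
    next
      case False
      then obtain z where "d = cs K z b" using P[of 0 1] by auto
      then show ?thesis using b cs_cs[OF K(1)] by auto
    qed
    then show ?thesis using b z3 by blast
  qed
  show ?thesis
  proof (cases "a = 0")
    case True
    then have b0: "b \<noteq> 0" using ab by simp
    obtain z4 where z4: "d = cs K z4 b" using P[of 0 1] b0 by auto
    obtain z where "c + d = cs K z b" using P[of 1 1] b0 True by auto
    then have "c = cs K (z - z4) b" unfolding cs_diff[symmetric] using z4 by (simp add: algebra_simps)
    moreover have "a = cs K 0 b" "b = cs K 1 b" using True by simp_all
    ultimately show ?thesis using b0 z4 by blast
  next
    case a0: False
    show ?thesis
    proof (cases "\<exists>w. b = cs K w a")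
      case True
      moreover have "a = cs K 1 a" by simp
      ultimately show ?thesis using line a0 by blast
    next
      case False
      then have b0: "b \<noteq> 0" using cs_0(1) by metis
      have "a + b \<noteq> 0"
      proof
        assume "a + b = 0"
        then have "b = cs K (-1) a" by (simp add: cs_def eq_neg_iff_add_eq_0 add.commute)
        then show False using False by blast
      qed
      then obtain z3 where z3: "c + d = cs K z3 (a + b)" using P[of 1 1] by auto
      obtain z1 where z1: "c = cs K z1 a" using P[of 1 0] a0 by auto
      obtain z2 where z2: "d = cs K z2 b" using P[of 0 1] b0 by auto
      have eq: "cs K (z1 - z3) a = cs K (z3 - z2) b"
        using z3 z1 z2 unfolding cs_diff[symmetric] by (simp add: linear_add[OF cs_linear] algebra_simps)
      have "z3 = z2"
      proof (rule ccontr)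
        assume "z3 \<noteq> z2"
        then have "b = cs K (inverse (z3 - z2)) (cs K (z3 - z2) b)" by (simp add: cs_cs[OF K(2)])
        also have "\<dots> = cs K (inverse (z3 - z2) * (z1 - z3)) a" by (simp add: eq[symmetric] cs_cs[OF K(1)])
        finally show False using False by blast
      qed
      then have "z1 = z3" using eq cs_eq_0[OF K(1), of "z1 - z3"] a0 by auto
      then show ?thesis using z1 z2 \<open>z3 = z2\<close> by blast
    qed
  qed
qed

text \<open>The part of \<open>m\<close> orthogonal to \<open>n\<close> completes \<open>u\<close>,
  \<open>v\<close>, \<open>n\<close> to an orthogonal basis of the plane. That the Cayley form has
  absolute value 1 is the equality case of Cauchy-Schwarz between this direction and the triple
  product.\<close>

lemma cayley_plane_line:
  assumes P: "cayley_plane P" "u \<in> P" "v \<in> P" "n \<in> P" "m \<in> P"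
    and on: "norm u = 1" "norm v = 1" "u \<bullet> v = 0" "u \<bullet> n = 0" "v \<bullet> n = 0" "u \<bullet> m = 0" "v \<bullet> m = 0" "n \<noteq> 0"
  shows "\<exists>s t. m = s *\<^sub>R n + t *\<^sub>R tc u v n"
proof -
  define w where "w = sgn n"
  have w: "norm w = 1" "u \<bullet> w = 0" "v \<bullet> w = 0" "n = norm n *\<^sub>R w"
    using on by (simp_all add: w_def norm_sgn) (simp_all add: sgn_div_norm)
  define k where "k = m - (m \<bullet> w) *\<^sub>R w"
  have ww: "w \<bullet> w = 1" using w by (simp add: dot_square_norm)
  have k: "u \<bullet> k = 0" "v \<bullet> k = 0" "w \<bullet> k = 0"
    using on w by (simp_all add: k_def inner_diff_right ww inner_commute)
  have sub: "subspace P" using P(1) by (simp add: cayley_plane_def)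
  have wP: "w \<in> P" unfolding w_def sgn_div_norm using sub P(4) by (simp add: subspace_scale)
  have "\<exists>t. k = t *\<^sub>R tc u v w"
  proof (cases "k = 0")
    case True
    then show ?thesis by (intro exI[of _ 0]) simp
  next
    case False
    define l where "l = sgn k"
    have l: "norm l = 1" "u \<bullet> l = 0" "v \<bullet> l = 0" "w \<bullet> l = 0" "k = norm k *\<^sub>R l"
      using False k by (simp_all add: l_def norm_sgn) (simp_all add: sgn_div_norm)
    have lP: "l \<in> P"
      unfolding l_def sgn_div_norm k_def using sub P(5) wP by (simp add: subspace_scale subspace_diff)
    define x :: "4 \<Rightarrow> octonion" where "x i = (if i = 1 then u else if i = 2 then v else if i = 3 then w else l)" for i
    have "\<forall>i j. x i \<bullet> x j = (if i = j then 1 else 0)"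
      using on w l ww by (simp add: forall_4 x_def dot_square_norm inner_commute)
    moreover have "range x \<subseteq> P" using P wP lP by (auto simp: x_def)
    ultimately have "\<bar>cayley_form (x 1) (x 2) (x 3) (x 4)\<bar> = 1"
      using P(1) unfolding cayley_plane_def by blast
    then have c: "\<bar>tc u v w \<bullet> l\<bar> = 1" by (simp add: x_def tc_inner)
    define e where "e = tc u v w \<bullet> l"
    have ee: "e * e = 1" using c by (simp add: e_def abs_square_eq_1[symmetric] power2_eq_square)
    have "norm (tc u v w) = 1" using norm_tc[OF on(1-3) w(2,3)] w(1) by simp
    then have "tc u v w \<bullet> tc u v w = 1" "l \<bullet> l = 1" using l(1) by (simp_all add: dot_square_norm)
    moreover have "tc u v w \<bullet> l = e" "l \<bullet> tc u v w = e" by (simp_all add: e_def inner_commute)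
    \<comment> \<open>Two unit vectors with inner product \<open>e\<close>, where
      \<open>e * e = 1\<close>, agree up to the sign \<open>e\<close>.\<close>
    ultimately have "(l - e *\<^sub>R tc u v w) \<bullet> (l - e *\<^sub>R tc u v w) = 0"
      using ee by (simp add: inner_diff_left inner_diff_right)
    then have "l = e *\<^sub>R tc u v w" by simp
    then show ?thesis using l(5) by (metis scaleR_scaleR)
  qed
  then obtain t where t: "k = t *\<^sub>R tc u v w" by blast
  have "m = (m \<bullet> w) *\<^sub>R w + t *\<^sub>R tc u v w" using t by (simp add: k_def algebra_simps)
  also have "w = inverse (norm n) *\<^sub>R n" by (simp add: w_def sgn_div_norm)
  finally show ?thesis by (auto simp: tc_simps)
qed

text \<open>The failure of the pair \<open>(c, d)\<close> to be a complex multiple of \<open>(a, b)\<close>: the defect in the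
  Hermitian Cauchy-Schwarz inequality.\<close>

definition defect :: "real^8^8 \<Rightarrow> octonion \<Rightarrow> octonion \<Rightarrow> octonion \<Rightarrow> octonion \<Rightarrow> real" where
  "defect K a b c d = (a \<bullet> a + b \<bullet> b) * (c \<bullet> c + d \<bullet> d) - (a \<bullet> c + b \<bullet> d)\<^sup>2 - ((K *v a) \<bullet> c + (K *v b) \<bullet> d)\<^sup>2"

lemma defect_multiple:
  assumes "transpose K = - K" "K *v (K *v a) = - a" "K *v (K *v b) = - b"
  shows "defect K a b (cs K z a) (cs K z b) = 0"
proof -
  have "(K *v x) \<bullet> x = 0" "x \<bullet> (K *v x) = 0" "(K *v a) \<bullet> (K *v a) = a \<bullet> a" "(K *v b) \<bullet> (K *v b) = b \<bullet> b" for x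
    using skew_inner_self[OF assms(1)] skew_inner[OF assms(1), of a "K *v a"] skew_inner[OF assms(1), of b "K *v b"]
    by (simp_all add: assms(2,3) inner_commute[of "K *v x" x])
  then show ?thesis
    by (simp add: defect_def cs_def inner_add_left inner_add_right power2_eq_square algebra_simps)
qed

text \<open>\<open>s\<close> and \<open>t\<close> are the real and imaginary coefficient of the
  orthogonal projection of the pair \<open>c\<close>, \<open>d\<close> to the complex line of
  \<open>a\<close>, \<open>b\<close>. Vanishing of the defect says that the residual
  \<open>c'\<close>, \<open>d'\<close> has length 0.\<close>

lemma defect_eq_0:
  assumes K: "transpose K = - K" "K *v (K *v a) = - a" "K *v (K *v b) = - b"
    and 0: "defect K a b c d = 0" and ab: "a \<noteq> 0 \<or> b \<noteq> 0"
  shows "\<exists>z. c = cs K z a \<and> d = cs K z b"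
proof -
  have k: "(K *v x) \<bullet> x = 0" "x \<bullet> (K *v x) = 0" "(K *v a) \<bullet> (K *v a) = a \<bullet> a" "(K *v b) \<bullet> (K *v b) = b \<bullet> b" for x
    using skew_inner_self[OF K(1)] skew_inner[OF K(1), of a "K *v a"] skew_inner[OF K(1), of b "K *v b"]
    by (simp_all add: K(2,3) inner_commute[of "K *v x" x])
  define N where "N = a \<bullet> a + b \<bullet> b"
  define s where "s = (a \<bullet> c + b \<bullet> d) / N"
  define t where "t = ((K *v a) \<bullet> c + (K *v b) \<bullet> d) / N"
  have N: "N > 0" using ab by (auto simp: N_def add_pos_nonneg add_nonneg_pos)
  have sN: "a \<bullet> c + b \<bullet> d = s * N" "(K *v a) \<bullet> c + (K *v b) \<bullet> d = t * N"
    using N by (simp_all add: s_def t_def)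
  have "N * (c \<bullet> c + d \<bullet> d) = N * (s\<^sup>2 * N + t\<^sup>2 * N)"
    using 0 unfolding defect_def sN N_def[symmetric] by (simp add: power2_eq_square algebra_simps)
  then have cd: "c \<bullet> c + d \<bullet> d = s\<^sup>2 * N + t\<^sup>2 * N" using N by simp
  define c' where "c' = c - s *\<^sub>R a - t *\<^sub>R (K *v a)"
  define d' where "d' = d - s *\<^sub>R b - t *\<^sub>R (K *v b)"
  have "c' \<bullet> c' + d' \<bullet> d' = (c \<bullet> c + d \<bullet> d) - 2 * s * (a \<bullet> c + b \<bullet> d) - 2 * t * ((K *v a) \<bullet> c + (K *v b) \<bullet> d)
      + (s\<^sup>2 + t\<^sup>2) * N"
    by (simp add: c'_def d'_def inner_diff_left inner_diff_right k N_def power2_eq_square inner_commute algebra_simps)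
  also have "\<dots> = 0" unfolding cd sN by (simp add: power2_eq_square algebra_simps)
  finally have "c' \<bullet> c' + d' \<bullet> d' = 0" .
  then have "c' = 0" "d' = 0" by (simp_all add: add_nonneg_eq_0_iff)
  then show ?thesis
    by (intro exI[of _ "Complex s t"]) (simp add: cs_def c'_def d'_def algebra_simps)
qed

text \<open>\<open>P1\<close> and \<open>P2\<close> stand for the partial derivatives of the
  projection \<open>Pi\<close>. Since they commute with complex scalars at \<open>q\<close>, the two
  equations form a complex linear system for \<open>P1 *v q\<close> and \<open>P2 *v q\<close> with
  nonzero determinant. So each kills the image of \<open>Pi\<close>; by symmetry both products with
  \<open>Pi\<close> vanish, and their sum is the derivative itself.\<close>

lemma planar_algebra:
  fixes K Pi P1 P2 :: "real^8^8"
  assumes Pi: "\<And>x. Pi *v x \<in> span {e1, e2, q, K *v q}"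
    and sym: "transpose Pi = Pi" "transpose P1 = P1" "transpose P2 = P2"
    and PP: "P1 ** Pi + Pi ** P1 = P1" "P2 ** Pi + Pi ** P2 = P2"
    and e: "P1 *v e1 = 0" "P1 *v e2 = 0" "P2 *v e1 = 0" "P2 *v e2 = 0"
    and Kq: "P1 *v (K *v q) = K *v (P1 *v q)" "P2 *v (K *v q) = K *v (P2 *v q)"
    and KK: "K *v (K *v (P1 *v q)) = - (P1 *v q)" "K *v (K *v (P2 *v q)) = - (P2 *v q)"
    and eq: "P2 *v cs K z11 q = P1 *v cs K z21 q" "P2 *v cs K z12 q = P1 *v cs K z22 q"
    and D: "z11 * z22 - z12 * z21 \<noteq> 0"
  shows "P1 = 0" "P2 = 0"
proof -
  have c: "P1 *v cs K z q = cs K z (P1 *v q)" "P2 *v cs K z q = cs K z (P2 *v q)" for z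
    by (simp_all add: cs_def mv_simps Kq)
  have eq': "cs K z11 (P2 *v q) = cs K z21 (P1 *v q)" "cs K z12 (P2 *v q) = cs K z22 (P1 *v q)"
    using eq by (simp_all add: c)
  have "cs K (z22 * z11) (P2 *v q) = cs K z22 (cs K z21 (P1 *v q))"
    by (simp add: eq'(1)[symmetric] cs_cs KK)
  also have "\<dots> = cs K z21 (cs K z12 (P2 *v q))" by (simp add: eq' cs_cs KK mult.commute)
  finally have "cs K (z11 * z22 - z12 * z21) (P2 *v q) = 0"
    by (simp add: cs_diff[symmetric] cs_cs KK mult.commute)
  then have q2: "P2 *v q = 0" using cs_eq_0[OF KK(2)] D by blast
  have "cs K (z12 * z21) (P1 *v q) = cs K z12 (cs K z11 (P2 *v q))"
    by (simp add: eq'(1) cs_cs KK)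
  also have "\<dots> = cs K z11 (cs K z22 (P1 *v q))"
    by (simp add: eq'(2)[symmetric] cs_cs KK mult.commute)
  finally have "cs K (z11 * z22 - z12 * z21) (P1 *v q) = 0"
    by (simp add: cs_diff[symmetric] cs_cs KK mult.commute)
  then have q1: "P1 *v q = 0" using cs_eq_0[OF KK(1)] D by blast
  have zero: "P = 0" if P: "P *v e1 = 0" "P *v e2 = 0" "P *v q = 0" "P *v (K *v q) = 0"
    "transpose P = P" "P ** Pi + Pi ** P = P" for P
  proof -
    have "subspace {x. P *v x = 0}" by (auto simp: subspace_def mv_simps)
    then have "span {e1, e2, q, K *v q} \<subseteq> {x. P *v x = 0}" using P by (intro span_minimal) auto
    then have "P *v (Pi *v x) = 0" for x using Pi by blast
    then have 1: "P ** Pi = 0" by (simp add: matrix_eq mv_simps)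
    then have "transpose (P ** Pi) = 0" by (simp add: transpose_def vec_eq_iff)
    then have "Pi ** P = 0" by (simp add: matrix_transpose_mul P sym)
    then show ?thesis using P(6) 1 by simp
  qed
  show "P1 = 0" using zero[OF e(1,2) q1 _ sym(2) PP(1)] Kq q1 by simp
  show "P2 = 0" using zero[OF e(3,4) q2 _ sym(3) PP(2)] Kq q2 by simp
qed

section \<open>Projections to a varying Cayley plane\<close>

lemma has_derivative_unique_on_open:
  assumes "(f has_derivative f') (at x)" "(g has_derivative g') (at x)" "open S" "x \<in> S" "\<And>y. y \<in> S \<Longrightarrow> f y = g y"
  shows "f' h = g' h"
proof -
  have "(g has_derivative f') (at x)"
    by (rule has_derivative_transform_within_open[OF assms(1,3,4)]) (rule assms(5))
  then show ?thesis using has_derivative_unique[OF _ assms(2)] by metis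
qed

lemma tc_cycle: "tc b c a = tc a b c"
  using tc_swap(1)[of a b c] tc_swap(2)[of b a c] by simp

lemma tc_tc_scaled:
  assumes "norm v = 1" "v \<bullet> n = 0" "v \<bullet> x = 0" "n \<bullet> x = 0"
  shows "tc v n (tc v n x) = - ((n \<bullet> n) *\<^sub>R x)"
proof (cases "n = 0")
  case False
  then have 1: "norm (sgn n) = 1" "v \<bullet> sgn n = 0" using assms by (simp_all add: norm_sgn) (simp add: sgn_div_norm)
  have "sgn n \<bullet> x = 0" using assms by (simp add: sgn_div_norm)
  then have "tc v (sgn n) (tc v (sgn n) x) = - x" using tc_tc[OF assms(1) 1] assms by simp
  moreover have n: "n = norm n *\<^sub>R sgn n" using False by (simp add: sgn_div_norm)
  have "tc v n y = norm n *\<^sub>R tc v (sgn n) y" for y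
    using arg_cong[OF n, of "\<lambda>m. tc v m y"] by (simp only: tc_simps)
  ultimately have "tc v n (tc v n x) = - ((norm n * norm n) *\<^sub>R x)" by (simp add: tc_simps)
  then show ?thesis by (simp add: dot_square_norm power2_eq_square)
qed (simp add: tc_simps)

text \<open>Triple products of vectors in the Cayley plane of \<open>u\<close>, \<open>v\<close>,
  \<open>n\<close> stay in it. These two values are needed when K_E is differentiated and applied to
  \<open>n\<close>.\<close>

lemma tc_closed:
  assumes "norm u = 1" "norm v = 1" "u \<bullet> v = 0" "u \<bullet> n = 0" "v \<bullet> n = 0"
  shows "tc (tc u v n) v n = - ((n \<bullet> n) *\<^sub>R u)" "tc u (tc u v n) n = - ((n \<bullet> n) *\<^sub>R v)"
proof -
  have "tc (tc u v n) v n = tc v n (tc v n u)" by (metis tc_cycle)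
  also have "\<dots> = - ((n \<bullet> n) *\<^sub>R u)"
    using assms by (intro tc_tc_scaled) (simp_all add: inner_commute)
  finally show "tc (tc u v n) v n = - ((n \<bullet> n) *\<^sub>R u)" .
  have "tc u (tc u v n) n = tc u n (tc u n v)"
    using tc_swap(2)[of u n "tc u v n"] tc_swap(2)[of u n v] by (simp add: tc_simps)
  also have "\<dots> = - ((n \<bullet> n) *\<^sub>R v)"
    using assms by (intro tc_tc_scaled) (simp_all add: inner_commute)
  finally show "tc u (tc u v n) n = - ((n \<bullet> n) *\<^sub>R v)" .
qed

definition outer :: "octonion \<Rightarrow> octonion \<Rightarrow> real^8^8" where
  "outer u v = (\<chi> i j. u$i * v$j)"

lemma outer_mult: "outer u v *v x = (v \<bullet> x) *\<^sub>R u"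
  by (simp add: outer_def matrix_vector_mult_def vec_eq_iff inner_vec_def sum_distrib_left mult_ac)

lemma transpose_outer: "transpose (outer u v) = outer v u"
  by (simp add: outer_def transpose_def vec_eq_iff mult.commute)

lemma smooth_on_outer: "open S \<Longrightarrow> smooth_on S f \<Longrightarrow> smooth_on S g \<Longrightarrow> smooth_on S (\<lambda>x. outer (f x) (g x))"
  unfolding outer_def by (intro smooth_on_vec_lambda smooth_on_mult smooth_on_vec_nth)

text \<open>The orthogonal projection to the Cayley plane. \<open>n\<close> is not normalized; for
  \<open>n\<close> orthogonal to \<open>u\<close>, \<open>v\<close> it has the same length as its
  triple product, so one factor corrects both terms.\<close>

definition cproj :: "octonion \<Rightarrow> octonion \<Rightarrow> octonion \<Rightarrow> real^8^8" where
  "cproj u v n = outer u u + outer v v + inverse (n \<bullet> n) *\<^sub>R (outer n n + outer (tc u v n) (tc u v n))"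

lemma cproj:
  assumes on: "norm u = 1" "norm v = 1" "u \<bullet> v = 0" "u \<bullet> n = 0" "v \<bullet> n = 0" "n \<noteq> 0"
  shows "\<And>x. x \<in> span {u, v, n, tc u v n} \<Longrightarrow> cproj u v n *v x = x"
    and "\<And>x. cproj u v n *v x \<in> span {u, v, n, tc u v n}"
    and "transpose (cproj u v n) = cproj u v n" "cproj u v n ** cproj u v n = cproj u v n"
    and "cproj u v n ** Kop (wedge u v) = Kop (wedge u v) ** cproj u v n"
proof -
  let ?w = "tc u v n"
  have ip: "u \<bullet> u = 1" "v \<bullet> v = 1" "v \<bullet> u = 0" "n \<bullet> u = 0" "n \<bullet> v = 0" "n \<bullet> n \<noteq> 0" "?w \<bullet> ?w = n \<bullet> n"
    using on norm_tc[OF on(1-5)] by (simp_all add: inner_commute dot_square_norm)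
  have C: "cproj u v n *v x = (u \<bullet> x) *\<^sub>R u + (v \<bullet> x) *\<^sub>R v + (inverse (n \<bullet> n) * (n \<bullet> x)) *\<^sub>R n
      + (inverse (n \<bullet> n) * (?w \<bullet> x)) *\<^sub>R ?w" for x
    by (simp add: cproj_def mv_simps outer_mult scaleR_add_right)
  have "subspace {x. cproj u v n *v x = x}" by (auto simp: subspace_def mv_simps)
  moreover have "{u, v, n, ?w} \<subseteq> {x. cproj u v n *v x = x}"
    using ip on by (simp add: C tc_perp)
  ultimately have "span {u, v, n, ?w} \<subseteq> {x. cproj u v n *v x = x}" by (rule span_minimal[rotated])
  then show fix': "cproj u v n *v x = x" if "x \<in> span {u, v, n, ?w}" for x using that by blast
  show mem: "cproj u v n *v x \<in> span {u, v, n, ?w}" for x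
    unfolding C by (intro span_add span_scale span_base) auto
  show "cproj u v n ** cproj u v n = cproj u v n"
    unfolding matrix_eq by (simp add: mv_simps fix'[OF mem])
  have "transpose (A + B) = transpose A + transpose B" "transpose (r *\<^sub>R A) = r *\<^sub>R transpose A" for A B :: "real^8^8" and r
    by (simp_all add: transpose_def vec_eq_iff)
  then show "transpose (cproj u v n) = cproj u v n" by (simp add: cproj_def transpose_outer)
  have s: "n \<bullet> tc u v x = - (?w \<bullet> x)" for x by (simp add: tc_inner_cycle)
  have t: "?w \<bullet> tc u v x = n \<bullet> x" for x
    unfolding tc_inner_cycle[of u v n] tc_tc[OF on(1-3)] using ip by (simp add: inner_add_right inner_diff_right)
  have w: "tc u v ?w = - n" using tc_tc[OF on(1-3), of n] on by simp
  show "cproj u v n ** Kop (wedge u v) = Kop (wedge u v) ** cproj u v n"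
    unfolding matrix_eq by (simp add: mv_simps Kop_wedge C tc_perp tc_simps tc_refl s t w)
qed

lemma smooth_on_cproj:
  assumes "open S" "smooth_on S u" "smooth_on S v" "smooth_on S n" "\<And>y. y \<in> S \<Longrightarrow> n y \<noteq> 0"
  shows "smooth_on S (\<lambda>y. cproj (u y) (v y) (n y))"
  unfolding cproj_def
  by (intro smooth_on_add smooth_on_scaleR smooth_on_inverse smooth_on_inner smooth_on_outer smooth_on_tc assms(1-4))
    (simp add: assms(5))

text \<open>The derivative of the bivector sees the derivative of a frame only modulo the plane,
  since rotating the frame does not move the plane.\<close>

lemma wedge_derivative_components:
  assumes "u \<bullet> u = 1" "v \<bullet> v = 1" "u \<bullet> v = 0" and X: "X = wedge p v + wedge u r"
  shows "\<exists>s t. p = X *v v + s *\<^sub>R u + t *\<^sub>R v" "\<exists>s t. r = - (X *v u) + s *\<^sub>R u + t *\<^sub>R v"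
proof -
  have "p = X *v v + (- (r \<bullet> v)) *\<^sub>R u + (p \<bullet> v) *\<^sub>R v"
    using assms by (simp add: X mv_simps wedge_mult)
  then show "\<exists>s t. p = X *v v + s *\<^sub>R u + t *\<^sub>R v" by blast
  have "r = - (X *v u) + (r \<bullet> u) *\<^sub>R u + (- (p \<bullet> u)) *\<^sub>R v"
    using assms by (simp add: X mv_simps wedge_mult inner_commute[of v u])
  then show "\<exists>s t. r = - (X *v u) + s *\<^sub>R u + t *\<^sub>R v" by blast
qed

text \<open>The rank-one case of the pencil: the derivative of the plane stays in the Cayley plane spanned by the plane
  and one complex direction, and then the projection to this Cayley plane is constant.\<close>

lemma cproj_derivative_0:
  fixes f1 f2 n :: "real^2 \<Rightarrow> octonion"
  defines "g \<equiv> \<lambda>y. wedge (f1 y) (f2 y)"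
  defines "X \<equiv> \<lambda>k y. frechet_derivative g (at y) (axis k 1)"
  defines "K \<equiv> \<lambda>y. Kop (g y)"
  assumes S: "open S" and sm: "smooth_on S f1" "smooth_on S f2" "smooth_on S n"
    and on: "\<And>y. y \<in> S \<Longrightarrow> norm (f1 y) = 1 \<and> norm (f2 y) = 1 \<and> f1 y \<bullet> f2 y = 0 \<and> f1 y \<bullet> n y = 0 \<and> f2 y \<bullet> n y = 0 \<and> n y \<noteq> 0"
    and z: "\<And>y. y \<in> S \<Longrightarrow> \<exists>z11 z12 z21 z22. X 1 y *v f2 y = cs (K y) z11 (n y) \<and> - (X 1 y *v f1 y) = cs (K y) z12 (n y) \<and>
        X 2 y *v f2 y = cs (K y) z21 (n y) \<and> - (X 2 y *v f1 y) = cs (K y) z22 (n y) \<and> z11 * z22 - z12 * z21 \<noteq> 0"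
    and y: "y \<in> S"
  shows "((\<lambda>y. cproj (f1 y) (f2 y) (n y)) has_derivative (\<lambda>h. 0)) (at y)"
proof -
  define Pi where "Pi = (\<lambda>y. cproj (f1 y) (f2 y) (n y))"
  define P where "P y = span {f1 y, f2 y, n y, tc (f1 y) (f2 y) (n y)}" for y
  define D where "D k y = frechet_derivative Pi (at y) (axis k 1)" for k y
  have sPi: "smooth_on S Pi" unfolding Pi_def using on by (intro smooth_on_cproj S sm) blast
  have sg: "smooth_on S g" unfolding g_def by (intro smooth_on_wedge S sm)
  have pr: "Pi y *v x \<in> P y" "transpose (Pi y) = Pi y" "Pi y ** Pi y = Pi y" "Pi y ** K y = K y ** Pi y"
    "x \<in> P y \<Longrightarrow> Pi y *v x = x" if "y \<in> S" for y x
    using cproj[of "f1 y" "f2 y" "n y"] on[OF that] unfolding Pi_def P_def K_def g_def by auto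
  have dPi: "(Pi has_derivative frechet_derivative Pi (at y)) (at y)" by (rule smooth_on_has_derivative[OF sPi y])
  have onS: "f1 y \<bullet> f1 y = 1" "f2 y \<bullet> f2 y = 1" "f1 y \<bullet> f2 y = 0" if "y \<in> S" for y
    using on[OF that] by (simp_all add: dot_square_norm)
  note on' = on[OF y]
  \<comment> \<open>The projection is symmetric, idempotent and commutes with \<open>K\<close> on
    all of \<open>S\<close>, so these three identities may be differentiated.\<close>
  note Dsym = has_derivative_unique_on_open[OF bounded_linear.has_derivative[OF bounded_linear_transpose dPi] dPi S y pr(2)]
  note Didem = has_derivative_unique_on_open[OF bounded_bilinear.FDERIV[OF bounded_bilinear_matrix_mult dPi dPi] dPi S y pr(3)]
  have dK: "(K has_derivative (\<lambda>h. Kop (frechet_derivative g (at y) h))) (at y)"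
    unfolding K_def
    by (rule bounded_linear.has_derivative[OF linear_conv_bounded_linear[THEN iffD1, OF linear_Kop] smooth_on_has_derivative[OF sg y]])
  note DK = has_derivative_unique_on_open[OF bounded_bilinear.FDERIV[OF bounded_bilinear_matrix_mult dPi dK]
      bounded_bilinear.FDERIV[OF bounded_bilinear_matrix_mult dK dPi] S y pr(4)]
  have Xk: "X k y' = wedge (frechet_derivative f1 (at y') (axis k 1)) (f2 y') + wedge (f1 y') (frechet_derivative f2 (at y') (axis k 1))"
    if "y' \<in> S" for k y'
  proof -
    have "(g has_derivative (\<lambda>h. wedge (f1 y') (frechet_derivative f2 (at y') h) + wedge (frechet_derivative f1 (at y') h) (f2 y'))) (at y')"
      unfolding g_def
      by (intro bounded_bilinear.FDERIV[OF bounded_bilinear_wedge] smooth_on_has_derivative[OF sm(1) that] smooth_on_has_derivative[OF sm(2) that])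
    from fun_cong[OF frechet_derivative_at[OF this], of "axis k 1"]
    show ?thesis unfolding X_def by (simp only: add.commute)
  qed
  have csP: "cs (K y') z (n y') \<in> P y'" for z y'
    unfolding cs_def P_def K_def g_def Kop_wedge by (intro span_add span_scale span_base) auto
  have comp: "\<exists>s t. frechet_derivative f1 (at y') (axis k 1) = X k y' *v f2 y' + s *\<^sub>R f1 y' + t *\<^sub>R f2 y'"
    "\<exists>s t. frechet_derivative f2 (at y') (axis k 1) = - (X k y' *v f1 y') + s *\<^sub>R f1 y' + t *\<^sub>R f2 y'" if "y' \<in> S" for k y'
    using wedge_derivative_components[OF onS[OF that] Xk[OF that]] by blast+
  have XP: "X k y' *v f2 y' \<in> P y'" "- (X k y' *v f1 y') \<in> P y'" if "y' \<in> S" for k :: 2 and y'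
  proof -
    have "X 1 y' *v f2 y' \<in> P y'" "- (X 1 y' *v f1 y') \<in> P y'" "X 2 y' *v f2 y' \<in> P y'" "- (X 2 y' *v f1 y') \<in> P y'"
      using z[OF that] csP by metis+
    then show "X k y' *v f2 y' \<in> P y'" "- (X k y' *v f1 y') \<in> P y'" using exhaust_2[of k] by auto
  qed
  have fP: "f1 y' \<in> P y'" "f2 y' \<in> P y'" "n y' \<in> P y'" for y' by (auto simp: P_def intro: span_base)
  have dfP: "frechet_derivative f1 (at y') (axis k 1) \<in> P y'" "frechet_derivative f2 (at y') (axis k 1) \<in> P y'" if "y' \<in> S" for k y'
    using comp[OF that] XP[OF that] fP unfolding P_def by (metis span_add span_scale)+
  have Pif: "Pi y' *v f1 y' = f1 y'" "Pi y' *v f2 y' = f2 y'" if "y' \<in> S" for y' using pr(5)[OF that] fP by auto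
  have Df: "D k y *v f1 y = 0" "D k y *v f2 y = 0" for k
  proof -
    have "Pi y *v frechet_derivative f (at y) h + frechet_derivative Pi (at y) h *v f y = frechet_derivative f (at y) h"
      if "smooth_on S f" "\<And>y'. y' \<in> S \<Longrightarrow> Pi y' *v f y' = f y'" for f h
      using has_derivative_unique_on_open[OF bounded_bilinear.FDERIV[OF bounded_bilinear_matrix_vector_mult dPi
            smooth_on_has_derivative[OF that(1) y]] smooth_on_has_derivative[OF that(1) y] S y that(2)] .
    from this[OF sm(1) Pif(1), of "axis k 1"] this[OF sm(2) Pif(2), of "axis k 1"]
    show "D k y *v f1 y = 0" "D k y *v f2 y = 0" using pr(5)[OF y dfP(1)[OF y]] pr(5)[OF y dfP(2)[OF y]] by (auto simp: D_def)
  qed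
  \<comment> \<open>On \<open>S\<close> the projection fixes the partial derivatives of
    \<open>f\<close>. Differentiating this along the other axis and comparing the two orders cancels
    the second derivatives of \<open>f\<close>.\<close>
  have mixed: "D 2 y *v frechet_derivative f (at y) (axis 1 1) = D 1 y *v frechet_derivative f (at y) (axis 2 1)"
    if f: "smooth_on S f" "\<And>k y'. y' \<in> S \<Longrightarrow> frechet_derivative f (at y') (axis k 1) \<in> P y'" for f
  proof -
    have 2: "Pi y *v frechet_derivative (\<lambda>y. frechet_derivative f (at y) (axis k 1)) (at y) h +
        frechet_derivative Pi (at y) h *v frechet_derivative f (at y) (axis k 1) =
        frechet_derivative (\<lambda>y. frechet_derivative f (at y) (axis k 1)) (at y) h" for k h
      by (rule has_derivative_unique_on_open[OF bounded_bilinear.FDERIV[OF bounded_bilinear_matrix_vector_mult dPi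
            smooth_on_has_derivative[OF smooth_on_frechet_derivative[OF f(1)] y]]
            smooth_on_has_derivative[OF smooth_on_frechet_derivative[OF f(1)] y] S y pr(5)[OF _ f(2)]])
    show ?thesis
      using 2[of 1 "axis 2 1"] 2[of 2 "axis 1 1"] symmetric_second_derivative[OF f(1) S y, of "axis 1 1" "axis 2 1"]
      by (simp add: D_def) (metis add_left_cancel)
  qed
  have D2: "D 2 y *v (X 1 y *v f2 y) = D 1 y *v (X 2 y *v f2 y)" "D 2 y *v (- (X 1 y *v f1 y)) = D 1 y *v (- (X 2 y *v f1 y))"
  proof -
    have c: "D l y *v frechet_derivative f1 (at y) (axis k 1) = D l y *v (X k y *v f2 y)"
      "D l y *v frechet_derivative f2 (at y) (axis k 1) = D l y *v (- (X k y *v f1 y))" for k l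
      using comp[OF y, of k] by (auto simp: mv_simps Df)
    show "D 2 y *v (X 1 y *v f2 y) = D 1 y *v (X 2 y *v f2 y)" "D 2 y *v (- (X 1 y *v f1 y)) = D 1 y *v (- (X 2 y *v f1 y))"
      using mixed[OF sm(1) dfP(1)] mixed[OF sm(2) dfP(2)] unfolding c by blast+
  qed
  obtain z11 z12 z21 z22 where zz: "X 1 y *v f2 y = cs (K y) z11 (n y)" "- (X 1 y *v f1 y) = cs (K y) z12 (n y)"
      "X 2 y *v f2 y = cs (K y) z21 (n y)" "- (X 2 y *v f1 y) = cs (K y) z22 (n y)" "z11 * z22 - z12 * z21 \<noteq> 0"
    using z[OF y] by blast
  have Kn: "K y *v x = tc (f1 y) (f2 y) x" for x by (simp add: K_def g_def Kop_wedge)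
  \<comment> \<open>By linearity of \<open>Kop\<close> this is the derivative of \<open>K\<close>
    applied to \<open>n\<close>. The tangent vector is built from the complex line of
    \<open>n\<close>, so \<open>tc_closed\<close> puts the value in the span of \<open>f1\<close>
    and \<open>f2\<close>.\<close>
  have KX: "Kop (X k y) *v n y \<in> P y" for k
  proof -
    have gT: "g y' \<in> G2O" if "y' \<in> S" for y' using on[OF that] by (simp add: g_def G2O_I)
    have "X k y \<in> TG2O (g y)"
      unfolding X_def by (rule TG2O_of_derivative[OF smooth_on_has_derivative[OF sg y] S y gT])
    then have "X k y = wedge (X k y *v f2 y) (f2 y) + wedge (f1 y) (- (X k y *v f1 y))"
      using TG2O_D(1)[of "f1 y" "f2 y" "X k y"] on' by (simp add: g_def)
    moreover obtain w w' where "X k y *v f2 y = cs (K y) w (n y)" "- (X k y *v f1 y) = cs (K y) w' (n y)"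
      using zz exhaust_2[of k] by metis
    ultimately have Xeq: "X k y = wedge (cs (K y) w (n y)) (f2 y) + wedge (f1 y) (cs (K y) w' (n y))" by simp
    have "Kop (X k y) *v n y = tc (cs (K y) w (n y)) (f2 y) (n y) + tc (f1 y) (cs (K y) w' (n y)) (n y)"
      by (simp add: Xeq linear_add[OF linear_Kop] mv_simps Kop_wedge)
    also have "\<dots> = (- Im w * (n y \<bullet> n y)) *\<^sub>R f1 y + (- Im w' * (n y \<bullet> n y)) *\<^sub>R f2 y"
      using on' by (simp add: cs_def Kn tc_simps tc_refl tc_closed)
    finally show ?thesis unfolding P_def by (simp add: span_add span_scale span_base span_neg span_diff)
  qed
  \<comment> \<open>The projection fixes both \<open>n y\<close> and the derivative of
    \<open>K\<close> applied to it, so the terms with that derivative cancel.\<close>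
  have Kq: "D k y *v (K y *v n y) = K y *v (D k y *v n y)" for k
  proof -
    have "(Pi y ** Kop (X k y) + D k y ** K y) *v n y = (K y ** D k y + Kop (X k y) ** Pi y) *v n y"
      using DK[of "axis k 1"] by (simp add: X_def D_def)
    then show ?thesis by (simp add: mv_simps pr(5)[OF y KX] pr(5)[OF y fP(3)])
  qed
  have PD: "D k y ** Pi y + Pi y ** D k y = D k y" for k
    using Didem[of "axis k 1"] by (simp add: D_def add.commute)
  \<comment> \<open>The derivative of an idempotent maps its image to its kernel. So
    \<open>D k y *v n y\<close> is orthogonal to the plane, where \<open>K\<close> squares to
    -1.\<close>
  have KK: "K y *v (K y *v (D k y *v n y)) = - (D k y *v n y)" for k
  proof -
    have "(D k y ** Pi y + Pi y ** D k y) *v n y = D k y *v n y" by (simp add: PD)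
    then have "Pi y *v (D k y *v n y) = 0" by (simp add: mv_simps pr(5)[OF y fP(3)])
    then have "(Pi y *v f) \<bullet> (D k y *v n y) = 0" for f
      unfolding inner_transpose_matrix pr(2)[OF y] by simp
    from this[of "f1 y"] this[of "f2 y"] have "f1 y \<bullet> (D k y *v n y) = 0" "f2 y \<bullet> (D k y *v n y) = 0"
      by (simp_all add: Pif[OF y])
    then show ?thesis using on' by (simp add: Kn tc_tc)
  qed
  have sym: "transpose (D k y) = D k y" for k using Dsym by (simp add: D_def)
  have mem: "Pi y *v x \<in> span {f1 y, f2 y, n y, K y *v n y}" for x
    using pr(1)[OF y] by (simp add: P_def Kn)
  have "D 1 y = 0" "D 2 y = 0"
    by (rule planar_algebra[OF mem pr(2)[OF y] sym sym PD PD Df(1) Df(2) Df(1) Df(2) Kq Kq KK KK D2[unfolded zz(1-4)] zz(5)])+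
  then have "frechet_derivative Pi (at y) h = 0" for h
  proof -
    have h: "h = (h$1) *\<^sub>R axis 1 1 + (h$2) *\<^sub>R axis 2 1" by (simp add: vec_eq_iff forall_2 axis_def)
    have lin: "linear (frechet_derivative Pi (at y))" using dPi has_derivative_linear by blast
    have "frechet_derivative Pi (at y) h = (h$1) *\<^sub>R D 1 y + (h$2) *\<^sub>R D 2 y"
      unfolding D_def linear_cmul[OF lin, symmetric] linear_add[OF lin, symmetric] using h by simp
    then show ?thesis using \<open>D 1 y = 0\<close> \<open>D 2 y = 0\<close> by simp
  qed
  then have "frechet_derivative Pi (at y) = (\<lambda>h. 0)" by blast
  then show ?thesis using dPi unfolding Pi_def by simp
qed

lemma cs_multiple:
  assumes K: "K *v (K *v p) = - p" and q: "q = cs K w p" "q \<noteq> 0" and x: "x = cs K z p"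
  shows "x = cs K (z / w) q"
proof -
  have "w \<noteq> 0" using q by auto
  then show ?thesis by (simp add: x q(1) cs_cs[OF K])
qed

text \<open>Complex independence at \<open>y0\<close> is nonvanishing of the defect, an open
  condition, so the rank-one alternative of \<open>pencil\<close> persists near \<open>y0\<close>.
  The projection to the resulting Cayley plane then has derivative 0 on a ball, and the planes over
  the ball lie in its fixed image.\<close>

lemma locally_planar:
  fixes f1 f2 :: "real^2 \<Rightarrow> octonion"
  defines "g \<equiv> \<lambda>y. wedge (f1 y) (f2 y)"
  defines "X \<equiv> \<lambda>k y. frechet_derivative g (at y) (axis k 1)"
  defines "K \<equiv> \<lambda>y. Kop (g y)"
  assumes S: "open S" and sm: "smooth_on S f1" "smooth_on S f2"
    and on: "\<And>y. y \<in> S \<Longrightarrow> norm (f1 y) = 1 \<and> norm (f2 y) = 1 \<and> f1 y \<bullet> f2 y = 0"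
    and im: "\<And>y. y \<in> S \<Longrightarrow> X 1 y \<noteq> 0"
    and pc: "\<And>y r s. y \<in> S \<Longrightarrow> r *\<^sub>R (X 1 y *v f2 y) + s *\<^sub>R (- (X 1 y *v f1 y)) \<noteq> 0 \<Longrightarrow>
      \<exists>z. r *\<^sub>R (X 2 y *v f2 y) + s *\<^sub>R (- (X 2 y *v f1 y)) = cs (K y) z (r *\<^sub>R (X 1 y *v f2 y) + s *\<^sub>R (- (X 1 y *v f1 y)))"
    and y0: "y0 \<in> S"
    and nh: "\<And>z. X 2 y0 *v f2 y0 = cs (K y0) z (X 1 y0 *v f2 y0) \<Longrightarrow> - (X 2 y0 *v f1 y0) = cs (K y0) z (- (X 1 y0 *v f1 y0)) \<Longrightarrow> False"
  shows "\<exists>e>0. \<exists>P. cayley_plane P \<and> ball y0 e \<subseteq> S \<and> (\<forall>y\<in>ball y0 e. span {f1 y, f2 y} \<subseteq> P)"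
proof -
  define a b c d where "a y = X 1 y *v f2 y" and "b y = - (X 1 y *v f1 y)" and "c y = X 2 y *v f2 y" and "d y = - (X 2 y *v f1 y)" for y
  note abcd = a_def[symmetric] b_def[symmetric] c_def[symmetric] d_def[symmetric]
  have sg: "smooth_on S g" unfolding g_def by (intro smooth_on_wedge S sm)
  have gG: "g y \<in> G2O" if "y \<in> S" for y using on[OF that] by (simp add: g_def G2O_I)
  have sX: "smooth_on S (X k)" for k unfolding X_def by (rule smooth_on_frechet_derivative[OF sg])
  have sabcd: "smooth_on S a" "smooth_on S b" "smooth_on S c" "smooth_on S d"
    unfolding a_def b_def c_def d_def by (intro smooth_on_minus smooth_on_matrix_vector_mult S sX sm)+
  have sK: "smooth_on S K" unfolding K_def by (rule smooth_on_linear[OF linear_Kop S sg])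
  have XT: "X k y \<in> TG2O (wedge (f1 y) (f2 y))" if "y \<in> S" for k y
    using TG2O_of_derivative[OF smooth_on_has_derivative[OF sg that] S that gG] unfolding X_def g_def by blast
  have Xd: "X 1 y = wedge (a y) (f2 y) + wedge (f1 y) (b y)"
    "f1 y \<bullet> a y = 0" "f2 y \<bullet> a y = 0" "f1 y \<bullet> b y = 0" "f2 y \<bullet> b y = 0"
    "f1 y \<bullet> c y = 0" "f2 y \<bullet> c y = 0" "f1 y \<bullet> d y = 0" "f2 y \<bullet> d y = 0" if "y \<in> S" for y
    using TG2O_D[OF _ _ _ XT[OF that, of 1]] TG2O_D[OF _ _ _ XT[OF that, of 2]] on[OF that]
    unfolding a_def b_def c_def d_def by (simp_all add: inner_commute)
  have ab: "a y \<noteq> 0 \<or> b y \<noteq> 0" if "y \<in> S" for y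
  proof (rule ccontr)
    assume "\<not> (a y \<noteq> 0 \<or> b y \<noteq> 0)"
    then have "X 1 y = 0" unfolding Xd(1)[OF that] by (simp add: wedge_def vec_eq_iff)
    then show False using im[OF that] by blast
  qed
  have Kx: "K y *v x = tc (f1 y) (f2 y) x" for x y by (simp add: K_def g_def Kop_wedge)
  have KK: "K y *v (K y *v x) = - x" if "y \<in> S" "f1 y \<bullet> x = 0" "f2 y \<bullet> x = 0" for x y
    using on[OF that(1)] that(2,3) by (simp add: Kx tc_tc)
  have skK: "transpose (K y) = - K y" for y by (simp add: K_def g_def transpose_Kop_wedge)
  note KK' = KK[OF _ Xd(2,3)] KK[OF _ Xd(4,5)] KK[OF _ Xd(6,7)] KK[OF _ Xd(8,9)]
  have pen: "(\<exists>z. c y = cs (K y) z (a y) \<and> d y = cs (K y) z (b y)) \<or> (\<exists>p z1 z2 z3 z4. p \<in> {a y, b y} \<and> p \<noteq> 0 \<and>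
    a y = cs (K y) z1 p \<and> b y = cs (K y) z2 p \<and> c y = cs (K y) z3 p \<and> d y = cs (K y) z4 p)" if y: "y \<in> S" for y
    by (rule pencil) (use y KK' ab pc[OF y] in \<open>auto simp: abcd\<close>)
  define df where "df y = defect (K y) (a y) (b y) (c y) (d y)" for y
  have sdf: "smooth_on S df"
    unfolding df_def defect_def power2_eq_square
    by (intro smooth_on_diff smooth_on_mult smooth_on_add smooth_on_inner smooth_on_matrix_vector_mult S sabcd sK)
  have nh': "\<not> (\<exists>z. c y0 = cs (K y0) z (a y0) \<and> d y0 = cs (K y0) z (b y0))"
    using nh unfolding abcd by blast
  then have df0: "df y0 \<noteq> 0"
    using defect_eq_0[OF skK KK'(1,2)[OF y0 y0 y0] _ ab[OF y0]] y0 unfolding df_def by blast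
  \<comment> \<open>The generator supplied by \<open>pencil\<close> may jump with \<open>y\<close>.
    Fixing the function \<open>a\<close> or \<open>b\<close>, whichever is nonzero at
    \<open>y0\<close>, gives a smooth generator of the complex line.\<close>
  obtain n where n: "n = a \<or> n = b" "n y0 \<noteq> 0" using ab[OF y0] by blast
  have sn: "smooth_on S n" using n(1) sabcd by auto
  have nf: "f1 y \<bullet> n y = 0" "f2 y \<bullet> n y = 0" if "y \<in> S" for y using n(1) Xd[OF that] by auto
  define S1 where "S1 = {y \<in> {y \<in> S. df y \<noteq> 0}. n y \<noteq> 0}"
  have oS0: "open {y \<in> S. df y \<noteq> 0}" by (rule open_nonzero[OF S sdf])
  have oS1: "open S1" unfolding S1_def by (rule open_nonzero[OF oS0 smooth_on_subset_open[OF sn]]) auto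
  have S1S: "S1 \<subseteq> S" by (auto simp: S1_def)
  have y01: "y0 \<in> S1" using y0 df0 n(2) by (simp add: S1_def)
  have zz: "\<exists>z11 z12 z21 z22. X 1 y *v f2 y = cs (K y) z11 (n y) \<and> - (X 1 y *v f1 y) = cs (K y) z12 (n y) \<and>
        X 2 y *v f2 y = cs (K y) z21 (n y) \<and> - (X 2 y *v f1 y) = cs (K y) z22 (n y) \<and> z11 * z22 - z12 * z21 \<noteq> 0"
    if y: "y \<in> S1" for y
  proof -
    have yS: "y \<in> S" "df y \<noteq> 0" "n y \<noteq> 0" using y by (auto simp: S1_def)
    have no: "\<not> (c y = cs (K y) z (a y) \<and> d y = cs (K y) z (b y))" for z
      using defect_multiple[OF skK, of y "a y" "b y" z] KK'(1,2) yS(1,2) unfolding df_def by auto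
    then obtain p z1 z2 z3 z4 where p: "p \<in> {a y, b y}" "a y = cs (K y) z1 p" "b y = cs (K y) z2 p" "c y = cs (K y) z3 p" "d y = cs (K y) z4 p"
      using pen[OF yS(1)] by blast
    have Kp: "K y *v (K y *v p) = - p" using p(1) KK'(1,2) yS(1) by auto
    have Kn: "K y *v (K y *v n y) = - n y" using n(1) KK'(1,2) yS(1) by auto
    obtain w where "n y = cs (K y) w p" using n(1) p by auto
    note m = cs_multiple[OF Kp this yS(3)]
    obtain z11 z12 z21 z22 where z: "a y = cs (K y) z11 (n y)" "b y = cs (K y) z12 (n y)" "c y = cs (K y) z21 (n y)" "d y = cs (K y) z22 (n y)"
      using m[OF p(2)] m[OF p(3)] m[OF p(4)] m[OF p(5)] by blast
    \<comment> \<open>A vanishing determinant would make the pair \<open>c y\<close>,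
      \<open>d y\<close> a complex multiple of \<open>a y\<close>, \<open>b y\<close>, so the defect
      would be 0.\<close>
    have "z11 * z22 - z12 * z21 \<noteq> 0"
    proof
      assume D: "z11 * z22 - z12 * z21 = 0"
      show False
      proof (cases "z11 = 0")
        case False
        then have "z22 = z21 / z11 * z12" using D by (simp add: field_simps)
        then have "c y = cs (K y) (z21 / z11) (a y)" "d y = cs (K y) (z21 / z11) (b y)"
          using False by (simp_all add: z cs_cs[OF Kn])
        then show False using no by blast
      next
        case True
        then have a0: "a y = 0" by (simp add: z)
        then have "z12 \<noteq> 0" using ab[OF yS(1)] z(2) by auto
        then have "z21 = 0" using D True by simp
        then have "c y = cs (K y) (z22 / z12) (a y)" "d y = cs (K y) (z22 / z12) (b y)"
          using \<open>z12 \<noteq> 0\<close> by (simp_all add: a0 z(2-4) cs_cs[OF Kn])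
        then show False using no by blast
      qed
    qed
    then show ?thesis using z unfolding a_def b_def c_def d_def by blast
  qed
  obtain e where e: "e > 0" "ball y0 e \<subseteq> S1" using oS1 y01 open_contains_ball by blast
  have on1: "norm (f1 y) = 1 \<and> norm (f2 y) = 1 \<and> f1 y \<bullet> f2 y = 0 \<and> f1 y \<bullet> n y = 0 \<and> f2 y \<bullet> n y = 0 \<and> n y \<noteq> 0"
    if "y \<in> S1" for y using on nf that by (auto simp: S1_def)
  have der: "((\<lambda>y. cproj (f1 y) (f2 y) (n y)) has_derivative (\<lambda>h. 0)) (at y)" if "y \<in> S1" for y
    using cproj_derivative_0[OF oS1 smooth_on_subset_open[OF sm(1) S1S] smooth_on_subset_open[OF sm(2) S1S]
        smooth_on_subset_open[OF sn S1S] on1 zz[unfolded X_def K_def g_def] that] by blast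
  have "((\<lambda>y. cproj (f1 y) (f2 y) (n y)) has_derivative (\<lambda>h. 0)) (at y within ball y0 e)" if "y \<in> ball y0 e" for y
    using der e(2) that has_derivative_at_withinI by blast
  then obtain C where C: "\<And>y. y \<in> ball y0 e \<Longrightarrow> cproj (f1 y) (f2 y) (n y) = C"
    using has_derivative_zero_constant[OF convex_ball, of y0 e "\<lambda>y. cproj (f1 y) (f2 y) (n y)"] by blast
  note o0 = on1[OF y01]
  define P where "P = span {f1 y0, f2 y0, sgn (n y0), tc (f1 y0) (f2 y0) (sgn (n y0))}"
  have "cayley_plane P"
    unfolding P_def using o0 by (intro cayley_plane_span) (simp_all add: norm_sgn, simp_all add: sgn_div_norm)
  moreover have "span {f1 y, f2 y} \<subseteq> P" if y: "y \<in> ball y0 e" for y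
  proof -
    have "y0 \<in> ball y0 e" using e(1) by simp
    then have "cproj (f1 y) (f2 y) (n y) = cproj (f1 y0) (f2 y0) (n y0)" using C y by simp
    moreover have y1: "y \<in> S1" using e(2) y by blast
    then have "cproj (f1 y) (f2 y) (n y) *v f1 y = f1 y" "cproj (f1 y) (f2 y) (n y) *v f2 y = f2 y"
      using cproj(1)[of "f1 y" "f2 y" "n y"] on1[OF y1] by (simp_all add: span_base)
    ultimately have "f1 y \<in> span {f1 y0, f2 y0, n y0, tc (f1 y0) (f2 y0) (n y0)}" "f2 y \<in> span {f1 y0, f2 y0, n y0, tc (f1 y0) (f2 y0) (n y0)}"
      using cproj(2)[of "f1 y0" "f2 y0" "n y0"] o0 by metis+
    moreover have "span {f1 y0, f2 y0, n y0, tc (f1 y0) (f2 y0) (n y0)} \<subseteq> P"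
    proof (rule span_minimal)
      have "n y0 = norm (n y0) *\<^sub>R sgn (n y0)" using o0 by (simp add: sgn_div_norm)
      moreover have "tc (f1 y0) (f2 y0) (n y0) = norm (n y0) *\<^sub>R tc (f1 y0) (f2 y0) (sgn (n y0))"
        using o0 by (simp add: sgn_div_norm tc_simps)
      moreover have "r *\<^sub>R sgn (n y0) \<in> P" "r *\<^sub>R tc (f1 y0) (f2 y0) (sgn (n y0)) \<in> P" "f1 y0 \<in> P" "f2 y0 \<in> P" for r
        unfolding P_def by (auto intro: span_scale span_base)
      ultimately show "{f1 y0, f2 y0, n y0, tc (f1 y0) (f2 y0) (n y0)} \<subseteq> P" by (metis empty_subsetI insert_subset)
    qed (simp add: P_def)
    ultimately show ?thesis by (intro span_minimal) (auto simp: P_def)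
  qed
  ultimately show ?thesis using e S1S by blast
qed

section \<open>Two-ruled cones\<close>

lemma surface_chart:
  assumes "smooth_surface A" "(U, \<phi>) \<in> A"
  shows "open U" "open (\<phi> ` U)" "continuous_on U \<phi>" "continuous_on (\<phi> ` U) (inv_into U \<phi>)"
    "\<And>\<sigma>. \<sigma> \<in> U \<Longrightarrow> inv_into U \<phi> (\<phi> \<sigma>) = \<sigma>" "\<And>y. y \<in> \<phi> ` U \<Longrightarrow> inv_into U \<phi> y \<in> U \<and> \<phi> (inv_into U \<phi> y) = y"
    "\<And>V. open V \<Longrightarrow> open (\<phi> ` (U \<inter> V))"
proof -
  have h: "open U" "open (\<phi> ` U)" "homeomorphism U (\<phi> ` U) \<phi> (inv_into U \<phi>)"
    using assms unfolding smooth_surface_def by blast+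
  then show "open U" "open (\<phi> ` U)" "continuous_on U \<phi>" "continuous_on (\<phi> ` U) (inv_into U \<phi>)"
    by (auto simp: homeomorphism_def)
  show "inv_into U \<phi> (\<phi> \<sigma>) = \<sigma>" if "\<sigma> \<in> U" for \<sigma> using homeomorphism_apply1[OF h(3) that] .
  show "inv_into U \<phi> y \<in> U \<and> \<phi> (inv_into U \<phi> y) = y" if "y \<in> \<phi> ` U" for y
    using that by (auto intro: inv_into_into f_inv_into_f)
  fix V :: "'a set" assume "open V"
  then have "openin (top_of_set U) (U \<inter> V)" by (simp add: openin_open_Int)
  then have "openin (top_of_set (\<phi> ` U)) (\<phi> ` (U \<inter> V))"
    using homeomorphism_imp_open_map[OF h(3)] by blast
  then show "open (\<phi> ` (U \<inter> V))" using h(2) openin_open_trans by blast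
qed

lemma surface_chart_exists:
  assumes "smooth_surface A"
  obtains U \<phi> where "(U, \<phi>) \<in> A" "\<sigma> \<in> U"
  using assms unfolding smooth_surface_def by fast

lemma smooth_map_onD: "smooth_map_on A V f \<Longrightarrow> (U, \<phi>) \<in> A \<Longrightarrow> smooth_on (\<phi> ` (U \<inter> V)) (\<lambda>y. f (inv_into U \<phi> y))"
  unfolding smooth_map_on_def o_def by blast

text \<open>Chain rule for the transition map; exchanging the two charts turns the inclusion into an
  equality.\<close>

lemma range_derivative_chart_change:
  assumes A: "smooth_surface A" and f: "smooth_map_on A UNIV f"
    and c: "(U, \<phi>) \<in> A" "(W, \<eta>) \<in> A" "\<sigma> \<in> U" "\<sigma> \<in> W"
  shows "range (frechet_derivative (f \<circ> inv_into U \<phi>) (at (\<phi> \<sigma>))) \<subseteq> range (frechet_derivative (f \<circ> inv_into W \<eta>) (at (\<eta> \<sigma>)))"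
proof -
  note cU = surface_chart[OF A c(1)] and cW = surface_chart[OF A c(2)]
  let ?t = "\<eta> \<circ> inv_into U \<phi>" and ?S = "\<phi> ` (U \<inter> W)"
  have S: "open ?S" "\<phi> \<sigma> \<in> ?S" using cU(7) cW(1) c by auto
  have "smooth_on ?S ?t" using A c(1,2) unfolding smooth_surface_def by fast
  from smooth_on_has_derivative[OF this S(2)]
  have t: "(?t has_derivative frechet_derivative ?t (at (\<phi> \<sigma>))) (at (\<phi> \<sigma>))" .
  have "smooth_on (\<eta> ` W) (f \<circ> inv_into W \<eta>)" using smooth_map_onD[OF f c(2)] by (simp add: o_def)
  then have "((f \<circ> inv_into W \<eta>) has_derivative frechet_derivative (f \<circ> inv_into W \<eta>) (at (\<eta> \<sigma>))) (at (\<eta> \<sigma>))"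
    by (rule smooth_on_has_derivative) (use c in auto)
  then have "((f \<circ> inv_into W \<eta>) has_derivative frechet_derivative (f \<circ> inv_into W \<eta>) (at (\<eta> \<sigma>))) (at (?t (\<phi> \<sigma>)))"
    using c cU by simp
  from diff_chain_at[OF t this]
  have 1: "((f \<circ> inv_into W \<eta> \<circ> ?t) has_derivative
      frechet_derivative (f \<circ> inv_into W \<eta>) (at (\<eta> \<sigma>)) \<circ> frechet_derivative ?t (at (\<phi> \<sigma>))) (at (\<phi> \<sigma>))" .
  have "((f \<circ> inv_into U \<phi>) has_derivative
      frechet_derivative (f \<circ> inv_into W \<eta>) (at (\<eta> \<sigma>)) \<circ> frechet_derivative ?t (at (\<phi> \<sigma>))) (at (\<phi> \<sigma>))"
    by (rule has_derivative_transform_within_open[OF 1 S]) (use cU cW in auto)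
  then have "frechet_derivative (f \<circ> inv_into U \<phi>) (at (\<phi> \<sigma>)) =
      frechet_derivative (f \<circ> inv_into W \<eta>) (at (\<eta> \<sigma>)) \<circ> frechet_derivative ?t (at (\<phi> \<sigma>))"
    by (rule frechet_derivative_at[symmetric])
  then show ?thesis by auto
qed

lemma tangent_image_chart:
  assumes A: "smooth_surface A" and f: "smooth_map_on A UNIV f" and c: "(U, \<phi>) \<in> A" "\<sigma> \<in> U"
  shows "tangent_image A f \<sigma> = range (frechet_derivative (f \<circ> inv_into U \<phi>) (at (\<phi> \<sigma>)))"
  using range_derivative_chart_change[OF A f] c unfolding tangent_image_def by fast

lemma smooth_map_imp_continuous:
  assumes A: "smooth_surface A" and f: "smooth_map_on A UNIV f"
  shows "continuous_on UNIV f"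
proof -
  have "continuous (at \<sigma>) f" for \<sigma>
  proof -
    obtain U \<phi> where c: "(U, \<phi>) \<in> A" "\<sigma> \<in> U" using surface_chart_exists[OF A] .
    note cU = surface_chart[OF A c(1)]
    have "continuous_on (\<phi> ` U) (\<lambda>y. f (inv_into U \<phi> y))"
      using smooth_on_imp_continuous_on[OF smooth_map_onD[OF f c(1)]] by simp
    then have "continuous_on U (\<lambda>\<sigma>. f (inv_into U \<phi> (\<phi> \<sigma>)))"
      using continuous_on_compose2[OF _ cU(3)] by blast
    then have "continuous_on U f" using cU(5) by (simp cong: continuous_on_cong)
    then show ?thesis using c(2) cU(1) continuous_on_eq_continuous_at by blast
  qed
  then show ?thesis by (simp add: continuous_at_imp_continuous_on)
qed

section \<open>Rulings and tangent spaces of cones\<close>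

lemma span_pair:
  assumes "x \<in> span {u, v}"
  obtains r s where "x = r *\<^sub>R u + s *\<^sub>R v"
proof -
  obtain r where "x - r *\<^sub>R u \<in> span {v}" using assms by (auto simp: span_insert)
  then obtain s where "x - r *\<^sub>R u = s *\<^sub>R v" by (auto simp: span_singleton)
  then have "x = r *\<^sub>R u + s *\<^sub>R v" by (simp add: algebra_simps)
  then show ?thesis using that by blast
qed

lemma plane_of_wedge:
  assumes "norm u = 1" "norm v = 1" "u \<bullet> v = 0"
  shows "plane_of (wedge u v) = span {u, v}"
proof
  show "plane_of (wedge u v) \<subseteq> span {u, v}"
    unfolding plane_of_def wedge_mult by (auto intro: span_diff span_scale span_base)
  have "x \<in> plane_of (wedge u v)" if x: "x \<in> span {u, v}" for x
  proof -
    obtain r s where "x = r *\<^sub>R u + s *\<^sub>R v" using span_pair[OF x] .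
    then have "x = wedge u v *v (r *\<^sub>R v - s *\<^sub>R u)"
      using assms by (simp add: wedge_mult inner_diff_right inner_commute[of v u] dot_square_norm algebra_simps)
    then show ?thesis unfolding plane_of_def by blast
  qed
  then show "span {u, v} \<subseteq> plane_of (wedge u v)" by blast
qed

text \<open>Two orthonormal bases of the same plane differ by an orthogonal 2 by 2 matrix, whose
  determinant is the sign.\<close>

lemma G2O_plane_sign:
  assumes E: "E \<in> G2O" and e: "norm e1 = 1" "norm e2 = 1" "e1 \<bullet> e2 = 0" and P: "plane_of E = span {e1, e2}"
  shows "E = wedge e1 e2 \<or> E = - wedge e1 e2"
proof -
  obtain u v where uv: "E = wedge u v" "norm u = 1" "norm v = 1" "u \<bullet> v = 0" using G2O_E[OF E] .
  have uv': "u \<bullet> u = 1" "v \<bullet> v = 1" "v \<bullet> u = 0" using uv by (simp_all add: inner_commute dot_square_norm)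
  have s: "span {u, v} = span {e1, e2}" using P plane_of_wedge[OF uv(2-4)] uv(1) by simp
  obtain a b where ab: "e1 = a *\<^sub>R u + b *\<^sub>R v" using s span_pair[of e1 u v] span_base[of e1 "{e1, e2}"] by auto
  obtain c d where cd: "e2 = c *\<^sub>R u + d *\<^sub>R v" using s span_pair[of e2 u v] span_base[of e2 "{e1, e2}"] by auto
  have "e1 \<bullet> e1 = 1" "e2 \<bullet> e2 = 1" using e by (simp_all add: dot_square_norm)
  then have "a * a + b * b = 1" "c * c + d * d = 1" "a * c + b * d = 0"
    using e(3) unfolding ab cd by (simp_all add: inner_add_left inner_add_right uv' uv(4) mult.commute)
  then have "(a * d - b * c) * (a * d - b * c) = 1" by algebra
  then have D: "a * d - b * c = 1 \<or> a * d - b * c = -1"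
    by (simp add: power2_eq_square[symmetric] power2_eq_1_iff)
  have w: "wedge e1 e2 = (a * d - b * c) *\<^sub>R wedge u v"
    unfolding ab cd by (simp add: wedge_def vec_eq_iff algebra_simps)
  show ?thesis using D unfolding w uv(1) by auto
qed

text \<open>\<open>cone_tan E T x\<close> is the tangent space, at the point \<open>x\<close> of the plane \<open>E\<close>, of the cone swept out by
  planes with velocities \<open>T\<close>: if \<open>E = e\<^sub>1 \<and> e\<^sub>2\<close> and \<open>X = de\<^sub>1 \<and> e\<^sub>2 + e\<^sub>1 \<and> de\<^sub>2\<close>, then \<open>X E x\<close> is
  \<open>- (x\<^sub>1 de\<^sub>1 + x\<^sub>2 de\<^sub>2)\<close> up to the plane.\<close>

definition cone_tan :: "bivector \<Rightarrow> bivector set \<Rightarrow> octonion \<Rightarrow> octonion set" where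
  "cone_tan E T x = {p + X *v (E *v x) | p X. p \<in> plane_of E \<and> X \<in> T}"

text \<open>A ruling frame carries no orientation and may be opposite to that of the bivector, which
  \<open>eps\<close> records. It occurs once in E and once in X, and cancels in the product.\<close>

lemma cone_param_range:
  fixes a b :: "real^2 \<Rightarrow> octonion" and r :: "real^2"
  assumes on: "norm u = 1" "norm v = 1" "u \<bullet> v = 0" and eps: "eps = 1 \<or> eps = (-1::real)"
    and lin: "linear a" "linear b"
  shows "range (\<lambda>(q :: real^2, h). (r$1 *\<^sub>R a h + q$1 *\<^sub>R u) + (r$2 *\<^sub>R b h + q$2 *\<^sub>R v)) =
    cone_tan (eps *\<^sub>R wedge u v) (range (\<lambda>h. eps *\<^sub>R (wedge (a h) v + wedge u (b h)))) (r$1 *\<^sub>R u + r$2 *\<^sub>R v)"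
    (is "range (?L :: (real^2) \<times> (real^2) \<Rightarrow> octonion) = ?R")
proof -
  have ee: "eps * eps = 1" using eps by auto
  have uv': "u \<bullet> u = 1" "v \<bullet> v = 1" "v \<bullet> u = 0" using on by (simp_all add: inner_commute dot_square_norm)
  define X where "X h = eps *\<^sub>R (wedge (a h) v + wedge u (b h))" for h
  define E where "E = eps *\<^sub>R wedge u v"
  let ?x = "r$1 *\<^sub>R u + r$2 *\<^sub>R v"
  have pl: "plane_of E = span {u, v}"
  proof -
    have "range (\<lambda>x. E *v x) = range (\<lambda>x. wedge u v *v x)"
    proof (intro equalityI subsetI; elim rangeE)
      show "y \<in> range (\<lambda>x. wedge u v *v x)" if "y = E *v x" for x y
        using that by (intro range_eqI[of _ _ "eps *\<^sub>R x"]) (simp add: E_def mv_simps)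
      show "y \<in> range (\<lambda>x. E *v x)" if "y = wedge u v *v x" for x y
        using that by (intro range_eqI[of _ _ "eps *\<^sub>R x"]) (simp add: E_def mv_simps ee)
    qed
    then show ?thesis using plane_of_wedge[OF on] by (simp add: plane_of_def)
  qed
  have XE: "\<exists>s t. X h *v (E *v ?x) = - (r$1 *\<^sub>R a h + r$2 *\<^sub>R b h) + s *\<^sub>R u + t *\<^sub>R v" for h
  proof -
    have "X h *v (E *v ?x) = (eps * eps) *\<^sub>R ((wedge (a h) v + wedge u (b h)) *v (wedge u v *v ?x))"
      using eps by (elim disjE) (simp_all add: X_def E_def mv_simps algebra_simps)
    also have "\<dots> = - (r$1 *\<^sub>R a h + r$2 *\<^sub>R b h) + (r$2 * (b h \<bullet> u) - r$1 * (b h \<bullet> v)) *\<^sub>R u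
        + (r$1 * (a h \<bullet> v) - r$2 * (a h \<bullet> u)) *\<^sub>R v"
      by (simp add: ee mv_simps wedge_mult inner_add_right inner_diff_right uv' on(3) algebra_simps)
    finally show ?thesis by blast
  qed
  have 1: "?L (q, h) \<in> ?R" for q h
  proof -
    \<comment> \<open>The parameter direction is \<open>- h\<close> because the product of X and E
      gives minus the velocity of the point, up to the plane.\<close>
    obtain s t where st: "X (-h) *v (E *v ?x) = - (r$1 *\<^sub>R a (-h) + r$2 *\<^sub>R b (-h)) + s *\<^sub>R u + t *\<^sub>R v" using XE by blast
    have "?L (q, h) = ((q$1 - s) *\<^sub>R u + (q$2 - t) *\<^sub>R v) + X (-h) *v (E *v ?x)"
      unfolding st by (simp add: linear_neg[OF lin(1)] linear_neg[OF lin(2)] algebra_simps)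
    moreover have "(q$1 - s) *\<^sub>R u + (q$2 - t) *\<^sub>R v \<in> plane_of E"
      unfolding pl by (intro span_add span_scale span_base) auto
    ultimately show ?thesis unfolding cone_tan_def E_def[symmetric] X_def[symmetric] by blast
  qed
  have 2: "p + X h *v (E *v ?x) \<in> range ?L" if p: "p \<in> plane_of E" for p h
  proof -
    obtain s t where st: "X h *v (E *v ?x) = - (r$1 *\<^sub>R a h + r$2 *\<^sub>R b h) + s *\<^sub>R u + t *\<^sub>R v" using XE by blast
    obtain s' t' where p': "p = s' *\<^sub>R u + t' *\<^sub>R v" using p span_pair unfolding pl by metis
    have "p + X h *v (E *v ?x) = ?L (vector [s + s', t + t'] :: real^2, - h)"
      unfolding st p' by (simp add: linear_neg[OF lin(1)] linear_neg[OF lin(2)] algebra_simps)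
    then show ?thesis by (rule range_eqI)
  qed
  show ?thesis
  proof (intro equalityI subsetI)
    show "w \<in> ?R" if w: "w \<in> range ?L" for w
    proof -
      obtain qh where qh: "w = ?L qh" using w by (rule rangeE)
      obtain q h where "qh = (q, h)" by (rule prod.exhaust)
      then show ?thesis using 1[of q h] unfolding qh by (simp only:)
    qed
  next
    fix w assume "w \<in> ?R"
    then obtain p h where "p \<in> plane_of E" "w = p + X h *v (E *v ?x)"
      unfolding cone_tan_def E_def[symmetric] X_def[symmetric] by blast
    then show "w \<in> range ?L" using 2 by blast
  qed
qed

text \<open>The right side refers neither to the chart nor to the frame, so all local
  parametrizations give the same tangent space.\<close>

lemma cone_param_tangent:
  assumes A: "smooth_surface A" and \<gamma>: "smooth_map_on A UNIV \<gamma>"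
    and rul: "\<And>\<tau>. \<gamma> \<tau> \<in> G2O \<and> plane_of (\<gamma> \<tau>) = ruling M \<tau>"
    and fr: "ruling_frame A M V e1 e2" and c: "(U, \<phi>) \<in> A" "\<sigma> \<in> U" "\<sigma> \<in> V"
    and x: "cone_param U \<phi> e1 e2 (r, \<phi> \<sigma>) = x"
  shows "range (frechet_derivative (cone_param U \<phi> e1 e2) (at (r, \<phi> \<sigma>))) = cone_tan (\<gamma> \<sigma>) (tangent_image A \<gamma> \<sigma>) x"
proof -
  note cU = surface_chart[OF A c(1)]
  let ?\<psi> = "inv_into U \<phi>" and ?S = "\<phi> ` (U \<inter> V)"
  define f1 where "f1 y = e1 (?\<psi> y)" for y
  define f2 where "f2 y = e2 (?\<psi> y)" for y
  define g where "g y = \<gamma> (?\<psi> y)" for y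
  have V: "open V" and e: "\<And>\<tau>. \<tau> \<in> V \<Longrightarrow> norm (e1 \<tau>) = 1 \<and> norm (e2 \<tau>) = 1 \<and> e1 \<tau> \<bullet> e2 \<tau> = 0 \<and> ruling M \<tau> = span {e1 \<tau>, e2 \<tau>}"
    using fr by (auto simp: ruling_frame_def)
  have S: "open ?S" "\<phi> \<sigma> \<in> ?S" using cU(7)[OF V] c by auto
  have SV: "?\<psi> y \<in> V" if "y \<in> ?S" for y using that cU(5) by auto
  have sm: "smooth_on ?S f1" "smooth_on ?S f2"
    unfolding f1_def f2_def using fr c(1) by (auto simp: ruling_frame_def intro: smooth_map_onD)
  have sg: "smooth_on ?S g"
    unfolding g_def by (rule smooth_on_subset_open[OF smooth_map_onD[OF \<gamma> c(1)]]) auto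
  define w where "w y = wedge (f1 y) (f2 y)" for y
  have sw: "smooth_on ?S w" unfolding w_def by (intro smooth_on_wedge S sm)
  have sign: "g y = w y \<or> g y = - w y" if "y \<in> ?S" for y
    unfolding g_def w_def f1_def f2_def
    by (rule G2O_plane_sign) (use e[OF SV[OF that]] rul[of "?\<psi> y"] in simp_all)
  obtain eps where eps: "eps = 1 \<or> eps = (-1::real)" "g (\<phi> \<sigma>) = eps *\<^sub>R w (\<phi> \<sigma>)"
    using sign[OF S(2)] by (metis scaleR_minus_left scaleR_one)
  have ww: "w y \<noteq> 0" if "y \<in> ?S" for y
  proof -
    have "w y *v f2 y = f1 y"
      using e[OF SV[OF that]] by (simp add: w_def f1_def f2_def wedge_mult dot_square_norm)
    moreover have "f1 y \<noteq> 0" using e[OF SV[OF that]] by (auto simp: f1_def)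
    ultimately show ?thesis by auto
  qed
  text \<open>The sign relating \<open>\<gamma>\<close> to the frame is locally constant.\<close>
  define S' where "S' = {y \<in> ?S. g y + eps *\<^sub>R w y \<noteq> 0}"
  have S': "open S'"
    unfolding S'_def by (intro open_nonzero S smooth_on_add smooth_on_scaleR smooth_on_const sg sw)
  have y0: "\<phi> \<sigma> \<in> S'"
    using S(2) ww[OF S(2)] eps by (auto simp: S'_def scaleR_2[symmetric])
  have gw: "g y = eps *\<^sub>R w y" if "y \<in> S'" for y
    using that sign[of y] eps(1) by (auto simp: S'_def)
  have S'S: "S' \<subseteq> ?S" by (auto simp: S'_def)
  let ?a = "frechet_derivative f1 (at (\<phi> \<sigma>))" and ?b = "frechet_derivative f2 (at (\<phi> \<sigma>))"
  have da: "(f1 has_derivative ?a) (at (\<phi> \<sigma>))" and db: "(f2 has_derivative ?b) (at (\<phi> \<sigma>))"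
    using smooth_on_has_derivative[OF sm(1) S(2)] smooth_on_has_derivative[OF sm(2) S(2)] .
  have "((\<lambda>y. eps *\<^sub>R w y) has_derivative (\<lambda>h. eps *\<^sub>R (wedge (f1 (\<phi> \<sigma>)) (?b h) + wedge (?a h) (f2 (\<phi> \<sigma>))))) (at (\<phi> \<sigma>))"
    unfolding w_def by (intro has_derivative_scaleR_right bounded_bilinear.FDERIV[OF bounded_bilinear_wedge] da db)
  then have "(g has_derivative (\<lambda>h. eps *\<^sub>R (wedge (f1 (\<phi> \<sigma>)) (?b h) + wedge (?a h) (f2 (\<phi> \<sigma>))))) (at (\<phi> \<sigma>))"
    by (rule has_derivative_transform_within_open[OF _ S' y0]) (simp add: gw)
  then have Dg: "frechet_derivative g (at (\<phi> \<sigma>)) = (\<lambda>h. eps *\<^sub>R (wedge (?a h) (f2 (\<phi> \<sigma>)) + wedge (f1 (\<phi> \<sigma>)) (?b h)))"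
    using frechet_derivative_at by (metis (no_types, lifting) add.commute ext)
  have T: "tangent_image A \<gamma> \<sigma> = range (\<lambda>h. eps *\<^sub>R (wedge (?a h) (f2 (\<phi> \<sigma>)) + wedge (f1 (\<phi> \<sigma>)) (?b h)))"
    using tangent_image_chart[OF A \<gamma> c(1,2)] unfolding Dg[symmetric] by (simp add: g_def[abs_def] o_def)
  have fst': "((\<lambda>p. fst p $ k) has_derivative (\<lambda>q. fst q $ k)) (at p)" for p :: "(real^2) \<times> (real^2)" and k
    by (rule bounded_linear_imp_has_derivative)
      (rule bounded_linear_compose[OF bounded_linear_vec_nth bounded_linear_fst])
  have snd': "((\<lambda>p. f (snd p)) has_derivative (\<lambda>q. f' (snd q))) (at (r, \<phi> \<sigma>))"
    if "(f has_derivative f') (at (\<phi> \<sigma>))" for f f' :: "real^2 \<Rightarrow> octonion"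
    using has_derivative_compose[OF bounded_linear_imp_has_derivative[OF bounded_linear_snd], of f f' "(r, \<phi> \<sigma>)" UNIV] that by simp
  have cp: "cone_param U \<phi> e1 e2 = (\<lambda>p. fst p $ 1 *\<^sub>R f1 (snd p) + fst p $ 2 *\<^sub>R f2 (snd p))"
    by (auto simp: cone_param_def f1_def f2_def fun_eq_iff)
  have "(cone_param U \<phi> e1 e2 has_derivative (\<lambda>q. (fst (r, \<phi> \<sigma>) $ 1 *\<^sub>R ?a (snd q) + fst q $ 1 *\<^sub>R f1 (snd (r, \<phi> \<sigma>))) +
      (fst (r, \<phi> \<sigma>) $ 2 *\<^sub>R ?b (snd q) + fst q $ 2 *\<^sub>R f2 (snd (r, \<phi> \<sigma>))))) (at (r, \<phi> \<sigma>))"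
    unfolding cp by (intro has_derivative_add has_derivative_scaleR fst' snd' da db)
  from frechet_derivative_at[OF this]
  have D: "frechet_derivative (cone_param U \<phi> e1 e2) (at (r, \<phi> \<sigma>)) =
      (\<lambda>(q, h). (r $ 1 *\<^sub>R ?a h + q $ 1 *\<^sub>R f1 (\<phi> \<sigma>)) + (r $ 2 *\<^sub>R ?b h + q $ 2 *\<^sub>R f2 (\<phi> \<sigma>)))"
    by (simp add: case_prod_unfold)
  have on: "norm (f1 (\<phi> \<sigma>)) = 1" "norm (f2 (\<phi> \<sigma>)) = 1" "f1 (\<phi> \<sigma>) \<bullet> f2 (\<phi> \<sigma>) = 0"
    using e[OF SV[OF S(2)]] by (simp_all add: f1_def f2_def)
  have "x = r $ 1 *\<^sub>R f1 (\<phi> \<sigma>) + r $ 2 *\<^sub>R f2 (\<phi> \<sigma>)" using x by (simp add: cp)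
  moreover have "\<gamma> \<sigma> = eps *\<^sub>R wedge (f1 (\<phi> \<sigma>)) (f2 (\<phi> \<sigma>))"
    using eps(2) by (simp add: g_def w_def cU(5)[OF c(2)])
  ultimately show ?thesis
    unfolding D T
    using cone_param_range[OF on eps(1) has_derivative_linear[OF da] has_derivative_linear[OF db], of r] by simp
qed

lemma cone_tangent_eq:
  assumes A: "smooth_surface A" and \<gamma>: "smooth_map_on A UNIV \<gamma>"
    and rul: "\<And>\<tau>. \<gamma> \<tau> \<in> G2O \<and> plane_of (\<gamma> \<tau>) = ruling M \<tau>"
    and fr: "ruling_frame A M V e1 e2" "\<sigma> \<in> V" and x: "x \<in> ruling M \<sigma>"
  shows "cone_tangent A M (\<sigma>, x) = cone_tan (\<gamma> \<sigma>) (tangent_image A \<gamma> \<sigma>) x"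
proof
  show "cone_tangent A M (\<sigma>, x) \<subseteq> cone_tan (\<gamma> \<sigma>) (tangent_image A \<gamma> \<sigma>) x"
    unfolding cone_tangent_def using cone_param_tangent[OF A \<gamma> rul] by fastforce
  obtain U \<phi> where c: "(U, \<phi>) \<in> A" "\<sigma> \<in> U" using surface_chart_exists[OF A] .
  have "x \<in> span {e1 \<sigma>, e2 \<sigma>}" using x fr by (simp add: ruling_frame_def)
  then obtain s t where "x = s *\<^sub>R e1 \<sigma> + t *\<^sub>R e2 \<sigma>" using span_pair by metis
  then have cp: "cone_param U \<phi> e1 e2 (vector [s, t], \<phi> \<sigma>) = x"
    by (simp add: cone_param_def surface_chart(5)[OF A c])
  show "cone_tan (\<gamma> \<sigma>) (tangent_image A \<gamma> \<sigma>) x \<subseteq> cone_tangent A M (\<sigma>, x)"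
    unfolding cone_param_tangent[OF A \<gamma> rul fr(1) c fr(2) cp, symmetric] cone_tangent_def
    using fr c cp by fastforce
qed

section \<open>From curves to cones\<close>

lemma TG2O_mult_plane:
  assumes "norm u = 1" "norm v = 1" "u \<bullet> v = 0" "X \<in> TG2O (wedge u v)"
  shows "X *v (wedge u v *v x) = - ((u \<bullet> x) *\<^sub>R (X *v v) + (v \<bullet> x) *\<^sub>R (- (X *v u)))"
    "u \<bullet> (X *v (wedge u v *v x)) = 0" "v \<bullet> (X *v (wedge u v *v x)) = 0"
    "Jop (wedge u v) X *v (wedge u v *v x) = tc u v (X *v (wedge u v *v x))"
proof -
  show 1: "X *v (wedge u v *v x) = - ((u \<bullet> x) *\<^sub>R (X *v v) + (v \<bullet> x) *\<^sub>R (- (X *v u)))"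
    by (simp add: wedge_mult mv_simps)
  show "u \<bullet> (X *v (wedge u v *v x)) = 0" "v \<bullet> (X *v (wedge u v *v x)) = 0"
    unfolding 1 using TG2O_D(2-5)[OF assms] by (simp_all add: inner_diff_right inner_commute)
  have "tc u v (wedge u v *v x) = 0" by (simp add: wedge_mult tc_simps tc_refl)
  then show "Jop (wedge u v) X *v (wedge u v *v x) = tc u v (X *v (wedge u v *v x))"
    by (simp add: Jop_def mv_simps Kop_wedge)
qed

text \<open>The tangent space is spanned by four vectors; an orthogonal quadruple of nonzero vectors
  inside it forces dimension 4 and equality.\<close>

lemma cone_tan_eq_span:
  assumes on: "norm u = 1" "norm v = 1" "u \<bullet> v = 0" and T: "T = span {X1, X2}"
    and n: "n \<in> cone_tan (wedge u v) T x" "k \<in> cone_tan (wedge u v) T x" "n \<noteq> 0" "k \<noteq> 0"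
    "u \<bullet> n = 0" "v \<bullet> n = 0" "u \<bullet> k = 0" "v \<bullet> k = 0" "n \<bullet> k = 0"
  shows "dim (cone_tan (wedge u v) T x) = 4" "cone_tan (wedge u v) T x = span {u, v, n, k}"
proof -
  let ?C = "cone_tan (wedge u v) T x" and ?f = "\<lambda>X. X *v (wedge u v *v x)"
  have lin: "linear ?f" by (rule linearI) (simp_all add: mv_simps)
  have C: "?C = span {u, v, ?f X1, ?f X2}"
  proof -
    have "?f ` T = span {?f X1, ?f X2}" unfolding T using linear_span_image[OF lin, of "{X1, X2}"] by simp
    moreover have "?C = {p + q | p q. p \<in> span {u, v} \<and> q \<in> ?f ` T}"
      unfolding cone_tan_def plane_of_wedge[OF on] by blast
    ultimately have "?C = {p + q | p q. p \<in> span {u, v} \<and> q \<in> span {?f X1, ?f X2}}" by simp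
    then show ?thesis unfolding span_Un[symmetric] by (simp add: insert_commute)
  qed
  have le: "dim ?C \<le> 4"
    unfolding C dim_span
    by (rule order_trans[OF dim_le_card'])
      (simp_all add: card_insert_if)
  have "{u, v} \<subseteq> ?C" unfolding C by (auto intro: span_base)
  then have sub: "span {u, v, n, k} \<subseteq> ?C"
    using n(1,2) unfolding C by (intro span_minimal) auto
  have d4: "dim (span {u, v, n, k}) = 4"
    using on n by (intro dim_orthogonal_4) auto
  then show "dim ?C = 4" using dim_subset[OF sub] le by simp
  then show "?C = span {u, v, n, k}"
    using subspace_dim_equal[OF subspace_span _ sub] d4 C by (metis order_refl subspace_span)
qed

lemma immersion_tangent:
  assumes A: "smooth_surface A" and \<gamma>: "immersion A \<gamma>" "range \<gamma> \<subseteq> G2O" and c: "(U, \<phi>) \<in> A" "\<sigma> \<in> U"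
  defines "L \<equiv> frechet_derivative (\<lambda>y. \<gamma> (inv_into U \<phi> y)) (at (\<phi> \<sigma>))"
  shows "linear L" "tangent_image A \<gamma> \<sigma> = range L" "tangent_image A \<gamma> \<sigma> = span {L (axis 1 1), L (axis 2 1)}"
    "\<And>s t. s *\<^sub>R L (axis 1 1) + t *\<^sub>R L (axis 2 1) = 0 \<Longrightarrow> s = 0 \<and> t = 0" "\<And>h. L h \<in> TG2O (\<gamma> \<sigma>)"
    "dim (tangent_image A \<gamma> \<sigma>) = 2"
proof -
  note cU = surface_chart[OF A c(1)]
  have sm: "smooth_map_on A UNIV \<gamma>" using \<gamma>(1) by (simp add: immersion_def)
  have s: "smooth_on (\<phi> ` U) (\<lambda>y. \<gamma> (inv_into U \<phi> y))" using smooth_map_onD[OF sm c(1)] by simp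
  have y0: "\<phi> \<sigma> \<in> \<phi> ` U" using c by blast
  have d: "((\<lambda>y. \<gamma> (inv_into U \<phi> y)) has_derivative L) (at (\<phi> \<sigma>))"
    unfolding L_def by (rule smooth_on_has_derivative[OF s y0])
  show lin: "linear L" using d has_derivative_linear by blast
  show T: "tangent_image A \<gamma> \<sigma> = range L"
    using tangent_image_chart[OF A sm c] by (simp add: L_def o_def)
  have inj: "inj L" using \<gamma>(1) c by (fastforce simp: immersion_def L_def o_def)
  have h: "h = (h$1) *\<^sub>R axis 1 1 + (h$2) *\<^sub>R axis 2 1" for h :: "real^2"
    by (simp add: vec_eq_iff forall_2 axis_nth_if)
  have "(h$1) *\<^sub>R axis 1 1 + (h$2) *\<^sub>R axis 2 1 \<in> span {axis 1 1, axis 2 1 :: real^2}" for h :: "real^2"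
    by (intro span_add span_scale span_base) auto
  then have "span {axis 1 1, axis 2 1 :: real^2} = UNIV" unfolding h[symmetric] by blast
  then show "tangent_image A \<gamma> \<sigma> = span {L (axis 1 1), L (axis 2 1)}"
    unfolding T using linear_span_image[OF lin, of "{axis 1 1, axis 2 1}"] by simp
  show "s = 0 \<and> t = 0" if "s *\<^sub>R L (axis 1 1) + t *\<^sub>R L (axis 2 1) = 0" for s t
  proof -
    have "L (s *\<^sub>R axis 1 1 + t *\<^sub>R axis 2 1) = L 0"
      using that by (simp add: linear_add[OF lin] linear_cmul[OF lin] linear_0[OF lin])
    then have "s *\<^sub>R axis 1 1 + t *\<^sub>R axis 2 1 = (0 :: real^2)" using inj by (simp add: inj_eq)
    then show ?thesis by (simp add: vec_eq_iff forall_2 axis_nth_if)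
  qed
  have "L h \<in> TG2O (\<gamma> (inv_into U \<phi> (\<phi> \<sigma>)))" for h
    using TG2O_of_derivative[OF d cU(2) y0] \<gamma>(2) by blast
  then show "L h \<in> TG2O (\<gamma> \<sigma>)" for h by (simp add: cU(5)[OF c(2)])
  show "dim (tangent_image A \<gamma> \<sigma>) = 2"
    unfolding T using dim_image_eq[OF lin, of UNIV] inj by simp
qed

lemma ruling_frame_pf:
  assumes A: "smooth_surface A" and \<gamma>: "smooth_map_on A UNIV \<gamma>"
    and rul: "\<And>\<tau>. \<gamma> \<tau> \<in> G2O \<and> plane_of (\<gamma> \<tau>) = ruling M \<tau>"
  obtains V q where "\<sigma> \<in> V" "ruling_frame A M V (\<lambda>\<tau>. pf1 q (\<gamma> \<tau>)) (\<lambda>\<tau>. pf2 q (\<gamma> \<tau>))"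
    "\<And>\<tau>. \<tau> \<in> V \<Longrightarrow> \<gamma> \<tau> = wedge (pf1 q (\<gamma> \<tau>)) (pf2 q (\<gamma> \<tau>))"
proof -
  obtain u v where uv: "\<gamma> \<sigma> = wedge u v" "norm u = 1" "norm v = 1" "u \<bullet> v = 0" using G2O_E rul by metis
  define W where "W = {E. plane_proj u E \<noteq> 0}"
  define V where "V = \<gamma> -` W"
  have "plane_proj u (\<gamma> \<sigma>) = u"
    using uv by (simp add: plane_proj_wedge dot_square_norm inner_commute[of v u])
  then have \<sigma>: "\<sigma> \<in> V" using uv(2) by (auto simp: V_def W_def)
  have oW: "open W" unfolding W_def by (rule open_plane_proj)
  then have oV: "open V" unfolding V_def
    using smooth_map_imp_continuous[OF A \<gamma>] by (simp add: open_vimage)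
  have sm: "smooth_map_on A V (\<lambda>\<tau>. f (\<gamma> \<tau>))" if "smooth_on W f" for f :: "bivector \<Rightarrow> octonion"
    unfolding smooth_map_on_def o_def
  proof (intro ballI, clarify)
    fix U \<phi> assume c: "(U, \<phi>) \<in> A"
    note cU = surface_chart[OF A c]
    show "smooth_on (\<phi> ` (U \<inter> V)) (\<lambda>y. f (\<gamma> (inv_into U \<phi> y)))"
    proof (rule smooth_on_compose[OF cU(7)[OF oV] oW _ that])
      show "smooth_on (\<phi> ` (U \<inter> V)) (\<lambda>y. \<gamma> (inv_into U \<phi> y))"
        by (rule smooth_on_subset_open[OF smooth_map_onD[OF \<gamma> c]]) auto
    qed (use cU(5) in \<open>auto simp: V_def\<close>)
  qed
  have pf: "norm (pf1 u (\<gamma> \<tau>)) = 1" "norm (pf2 u (\<gamma> \<tau>)) = 1" "pf1 u (\<gamma> \<tau>) \<bullet> pf2 u (\<gamma> \<tau>) = 0"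
    "\<gamma> \<tau> = wedge (pf1 u (\<gamma> \<tau>)) (pf2 u (\<gamma> \<tau>))" if "\<tau> \<in> V" for \<tau>
    using plane_frame[of "\<gamma> \<tau>" u] rul that by (auto simp: V_def W_def)
  have "ruling M \<tau> = span {pf1 u (\<gamma> \<tau>), pf2 u (\<gamma> \<tau>)}" if "\<tau> \<in> V" for \<tau>
    using plane_of_wedge[OF pf(1-3)[OF that]] pf(4)[OF that] rul by metis
  then have "ruling_frame A M V (\<lambda>\<tau>. pf1 u (\<gamma> \<tau>)) (\<lambda>\<tau>. pf2 u (\<gamma> \<tau>))"
    unfolding ruling_frame_def using oV sm smooth_plane_frame[of u, folded W_def] pf by blast
  then show ?thesis using that \<sigma> pf(4) by blast
qed

text \<open>The tangent image is closed under J, and J acts on the displacement of \<open>x\<close>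
  as the triple product with \<open>u\<close>, \<open>v\<close>. So the tangent space contains the
  unit displacement together with its triple product.\<close>

lemma pseudoholomorphic_cone_tan:
  assumes A: "smooth_surface A" and \<gamma>: "immersed_pseudoholomorphic_curve A \<gamma>"
    and uv: "\<gamma> \<sigma> = wedge u v" "norm u = 1" "norm v = 1" "u \<bullet> v = 0"
    and X: "X \<in> tangent_image A \<gamma> \<sigma>" "X *v (\<gamma> \<sigma> *v x) \<noteq> 0"
  shows "dim (cone_tan (\<gamma> \<sigma>) (tangent_image A \<gamma> \<sigma>) x) = 4" "cayley_plane (cone_tan (\<gamma> \<sigma>) (tangent_image A \<gamma> \<sigma>) x)"
proof -
  obtain U \<phi> where c: "(U, \<phi>) \<in> A" "\<sigma> \<in> U" using surface_chart_exists[OF A] .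
  have i: "immersion A \<gamma>" "range \<gamma> \<subseteq> G2O" "pseudoholomorphic_at A \<gamma> \<sigma>"
    using \<gamma> by (auto simp: immersed_pseudoholomorphic_curve_def)
  note T = immersion_tangent[OF A i(1,2) c]
  have XT: "X \<in> TG2O (wedge u v)" using X(1) T(2,5) uv(1) by auto
  define w where "w = sgn (X *v (\<gamma> \<sigma> *v x))"
  define m where "m = tc u v w"
  have "J_G2O (\<gamma> \<sigma>) X \<in> tangent_image A \<gamma> \<sigma>" using i(3) T(6) X(1) by (simp add: pseudoholomorphic_at_def)
  then have JX: "Jop (\<gamma> \<sigma>) X \<in> tangent_image A \<gamma> \<sigma>"
    using J_G2O_eq[OF _ XT] G2O_I[OF uv(2-4)] uv(1) by simp
  note pl = TG2O_mult_plane[OF uv(2-4) XT, of x, folded uv(1)]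
  have w: "norm w = 1" "u \<bullet> w = 0" "v \<bullet> w = 0"
    using X(2) pl by (simp_all add: w_def norm_sgn) (simp_all add: sgn_div_norm)
  have m: "norm m = 1" "u \<bullet> m = 0" "v \<bullet> m = 0" "w \<bullet> m = 0"
    using norm_tc[OF uv(2-4) w(2,3)] w(1) by (simp_all add: m_def tc_perp)
  have in_C: "r *\<^sub>R (Y *v (\<gamma> \<sigma> *v x)) \<in> cone_tan (\<gamma> \<sigma>) (tangent_image A \<gamma> \<sigma>) x" if "Y \<in> tangent_image A \<gamma> \<sigma>" for Y r
  proof -
    have "r *\<^sub>R Y \<in> tangent_image A \<gamma> \<sigma>" using that unfolding T(3) by (rule span_scale)
    moreover have "0 \<in> plane_of (\<gamma> \<sigma>)" unfolding uv(1) plane_of_wedge[OF uv(2-4)] by (rule span_zero)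
    ultimately show ?thesis unfolding cone_tan_def
      by (intro CollectI exI[of _ 0] exI[of _ "r *\<^sub>R Y"]) (simp add: mv_simps)
  qed
  have wC: "w \<in> cone_tan (\<gamma> \<sigma>) (tangent_image A \<gamma> \<sigma>) x" unfolding w_def sgn_div_norm by (rule in_C[OF X(1)])
  have "m = inverse (norm (X *v (\<gamma> \<sigma> *v x))) *\<^sub>R (Jop (\<gamma> \<sigma>) X *v (\<gamma> \<sigma> *v x))"
    unfolding pl(4) by (simp add: m_def w_def sgn_div_norm tc_simps)
  then have mC: "m \<in> cone_tan (\<gamma> \<sigma>) (tangent_image A \<gamma> \<sigma>) x" using in_C[OF JX] by simp
  have "w \<noteq> 0" "m \<noteq> 0" using w m by auto
  note c4 = cone_tan_eq_span[OF uv(2-4) T(3) wC[unfolded uv(1)] mC[unfolded uv(1)] this w(2,3) m(2-4)]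
  show "dim (cone_tan (\<gamma> \<sigma>) (tangent_image A \<gamma> \<sigma>) x) = 4" using c4(1) uv(1) by simp
  show "cayley_plane (cone_tan (\<gamma> \<sigma>) (tangent_image A \<gamma> \<sigma>) x)"
    using c4(2) cayley_plane_span[OF uv(2,3) w(1) uv(4) w(2,3)] uv(1) by (simp add: m_def)
qed

lemma ruling_swept_cone: "ruling (swept_cone \<gamma>) \<sigma> = plane_of (\<gamma> \<sigma>)"
  by (simp add: ruling_def swept_cone_def)

text \<open>At an immersed point some tangent vector displaces \<open>x\<close>, and the tangent
  space is then Cayley. Density holds already within one ruling plane: the displacement is linear in
  \<open>x\<close> and not identically 0 there.\<close>

lemma swept_cone_nondegenerate:
  assumes A: "smooth_surface A" and \<gamma>: "immersed_pseudoholomorphic_curve A \<gamma>"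
  shows "nondegenerate_oriented_cayley_cone A (swept_cone \<gamma>) \<gamma>"
proof -
  let ?M = "swept_cone \<gamma>"
  have i: "immersion A \<gamma>" "range \<gamma> \<subseteq> G2O" using \<gamma> by (auto simp: immersed_pseudoholomorphic_curve_def)
  have sm: "smooth_map_on A UNIV \<gamma>" using i(1) by (simp add: immersion_def)
  have rul: "\<gamma> \<tau> \<in> G2O \<and> plane_of (\<gamma> \<tau>) = ruling ?M \<tau>" for \<tau>
    using i(2) by (auto simp: ruling_swept_cone)
  have frames: "\<exists>V e1 e2. \<sigma> \<in> V \<and> ruling_frame A ?M V e1 e2" for \<sigma>
    by (rule ruling_frame_pf[OF A sm rul, of \<sigma>]) blast
  have ct: "cone_tangent A ?M (\<sigma>, x) = cone_tan (\<gamma> \<sigma>) (tangent_image A \<gamma> \<sigma>) x" if "(\<sigma>, x) \<in> ?M" for \<sigma> x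
    using frames[of \<sigma>] cone_tangent_eq[OF A sm rul _ _, of _ _ _ \<sigma> x] that by (auto simp: ruling_def)
  have "cayley_plane (cone_tangent A ?M p)" if p: "p \<in> immersed_points A ?M" for p
  proof -
    obtain \<sigma> x where px: "p = (\<sigma>, x)" by force
    have M: "(\<sigma>, x) \<in> ?M" and d: "dim (cone_tan (\<gamma> \<sigma>) (tangent_image A \<gamma> \<sigma>) x) = 4"
      using p ct by (auto simp: immersed_points_def px)
    obtain u v where uv: "\<gamma> \<sigma> = wedge u v" "norm u = 1" "norm v = 1" "u \<bullet> v = 0" using G2O_E rul by metis
    \<comment> \<open>Without any displacement the tangent space would lie in the ruling plane,
      whose dimension is 2.\<close>
    have "\<exists>X\<in>tangent_image A \<gamma> \<sigma>. X *v (\<gamma> \<sigma> *v x) \<noteq> 0"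
    proof (rule ccontr)
      assume "\<not> ?thesis"
      then have "cone_tan (\<gamma> \<sigma>) (tangent_image A \<gamma> \<sigma>) x \<subseteq> span {u, v}"
        unfolding cone_tan_def uv(1) plane_of_wedge[OF uv(2-4)] by auto
      then have "dim (cone_tan (\<gamma> \<sigma>) (tangent_image A \<gamma> \<sigma>) x) \<le> card {u, v}"
        by (intro dim_le_card) auto
      also have "\<dots> \<le> 2" by (simp add: card_insert_if)
      finally show False using d by simp
    qed
    then show ?thesis using pseudoholomorphic_cone_tan[OF A \<gamma> uv] ct[OF M] px by metis
  qed
  moreover have "?M \<subseteq> closure (immersed_points A ?M)"
  proof
    fix p assume "p \<in> ?M"
    then obtain \<sigma> x where px: "p = (\<sigma>, x)" and x: "x \<in> plane_of (\<gamma> \<sigma>)" by (auto simp: swept_cone_def)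
    obtain u v where uv: "\<gamma> \<sigma> = wedge u v" "norm u = 1" "norm v = 1" "u \<bullet> v = 0" using G2O_E rul by metis
    obtain U \<phi> where c: "(U, \<phi>) \<in> A" "\<sigma> \<in> U" using surface_chart_exists[OF A] .
    note T = immersion_tangent[OF A i c]
    define X where "X = frechet_derivative (\<lambda>y. \<gamma> (inv_into U \<phi> y)) (at (\<phi> \<sigma>)) (axis 1 1)"
    have X: "X \<in> tangent_image A \<gamma> \<sigma>" "X \<in> TG2O (wedge u v)" using T(2,5) uv(1) by (auto simp: X_def)
    have "X \<noteq> 0" using T(4)[of 1 0] by (auto simp: X_def)
    define f where "f x = X *v (\<gamma> \<sigma> *v x)" for x
    have "f u \<noteq> 0 \<or> f v \<noteq> 0"
    proof (rule ccontr)
      assume "\<not> ?thesis"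
      then have "X *v v = 0" "X *v u = 0"
        unfolding f_def uv(1) TG2O_mult_plane(1)[OF uv(2-4) X(2)] using uv by (simp_all add: inner_commute[of v u] dot_square_norm)
      then have "X = 0" using TG2O_D(1)[OF uv(2-4) X(2)] by (simp add: wedge_def vec_eq_iff)
      then show False using \<open>X \<noteq> 0\<close> by blast
    qed
    then obtain d where d: "f d \<noteq> 0" "d \<in> span {u, v}" by (auto intro: span_base)
    have pl: "plane_of (\<gamma> \<sigma>) = span {u, v}" using plane_of_wedge[OF uv(2-4)] uv(1) by simp
    have good: "(\<sigma>, x') \<in> immersed_points A ?M" if "x' \<in> plane_of (\<gamma> \<sigma>)" "f x' \<noteq> 0" for x'
      using pseudoholomorphic_cone_tan(1)[OF A \<gamma> uv X(1)] that ct[of \<sigma> x']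
      by (simp add: immersed_points_def swept_cone_def f_def)
    have f_add: "f (x + t *\<^sub>R d) = f x + t *\<^sub>R f d" for t by (simp add: f_def mv_simps)
    show "p \<in> closure (immersed_points A ?M)"
      unfolding closure_iff_nhds_not_empty
    proof (intro allI impI)
      fix W S assume S: "S \<subseteq> W" "open S" "p \<in> S"
      obtain B C where BC: "open B" "open C" "(\<sigma>, x) \<in> B \<times> C" "B \<times> C \<subseteq> S"
        using open_prod_elim[OF S(2,3)] px by metis
      obtain e where e: "e > 0" "ball x e \<subseteq> C" using BC(2,3) open_contains_ball by blast
      define N where "N = norm d + 1"
      define t where "t = e / (2 * N)"
      have nd: "N > 0" by (simp add: N_def add_nonneg_pos)
      have t: "t > 0" using e(1) nd by (simp add: t_def)
      have "t * norm d \<le> t * N" using t by (simp add: N_def)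
      also have "\<dots> = e / 2" using nd by (simp add: t_def)
      finally have td: "t * norm d < e" using e(1) by simp
      have near: "x + s *\<^sub>R d \<in> C" if "0 \<le> s" "s \<le> t" for s
      proof -
        have "s * norm d \<le> t * norm d" using that by (simp add: mult_right_mono)
        then have "dist x (x + s *\<^sub>R d) < e" using td that by (simp add: dist_norm)
        then show ?thesis using e(2) by auto
      qed
      \<comment> \<open>If the displacement vanishes at \<open>x\<close>, then at
        \<open>x + t *\<^sub>R d\<close> it is \<open>t *\<^sub>R f d\<close>, which is not
        0.\<close>
      have "f (x + t *\<^sub>R d) \<noteq> 0 \<or> f (x + 0 *\<^sub>R d) \<noteq> 0"
        using d(1) t unfolding f_add by auto
      then obtain s where s: "f (x + s *\<^sub>R d) \<noteq> 0" "0 \<le> s" "s \<le> t" using t by (metis less_eq_real_def)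
      have "x + s *\<^sub>R d \<in> plane_of (\<gamma> \<sigma>)" using x d(2) unfolding pl by (intro span_add span_scale)
      then have "(\<sigma>, x + s *\<^sub>R d) \<in> immersed_points A ?M" using good s(1) by blast
      moreover have "(\<sigma>, x + s *\<^sub>R d) \<in> W" using near s(2,3) BC S(1) by blast
      ultimately show "immersed_points A ?M \<inter> W \<noteq> {}" by blast
    qed
  qed
  ultimately show ?thesis
    using frames i rul smooth_map_imp_continuous[OF A sm]
    unfolding nondegenerate_oriented_cayley_cone_def two_ruled_cone_def cayley_cone_def r_orientation_def by blast
qed

section \<open>From cones to curves\<close>

lemma complex_multiple_imp_pseudoholomorphic:
  assumes uv: "\<gamma> \<sigma> = wedge u v" "norm u = 1" "norm v = 1" "u \<bullet> v = 0"
    and T: "tangent_image A \<gamma> \<sigma> = span {X1, X2}" "X1 \<in> TG2O (wedge u v)" "X2 \<in> TG2O (wedge u v)"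
    and ind: "\<And>s t. s *\<^sub>R X1 + t *\<^sub>R X2 = 0 \<Longrightarrow> s = 0 \<and> t = 0"
    and z: "X2 *v v = cs (Kop (wedge u v)) z (X1 *v v)" "- (X2 *v u) = cs (Kop (wedge u v)) z (- (X1 *v u))"
  shows "pseudoholomorphic_at A \<gamma> \<sigma>"
proof -
  let ?E = "wedge u v" and ?T = "span {X1, X2}"
  have E: "?E \<in> G2O" by (rule G2O_I[OF uv(2-4)])
  note D1 = TG2O_D(1)[OF uv(2-4) T(2)] and D2 = TG2O_D(1)[OF uv(2-4) T(3)]
  have "Jop ?E X1 = wedge (tc u v (X1 *v v)) v + wedge u (tc u v (- (X1 *v u)))"
    by (subst D1) (rule Jop_TG2O_wedge[OF uv(2-4)])
  moreover have "X2 = wedge (cs (Kop ?E) z (X1 *v v)) v + wedge u (cs (Kop ?E) z (- (X1 *v u)))"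
    unfolding z[symmetric] by (rule D2)
  ultimately have "X2 = Re z *\<^sub>R (wedge (X1 *v v) v + wedge u (- (X1 *v u))) + Im z *\<^sub>R Jop ?E X1"
    by (simp add: cs_def Kop_wedge wedge_add_left wedge_add_right wedge_scaleR_left wedge_scaleR_right
        wedge_diff_left wedge_diff_right wedge_minus_right scaleR_add_right algebra_simps)
  then have X2: "X2 = Re z *\<^sub>R X1 + Im z *\<^sub>R Jop ?E X1" unfolding D1[symmetric] .
  \<comment> \<open>A real multiplier would make \<open>X1\<close> and \<open>X2\<close> real
    dependent. With a nonreal one, the image of \<open>X1\<close> under J can be solved for in the
    span.\<close>
  have "Im z \<noteq> 0"
  proof
    assume "Im z = 0"
    then have "(- Re z) *\<^sub>R X1 + 1 *\<^sub>R X2 = 0" using X2 by simp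
    then show False using ind by fastforce
  qed
  have "Im z *\<^sub>R Jop ?E X1 = X2 - Re z *\<^sub>R X1" using X2 by (simp add: algebra_simps)
  then have "inverse (Im z) *\<^sub>R (Im z *\<^sub>R Jop ?E X1) = inverse (Im z) *\<^sub>R (X2 - Re z *\<^sub>R X1)" by simp
  then have "Jop ?E X1 = inverse (Im z) *\<^sub>R (X2 - Re z *\<^sub>R X1)" using \<open>Im z \<noteq> 0\<close> by simp
  moreover have "inverse (Im z) *\<^sub>R (X2 - Re z *\<^sub>R X1) \<in> ?T"
    by (intro span_scale span_diff span_base) auto
  ultimately have J1: "Jop ?E X1 \<in> ?T" by simp
  have "Jop ?E X2 = Re z *\<^sub>R Jop ?E X1 + Im z *\<^sub>R (- X1)"
    by (subst X2) (simp add: linear_add[OF linear_Jop] linear_cmul[OF linear_Jop] Jop_in_TG2O(2)[OF E T(2)])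
  moreover have "Re z *\<^sub>R Jop ?E X1 + Im z *\<^sub>R (- X1) \<in> ?T"
    by (intro span_scale span_add span_neg J1) (simp add: span_base)
  ultimately have J2: "Jop ?E X2 \<in> ?T" by simp
  have "J_G2O ?E w \<in> ?T" if w: "w \<in> ?T" for w
  proof -
    have "w \<in> TG2O ?E" using w T(2,3) span_minimal[OF _ subspace_TG2O, of "{X1, X2}" ?E] by auto
    then have "J_G2O ?E w = Jop ?E w" by (rule J_G2O_eq[OF E])
    moreover have "Jop ?E ` ?T \<subseteq> ?T"
      unfolding linear_span_image[OF linear_Jop, symmetric] using J1 J2 by (intro span_minimal) auto
    ultimately show ?thesis using w by auto
  qed
  then show ?thesis unfolding pseudoholomorphic_at_def T(1) uv(1) by blast
qed

text \<open>The numbers \<open>r\<close>, \<open>s\<close> are the coordinates of a point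
  \<open>x\<close> of the ruling plane, and \<open>n1\<close>, \<open>n2\<close> are the
  displacements of \<open>x\<close> up to sign. If they are real independent, the cone is immersed
  at \<open>x\<close>, and its Cayley tangent plane contains \<open>n2\<close> on the complex line
  of \<open>n1\<close>.\<close>

lemma cone_pencil:
  assumes A: "smooth_surface A" and M: "nondegenerate_oriented_cayley_cone A M \<gamma>"
    and uv: "\<gamma> \<sigma> = wedge u v" "norm u = 1" "norm v = 1" "u \<bullet> v = 0"
    and T: "tangent_image A \<gamma> \<sigma> = span {X1, X2}" "X1 \<in> TG2O (wedge u v)" "X2 \<in> TG2O (wedge u v)"
    and n: "n1 = r *\<^sub>R (X1 *v v) + s *\<^sub>R (- (X1 *v u))" "n2 = r *\<^sub>R (X2 *v v) + s *\<^sub>R (- (X2 *v u))" "n1 \<noteq> 0"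
  shows "\<exists>z. n2 = cs (Kop (wedge u v)) z n1"
proof -
  let ?E = "wedge u v" and ?T = "span {X1, X2}"
  define x where "x = r *\<^sub>R u + s *\<^sub>R v"
  have xuv: "u \<bullet> x = r" "v \<bullet> x = s"
    using uv by (simp_all add: x_def inner_add_right inner_commute[of v u] dot_square_norm)
  have cone: "two_ruled_cone A M" "cayley_cone A M" and im: "immersion A \<gamma>"
    and rul: "\<And>\<tau>. \<gamma> \<tau> \<in> G2O \<and> plane_of (\<gamma> \<tau>) = ruling M \<tau>"
    using M by (auto simp: nondegenerate_oriented_cayley_cone_def r_orientation_def)
  have pl: "ruling M \<sigma> = span {u, v}" using rul[of \<sigma>] plane_of_wedge[OF uv(2-4)] uv(1) by simp
  have x: "x \<in> ruling M \<sigma>" unfolding pl x_def by (intro span_add span_scale span_base) auto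
  obtain V e1 e2 where fr: "\<sigma> \<in> V" "ruling_frame A M V e1 e2" using cone(1) unfolding two_ruled_cone_def by blast
  have sm: "smooth_map_on A UNIV \<gamma>" using im by (simp add: immersion_def)
  have ct: "cone_tangent A M (\<sigma>, x) = cone_tan ?E ?T x"
    using cone_tangent_eq[OF A sm rul fr(2,1) x] by (simp add: uv(1) T(1))
  have n1: "X1 *v (?E *v x) = - n1" and n2: "X2 *v (?E *v x) = - n2"
    unfolding TG2O_mult_plane(1)[OF uv(2-4) T(2)] TG2O_mult_plane(1)[OF uv(2-4) T(3)] xuv n by simp_all
  have perp: "u \<bullet> n1 = 0" "v \<bullet> n1 = 0" "u \<bullet> n2 = 0" "v \<bullet> n2 = 0"
    using TG2O_mult_plane(2,3)[OF uv(2-4) T(2), of x] TG2O_mult_plane(2,3)[OF uv(2-4) T(3), of x]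
    unfolding n1 n2 by simp_all
  have C: "p + Y *v (?E *v x) \<in> cone_tan ?E ?T x" if "p \<in> span {u, v}" "Y \<in> ?T" for p Y
    using that unfolding cone_tan_def plane_of_wedge[OF uv(2-4)] by blast
  \<comment> \<open>\<open>k\<close> is the part of \<open>n2\<close> orthogonal to
    \<open>n1\<close>; when it vanishes, a real multiplier suffices.\<close>
  define c where "c = (n2 \<bullet> n1) / (n1 \<bullet> n1)"
  define k where "k = n2 - c *\<^sub>R n1"
  show ?thesis
  proof (cases "k = 0")
    case True
    then show ?thesis by (intro exI[of _ "complex_of_real c"]) (simp add: cs_def k_def)
  next
    case False
    have k: "u \<bullet> (- k) = 0" "v \<bullet> (- k) = 0" "(- n1) \<bullet> (- k) = 0"
      using perp n(3) by (simp_all add: k_def inner_diff_right c_def inner_commute)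
    have "X2 - c *\<^sub>R X1 \<in> ?T" by (intro span_diff span_scale span_base) auto
    from C[OF span_zero this] have kC: "- k \<in> cone_tan ?E ?T x"
      by (simp add: mv_simps n1 n2 k_def)
    have nC: "- n1 \<in> cone_tan ?E ?T x" "- n2 \<in> cone_tan ?E ?T x"
      using C[OF span_zero, of X1] C[OF span_zero, of X2] by (simp_all add: n1 n2 span_base)
    have "0 \<in> ?T" by (rule span_zero)
    from C[OF _ this] have uvC: "u \<in> cone_tan ?E ?T x" "v \<in> cone_tan ?E ?T x" by (simp_all add: span_base)
    have "dim (cone_tan ?E ?T x) = 4"
      by (rule cone_tan_eq_span(1)[OF uv(2-4) refl nC(1) kC]) (use n(3) False perp k in auto)
    then have "(\<sigma>, x) \<in> immersed_points A M" using x ct by (simp add: immersed_points_def ruling_def)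
    then have "cayley_plane (cone_tan ?E ?T x)" using cone(2) ct unfolding cayley_cone_def by metis
    from cayley_plane_line[OF this uvC nC uv(2-4)]
    obtain s t where "- n2 = s *\<^sub>R (- n1) + t *\<^sub>R tc u v (- n1)" using perp n(3) by auto
    then have "- (- n2) = - (s *\<^sub>R (- n1) + t *\<^sub>R tc u v (- n1))" by (rule arg_cong)
    then have "n2 = s *\<^sub>R n1 + t *\<^sub>R tc u v n1" by (simp add: tc_simps)
    then show ?thesis by (intro exI[of _ "Complex s t"]) (simp add: cs_def Kop_wedge)
  qed
qed

text \<open>A frame made from the curve is positively oriented, so the cone condition becomes the
  hypothesis of \<open>locally_planar\<close> in a chart; the ball found there is pulled back to the
  surface.\<close>

lemma cone_planar_or_pseudoholomorphic:
  assumes A: "smooth_surface A" and M: "nondegenerate_oriented_cayley_cone A M \<gamma>"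
  shows "planar_at M \<sigma> \<or> pseudoholomorphic_at A \<gamma> \<sigma>"
proof (rule disjCI)
  assume nh: "\<not> pseudoholomorphic_at A \<gamma> \<sigma>"
  have im: "immersion A \<gamma>" and rul: "\<And>\<tau>. \<gamma> \<tau> \<in> G2O \<and> plane_of (\<gamma> \<tau>) = ruling M \<tau>"
    using M by (auto simp: nondegenerate_oriented_cayley_cone_def r_orientation_def)
  then have rg: "range \<gamma> \<subseteq> G2O" by auto
  have sm: "smooth_map_on A UNIV \<gamma>" using im by (simp add: immersion_def)
  obtain V q where V: "\<sigma> \<in> V" and fr: "ruling_frame A M V (\<lambda>\<tau>. pf1 q (\<gamma> \<tau>)) (\<lambda>\<tau>. pf2 q (\<gamma> \<tau>))"
    and \<gamma>w: "\<And>\<tau>. \<tau> \<in> V \<Longrightarrow> \<gamma> \<tau> = wedge (pf1 q (\<gamma> \<tau>)) (pf2 q (\<gamma> \<tau>))"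
    by (rule ruling_frame_pf[OF A sm rul, of \<sigma>]) blast
  obtain U \<phi> where c: "(U, \<phi>) \<in> A" "\<sigma> \<in> U" using surface_chart_exists[OF A] .
  note cU = surface_chart[OF A c(1)]
  let ?S = "\<phi> ` (U \<inter> V)" and ?\<psi> = "inv_into U \<phi>"
  define f1 where "f1 y = pf1 q (\<gamma> (?\<psi> y))" for y
  define f2 where "f2 y = pf2 q (\<gamma> (?\<psi> y))" for y
  have S: "open ?S" "\<phi> \<sigma> \<in> ?S" using cU(7) fr c V by (auto simp: ruling_frame_def)
  have y: "?\<psi> y \<in> U" "?\<psi> y \<in> V" "\<phi> (?\<psi> y) = y" if "y \<in> ?S" for y using that cU(5) by auto
  have sf: "smooth_on ?S f1" "smooth_on ?S f2"
    unfolding f1_def f2_def using fr c(1) by (auto simp: ruling_frame_def intro: smooth_map_onD)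
  have on: "norm (f1 y) = 1 \<and> norm (f2 y) = 1 \<and> f1 y \<bullet> f2 y = 0" if "y \<in> ?S" for y
    using fr y(2)[OF that] by (auto simp: ruling_frame_def f1_def f2_def)
  have gw: "\<gamma> (?\<psi> y) = wedge (f1 y) (f2 y)" if "y \<in> ?S" for y using \<gamma>w[OF y(2)[OF that]] by (simp add: f1_def f2_def)
  have sg: "smooth_on ?S (\<lambda>y. \<gamma> (?\<psi> y))" by (rule smooth_on_subset_open[OF smooth_map_onD[OF sm c(1)]]) auto
  define X where "X k y = frechet_derivative (\<lambda>y. wedge (f1 y) (f2 y)) (at y) (axis k 1)" for k y
  have Xk: "X k y = frechet_derivative (\<lambda>y. \<gamma> (?\<psi> y)) (at (\<phi> (?\<psi> y))) (axis k 1)" if "y \<in> ?S" for k y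
  proof -
    have "((\<lambda>y. wedge (f1 y) (f2 y)) has_derivative frechet_derivative (\<lambda>y. \<gamma> (?\<psi> y)) (at y)) (at y)"
      by (rule has_derivative_transform_within_open[OF smooth_on_has_derivative[OF sg that] S(1) that]) (rule gw)
    from fun_cong[OF frechet_derivative_at[OF this], of "axis k 1"] show ?thesis by (simp add: X_def y(3)[OF that])
  qed
  have Tw: "X k y \<in> TG2O (wedge (f1 y) (f2 y))" if "y \<in> ?S" for k y
    using immersion_tangent(5)[OF A im rg c(1) y(1)[OF that]] gw[OF that] unfolding Xk[OF that] by metis
  have Ts: "tangent_image A \<gamma> (?\<psi> y) = span {X 1 y, X 2 y}" if "y \<in> ?S" for y
    using immersion_tangent(3)[OF A im rg c(1) y(1)[OF that]] unfolding Xk[OF that] .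
  have Ti: "s = 0 \<and> t = 0" if "y \<in> ?S" "s *\<^sub>R X 1 y + t *\<^sub>R X 2 y = 0" for y s t
    using immersion_tangent(4)[OF A im rg c(1) y(1)[OF that(1)]] that(2) unfolding Xk[OF that(1)] by blast
  have "\<exists>e>0. \<exists>P. cayley_plane P \<and> ball (\<phi> \<sigma>) e \<subseteq> ?S \<and> (\<forall>y\<in>ball (\<phi> \<sigma>) e. span {f1 y, f2 y} \<subseteq> P)"
  proof (rule locally_planar[OF S(1) sf on _ _ S(2), folded X_def])
    show "X 1 y \<noteq> 0" if "y \<in> ?S" for y using Ti[OF that, of 1 0] by auto
    show "\<exists>z. r *\<^sub>R (X 2 y *v f2 y) + s *\<^sub>R (- (X 2 y *v f1 y)) =
        cs (Kop (wedge (f1 y) (f2 y))) z (r *\<^sub>R (X 1 y *v f2 y) + s *\<^sub>R (- (X 1 y *v f1 y)))"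
      if "y \<in> ?S" "r *\<^sub>R (X 1 y *v f2 y) + s *\<^sub>R (- (X 1 y *v f1 y)) \<noteq> 0" for y r s
      using cone_pencil[OF A M gw[OF that(1)] _ _ _ Ts[OF that(1)] Tw[OF that(1)] Tw[OF that(1)] refl refl that(2)] on[OF that(1)]
      by blast
    show False if "X 2 (\<phi> \<sigma>) *v f2 (\<phi> \<sigma>) = cs (Kop (wedge (f1 (\<phi> \<sigma>)) (f2 (\<phi> \<sigma>)))) z (X 1 (\<phi> \<sigma>) *v f2 (\<phi> \<sigma>))"
      "- (X 2 (\<phi> \<sigma>) *v f1 (\<phi> \<sigma>)) = cs (Kop (wedge (f1 (\<phi> \<sigma>)) (f2 (\<phi> \<sigma>)))) z (- (X 1 (\<phi> \<sigma>) *v f1 (\<phi> \<sigma>)))" for z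
    proof -
      have "?\<psi> (\<phi> \<sigma>) = \<sigma>" by (rule cU(5)[OF c(2)])
      then show False
        using complex_multiple_imp_pseudoholomorphic[of \<gamma> \<sigma>, OF _ _ _ _ _ Tw[OF S(2)] Tw[OF S(2)] Ti[OF S(2)] that]
          gw[OF S(2)] on[OF S(2)] Ts[OF S(2)] nh by simp
    qed
  qed auto
  then obtain e P where e: "e > 0" "cayley_plane P" "ball (\<phi> \<sigma>) e \<subseteq> ?S" "\<And>y. y \<in> ball (\<phi> \<sigma>) e \<Longrightarrow> span {f1 y, f2 y} \<subseteq> P" by blast
  define W where "W = U \<inter> \<phi> -` ball (\<phi> \<sigma>) e"
  have "open W" unfolding W_def by (rule continuous_open_preimage[OF cU(3,1) open_ball])
  moreover have "\<sigma> \<in> W" using e(1) c by (simp add: W_def)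
  moreover have "ruling M \<tau> \<subseteq> P" if \<tau>: "\<tau> \<in> W" for \<tau>
  proof -
    have "\<phi> \<tau> \<in> ball (\<phi> \<sigma>) e" "?\<psi> (\<phi> \<tau>) = \<tau>" using \<tau> cU(5) by (auto simp: W_def)
    moreover from this have "\<tau> \<in> V" using e(3) y(2) by force
    ultimately show ?thesis using e(4)[of "\<phi> \<tau>"] fr by (simp add: ruling_frame_def f1_def f2_def)
  qed
  ultimately show "planar_at M \<sigma>" unfolding planar_at_def using e(2) by blast
qed

lemma oriented_cone_eq_swept_cone:
  assumes "r_orientation M \<gamma>"
  shows "M = swept_cone \<gamma>"
proof -
  have "p \<in> M \<longleftrightarrow> snd p \<in> plane_of (\<gamma> (fst p))" for p
    using assms by (simp add: r_orientation_def ruling_def)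
  then show ?thesis by (auto simp: swept_cone_def)
qed

text \<open>The orientation determines the cone as a set, so \<open>swept_cone\<close> inverts the
  map. Away from planar points the dichotomy leaves only pseudoholomorphy.\<close>

lemma cone_curve_bij_betw:
  assumes A: "smooth_surface A"
  shows "bij_betw (\<lambda>(M, \<gamma>). \<gamma>)
    {(M, \<gamma>). nondegenerate_oriented_cayley_cone A M \<gamma> \<and> (\<forall>\<sigma>. \<not> planar_at M \<sigma>)}
    {\<gamma>. immersed_pseudoholomorphic_curve A \<gamma> \<and> (\<forall>\<sigma>. \<not> planar_at (swept_cone \<gamma>) \<sigma>)}"
proof -
  have sw: "M = swept_cone \<gamma>" if "nondegenerate_oriented_cayley_cone A M \<gamma>" for M \<gamma>
    using that oriented_cone_eq_swept_cone by (auto simp: nondegenerate_oriented_cayley_cone_def)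
  have "immersed_pseudoholomorphic_curve A \<gamma>" if "nondegenerate_oriented_cayley_cone A M \<gamma>" "\<forall>\<sigma>. \<not> planar_at M \<sigma>" for M \<gamma>
    using that cone_planar_or_pseudoholomorphic[OF A that(1)]
    by (auto simp: immersed_pseudoholomorphic_curve_def nondegenerate_oriented_cayley_cone_def r_orientation_def)
  then show ?thesis
    by (intro bij_betw_byWitness[where f'="\<lambda>\<gamma>. (swept_cone \<gamma>, \<gamma>)"])
      (use sw swept_cone_nondegenerate[OF A] in auto)
qed

theorem proposition2p1:
  shows
    "homogeneous_space G2O Spin7 act2 U3 \<and>
     almost_complex_structure G2O J_G2O \<and>
     (\<forall>F\<in>Spin7. \<forall>X\<in>tangent_space G2O (frame_plane F). \<forall>Y\<in>tangent_space G2O (frame_plane F).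
        Y = J_G2O (frame_plane F) X \<longleftrightarrow> forms10 F Y = map ((*) \<i>) (forms10 F X)) \<and>
     (\<forall>g\<in>Spin7. \<forall>E\<in>G2O. \<forall>X\<in>tangent_space G2O E.
        J_G2O (act2 g E) (act2 g X) = act2 g (J_G2O E X)) \<and>
     \<not> integrable_acs TYPE(6) G2O J_G2O \<and>
     (\<forall>A :: ('s::{t2_space, second_countable_topology}) surface_atlas. smooth_surface A \<longrightarrow>
        (\<forall>\<gamma>. immersed_pseudoholomorphic_curve A \<gamma> \<longrightarrow>
           nondegenerate_oriented_cayley_cone A (swept_cone \<gamma>) \<gamma>) \<and>
        (\<forall>M \<gamma>. nondegenerate_oriented_cayley_cone A M \<gamma> \<longrightarrow>
           M = swept_cone \<gamma> \<and> (\<forall>\<sigma>. planar_at M \<sigma> \<or> pseudoholomorphic_at A \<gamma> \<sigma>)) \<and>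
        bij_betw (\<lambda>(M, \<gamma>). \<gamma>)
          {(M, \<gamma>). nondegenerate_oriented_cayley_cone A M \<gamma> \<and> (\<forall>\<sigma>. \<not> planar_at M \<sigma>)}
          {\<gamma>. immersed_pseudoholomorphic_curve A \<gamma> \<and> (\<forall>\<sigma>. \<not> planar_at (swept_cone \<gamma>) \<sigma>)})"
proof (intro conjI ballI allI impI)
  show "homogeneous_space G2O Spin7 act2 U3" by (rule homogeneous_space_G2O)
  show "almost_complex_structure G2O J_G2O" by (rule almost_complex_structure_J_G2O)
  show "\<not> integrable_acs TYPE(6) G2O J_G2O" by (rule not_integrable_J_G2O)
next
  fix F X Y assume F: "F \<in> Spin7" and X: "X \<in> tangent_space G2O (frame_plane F)" and Y: "Y \<in> tangent_space G2O (frame_plane F)"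
  then show "Y = J_G2O (frame_plane F) X \<longleftrightarrow> forms10 F Y = map ((*) \<i>) (forms10 F X)"
    by (simp add: tangent_space_G2O frame_plane_in_G2O J_G2O_forms10_iff)
next
  fix g E X assume "g \<in> Spin7" "E \<in> G2O" "X \<in> tangent_space G2O E"
  then show "J_G2O (act2 g E) (act2 g X) = act2 g (J_G2O E X)"
    by (simp add: tangent_space_G2O J_G2O_act2)
next
  fix A :: "'s surface_atlas" assume A: "smooth_surface A"
  show "nondegenerate_oriented_cayley_cone A (swept_cone \<gamma>) \<gamma>" if "immersed_pseudoholomorphic_curve A \<gamma>" for \<gamma>
    by (rule swept_cone_nondegenerate[OF A that])
  show "M = swept_cone \<gamma>" if "nondegenerate_oriented_cayley_cone A M \<gamma>" for M \<gamma>
    using that oriented_cone_eq_swept_cone by (auto simp: nondegenerate_oriented_cayley_cone_def)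
  show "planar_at M \<sigma> \<or> pseudoholomorphic_at A \<gamma> \<sigma>" if "nondegenerate_oriented_cayley_cone A M \<gamma>" for M \<gamma> \<sigma>
    by (rule cone_planar_or_pseudoholomorphic[OF A that])
  show "bij_betw (\<lambda>(M, \<gamma>). \<gamma>)
      {(M, \<gamma>). nondegenerate_oriented_cayley_cone A M \<gamma> \<and> (\<forall>\<sigma>. \<not> planar_at M \<sigma>)}
      {\<gamma>. immersed_pseudoholomorphic_curve A \<gamma> \<and> (\<forall>\<sigma>. \<not> planar_at (swept_cone \<gamma>) \<sigma>)}"
    by (rule cone_curve_bij_betw[OF A])
qed

end
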